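(* Suppose $t\ge5$. Let $d_{\mathrm{plan}}$ be a Class A or a Class B type $\mathcal W_1$ UBRMD with $t$ treatments, $t$ periods and $gt$ subjects, let $d_{\min}$ be the design consisting of its first $t-1$ periods, and let $d_{\mathrm{imp}}$ be any implemented design obtained from $d_{\mathrm{plan}}$ by subject dropout in the final period only. Then the loss of precision due to subject dropout satisfies $$L_{d_{\mathrm{imp}}:d_{\mathrm{plan}}}\le L_{d_{\min}:d_{\mathrm{plan}}}=ML_{d_{\mathrm{plan}}}=1-\frac{(t-1)(t^2-t-1)}{t(t-2)(t+1)}\left(\sum_{r=1}^{t-1}\frac1{\theta_r}\right)^{-1},$$ where, for $r=1,\dots,t-1$, $$\theta_r=\frac{t}{t-1}\left[t-2-\frac{2t\left(1+\cos\frac{2\pi r}{t}\right)}{t(t-3)-2\cos\frac{2\pi r}{t}}\right]\ \text{for Class A},\qquad \theta_r=\frac{t}{t-1}\left[t-2-\frac{t\left(1+\cos\frac{2\pi r}{t}\right)^2}{t(t-3)-2\cos\frac{2\pi r}{t}}\right]\ \text{for Class B}.$$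
   Context: A (crossover) design with $p$ periods, $s$ subjects and $t$ treatments labelled $0,\dots,t-1$ assigns a treatment $d(k,i)$ to each subject $i\in\{1,\dots,s\}$ in each period $k\in\{1,\dots,p\}$; it is viewed as a $p\times s$ array (rows = periods, columns = treatment sequences). It is uniform if each subject receives every treatment in the same number of periods and in each period every treatment is given to the same number of subjects. It is balanced if, in the order of application, each treatment is immediately preceded by every other treatment the same number of times and is never immediately preceded by itself. A UBRMD with $t$ treatments, $t$ periods and $s=gt$ subjects ($g$ a positive integer) is a uniform and balanced such design. For a $t\times t$ array $W$ of treatments, $P_j(W)$ is the $t\times t$ matrix whose $(h,i)$ entry is $1$ if the $(j,i)$ entry of $W$ is $h$, and $0$ otherwise. Class A type $\mathcal W_1$ UBRMD: take a $t\times t$ square $W$ that is a UBRMD, such that $1$ is an eigenvalue of multiplicity one of the permutation matrix $\Pi=P_t(W)P_{t-1}(W)'$; the design $d_{\mathrm{plan}}$ assigns $g$ subjects to each sequence (column) of $W$. Class B type $\mathcal W_1$ UBRMD: ($g$ even) take two $t\times t$ squares $W_1,W_2$ such that the $t\times 2t$ array $(W_1\ W_2)$ is a UBRMD and each treatment appears exactly once in each of the rows $t-1$ and $t$ of each $W_\delta$. Put $\Pi_\delta=P_t(W_\delta)P_{t-1}(W_\delta)'$, $\delta=1,2$ (permutation matrices). Suppose $1$ is an eigenvalue of $\Pi_\delta$ of multiplicity one for $\delta=1,2$, and $\Pi_2=\Pi_1'$. The design $d_{\mathrm{plan}}$ assigns $g/2$ subjects to each sequence (column) of $(W_1\ W_2)$.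 Implemented design: the observations are those of all subjects in periods $1,\dots,t-1$ together with those in period $t$ of an arbitrary (possibly empty or full) subset of the subjects. $d_{\min}$ is the case where no subject is observed in period $t$. Model: $Y=X_S\beta+X_P\alpha+X_D\tau+X_C\rho+\epsilon$ with fixed subject, period, direct treatment and carry-over effects. The rows of the 0–1 matrices $X_S,X_P,X_D,X_C$ are indexed by the available observations (subject $i$, period $k$): the row for $(i,k)$ has its single $1$ in the column of subject $i$ in $X_S$, of period $k$ in $X_P$, of treatment $d(k,i)$ in $X_D$, and of treatment $d(k-1,i)$ in $X_C$ if $k\ge2$; if $k=1$ the row of $X_C$ is zero. The direct-effects information matrix of a design $d$ is the $t\times t$ matrix $C_D^d=X_D'(I-Q)X_D$, where $Q$ is the orthogonal projection onto the column space of $[X_S\ X_P\ X_C]$. A design is connected if $\operatorname{rank}C_D^d=t-1$. For a connected design $d$, $H_d=(t-1)/\operatorname{trace}(C_D^d)^{+}$, where $^+$ is the Moore–Penrose inverse. The loss of precision of a design $d$ relative to $d_{\mathrm{plan}}$ is $L_{d:d_{\mathrm{plan}}}=(H_{d_{\mathrm{plan}}}-H_d)/H_{d_{\mathrm{plan}}}=1-\operatorname{trace}(C_D^{d_{\mathrm{plan}}})^+/\operatorname{trace}(C_D^{d})^+$, and the maximum loss is $ML_{d_{\mathrm{plan}}}=L_{d_{\min}:d_{\mathrm{plan}}}$. Here $'$ is transpose. *)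

theory Defs
  imports Complex_Main "Jordan_Normal_Form.Char_Poly" "Jordan_Normal_Form.DL_Rank"
begin

(* Treatments, periods and subjects are numbered from 0, in agreement with matrix indices:
   the first period is 0, and periods t - 1 and t of the usual numbering are t - 2 and t - 1. *)

section \<open>Crossover designs\<close>

(* Rows are periods, columns are subjects. *)
type_synonym arr = "nat \<Rightarrow> nat \<Rightarrow> nat"

definition uniform_arr :: "nat \<Rightarrow> nat \<Rightarrow> nat \<Rightarrow> arr \<Rightarrow> bool" where
  "uniform_arr t p s W \<longleftrightarrow>
     (\<forall>i<s. \<exists>r. \<forall>h<t. card {k. k < p \<and> W k i = h} = r) \<and>
     (\<forall>k<p. \<exists>r. \<forall>h<t. card {i. i < s \<and> W k i = h} = r)"

definition predecessors :: "nat \<Rightarrow> nat \<Rightarrow> arr \<Rightarrow> nat \<Rightarrow> nat \<Rightarrow> nat" where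
  "predecessors p s W h h' =
     card {(k, i). Suc k < p \<and> i < s \<and> W k i = h' \<and> W (Suc k) i = h}"

definition balanced_arr :: "nat \<Rightarrow> nat \<Rightarrow> nat \<Rightarrow> arr \<Rightarrow> bool" where
  "balanced_arr t p s W \<longleftrightarrow>
     (\<exists>l. \<forall>h<t. \<forall>h'<t. predecessors p s W h h' = (if h = h' then 0 else l))"

definition UBRMD :: "nat \<Rightarrow> nat \<Rightarrow> arr \<Rightarrow> bool" where
  "UBRMD t s W \<longleftrightarrow>
     (\<exists>g>0. s = g * t) \<and> (\<forall>k<t. \<forall>i<s. W k i < t) \<and>
     uniform_arr t t s W \<and> balanced_arr t t s W"

section \<open>Model and information matrix\<close>

record design =
  treatments :: nat
  periods :: nat
  subjects :: nat
  assign :: arr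
  observed :: "(nat \<times> nat) set"  \<comment> \<open>pairs (period, subject)\<close>

(* The order of the observations does not affect the information matrix. *)
definition obs :: "design \<Rightarrow> (nat \<times> nat) list" where
  "obs d = filter (\<lambda>x. x \<in> observed d) (List.product [0..<periods d] [0..<subjects d])"

definition incidence :: "design \<Rightarrow> nat \<Rightarrow> (nat \<Rightarrow> nat \<Rightarrow> nat \<Rightarrow> bool) \<Rightarrow> real mat" where
  "incidence d m R =
     mat (length (obs d)) m (\<lambda>(x, j). case obs d ! x of (k, i) \<Rightarrow> if R k i j then 1 else 0)"

definition X\<^sub>S :: "design \<Rightarrow> real mat" where
  "X\<^sub>S d = incidence d (subjects d) (\<lambda>k i j. i = j)"

definition X\<^sub>P :: "design \<Rightarrow> real mat" where
  "X\<^sub>P d = incidence d (periods d) (\<lambda>k i j. k = j)"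

definition X\<^sub>D :: "design \<Rightarrow> real mat" where
  "X\<^sub>D d = incidence d (treatments d) (\<lambda>k i j. assign d k i = j)"

definition X\<^sub>C :: "design \<Rightarrow> real mat" where
  "X\<^sub>C d = incidence d (treatments d) (\<lambda>k i j. 0 < k \<and> assign d (k - 1) i = j)"

definition orth_proj :: "nat \<Rightarrow> real mat \<Rightarrow> real mat" where
  "orth_proj n Z = (THE Q. Q \<in> carrier_mat n n \<and> Q\<^sup>T = Q \<and> Q * Q = Q \<and>
     vec_space.col_space n Q = vec_space.col_space n Z)"

definition info_matrix :: "design \<Rightarrow> real mat" where
  "info_matrix d =
     (let n = length (obs d);
          Z = mat_of_cols n (cols (X\<^sub>S d) @ cols (X\<^sub>P d) @ cols (X\<^sub>C d))
      in (X\<^sub>D d)\<^sup>T * (1\<^sub>m n - orth_proj n Z) * X\<^sub>D d)"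

definition is_connected :: "design \<Rightarrow> bool" where
  "is_connected d \<longleftrightarrow> vec_space.rank (treatments d) (info_matrix d) = treatments d - 1"

section \<open>Efficiency and loss of precision\<close>

definition mat_trace :: "'a::comm_monoid_add mat \<Rightarrow> 'a" where
  "mat_trace A = (\<Sum>i<dim_row A. A $$ (i, i))"

definition moore_penrose :: "real mat \<Rightarrow> real mat" where
  "moore_penrose A = (THE G. G \<in> carrier_mat (dim_col A) (dim_row A) \<and>
     A * G * A = A \<and> G * A * G = G \<and> (A * G)\<^sup>T = A * G \<and> (G * A)\<^sup>T = G * A)"

(* Efficiency, and hence loss of precision, is defined only for connected designs; for other designs
   the value is left unspecified. *)
definition H_eff :: "design \<Rightarrow> real" where
  "H_eff d = (if is_connected d
     then real (treatments d - 1) / mat_trace (moore_penrose (info_matrix d))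
     else undefined)"

definition loss :: "design \<Rightarrow> design \<Rightarrow> real" where
  "loss d d_plan = (H_eff d_plan - H_eff d) / H_eff d_plan"

section \<open>Dropout in the final period\<close>

(* A is the set of subjects still observed in the final period. If it is empty, the final period
   contributes a zero column to X\<^sub>P, which leaves the information matrix unchanged. *)
definition implemented :: "design \<Rightarrow> nat set \<Rightarrow> design" where
  "implemented d A = d\<lparr>observed :=
     {..<periods d - 1} \<times> {..<subjects d} \<union> {periods d - 1} \<times> A\<rparr>"

definition d_min :: "design \<Rightarrow> design" where
  "d_min d = implemented d {}"

definition max_loss :: "design \<Rightarrow> real" where
  "max_loss d_plan = loss (d_min d_plan) d_plan"

section \<open>The two classes of planned designs\<close>

definition P_mat :: "nat \<Rightarrow> arr \<Rightarrow> nat \<Rightarrow> real mat" where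
  "P_mat t W k = mat t t (\<lambda>(h, i). if W k i = h then 1 else 0)"

definition Pi_mat :: "nat \<Rightarrow> arr \<Rightarrow> real mat" where
  "Pi_mat t W = P_mat t W (t - 1) * (P_mat t W (t - 2))\<^sup>T"

(* Algebraic multiplicity; for permutation matrices it equals the geometric one. *)
definition eigenvalue_one_simple :: "real mat \<Rightarrow> bool" where
  "eigenvalue_one_simple A \<longleftrightarrow> Polynomial.order 1 (char_poly A) = 1"

(* d is fully observed, and each of the m columns of W is used for exactly c subjects,
   the subjects being in any order. *)
definition plan :: "nat \<Rightarrow> nat \<Rightarrow> nat \<Rightarrow> arr \<Rightarrow> design \<Rightarrow> bool" where
  "plan t m c W d \<longleftrightarrow>
     treatments d = t \<and> periods d = t \<and> subjects d = m * c \<and>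
     observed d = {..<t} \<times> {..<m * c} \<and>
     (\<exists>q. (\<forall>i<m * c. q i < m) \<and>
          (\<forall>j<m. card {i. i < m * c \<and> q i = j} = c) \<and>
          (\<forall>k<t. \<forall>i<m * c. assign d k i = W k (q i)))"

definition class_A :: "nat \<Rightarrow> nat \<Rightarrow> design \<Rightarrow> bool" where
  "class_A t g d \<longleftrightarrow> g > 0 \<and>
     (\<exists>W. UBRMD t t W \<and> eigenvalue_one_simple (Pi_mat t W) \<and> plan t t g W d)"

definition juxtapose :: "nat \<Rightarrow> arr \<Rightarrow> arr \<Rightarrow> arr" where
  "juxtapose t W\<^sub>1 W\<^sub>2 = (\<lambda>k i. if i < t then W\<^sub>1 k i else W\<^sub>2 k (i - t))"

definition row_permutation :: "nat \<Rightarrow> arr \<Rightarrow> nat \<Rightarrow> bool" where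
  "row_permutation t W k \<longleftrightarrow> (\<forall>h<t. \<exists>!i. i < t \<and> W k i = h)"

definition class_B :: "nat \<Rightarrow> nat \<Rightarrow> design \<Rightarrow> bool" where
  "class_B t g d \<longleftrightarrow> g > 0 \<and> even g \<and>
     (\<exists>W\<^sub>1 W\<^sub>2. UBRMD t (2 * t) (juxtapose t W\<^sub>1 W\<^sub>2) \<and>
        (\<forall>W\<in>{W\<^sub>1, W\<^sub>2}. row_permutation t W (t - 2) \<and> row_permutation t W (t - 1) \<and>
           eigenvalue_one_simple (Pi_mat t W)) \<and>
        Pi_mat t W\<^sub>2 = (Pi_mat t W\<^sub>1)\<^sup>T \<and>
        plan t (2 * t) (g div 2) (juxtapose t W\<^sub>1 W\<^sub>2) d)"

end

theory Submission
  imports Defs "HOL-Combinatorics.Orbits"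
begin

text \<open>The quadratic form of the information matrix is a minimal residual sum of squares, so it
  grows with the set of observations, and on the complement of the constants the Moore-Penrose
  inverse reverses this order. Hence \<open>d_min\<close> is the worst implemented design. Its information
  matrix is read off explicit solutions of the normal equations: a simple eigenvalue 1 forces the
  transition permutation between the last two periods to be a single cycle, and along this cycle
  the real Fourier vectors \<open>cos (2 \<pi> r k / t - \<delta>)\<close> are eigenvectors with eigenvalues \<open>g \<theta>\<^sub>r\<close>. The same
  equations for all \<open>t\<close> periods give a multiple of the centering matrix.\<close>

section \<open>Orthogonal projections\<close>

text \<open>Efficiency is unspecified for disconnected designs, so every implemented design must be
  shown connected, although its information matrix is never computed. Positive definiteness on
  centred vectors settles this: \<open>d_min\<close> has it because every \<open>\<theta> r\<close>
  is positive, which is where \<open>t \<ge> 5\<close> enters, and it passes to larger quadratic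
  forms. The shape of \<open>\<theta> r\<close> comes from eliminating subject and carry-over
  effects. Balance controls all transitions together; dropping the last period leaves a defect, the
  matrix \<open>N\<close> of last transitions. The carry-over equation then contains the operator
  t(t-3) - N - N', and the amount subtracted from t-2 is t times (1+N')(1+N) divided by that
  operator. On waves of angle \<phi> = 2 pi r / t, N + N' is 2 cos \<phi> in both classes. In Class
  A, N is a permutation matrix and (1+N')(1+N) is 2 + 2 cos \<phi>; in Class B, N is the symmetric
  mean of a permutation matrix and its inverse, hence cos \<phi> itself, and the product is a
  square. Traces are taken over a redundant real frame instead of an orthonormal basis, which avoids
  a case split on the parity of \<open>t\<close>.\<close>

lemma symmetric_mult_vec_scalar_prod:
  fixes Q :: "'a::comm_ring_1 mat"
  assumes "Q \<in> carrier_mat n n" "Q\<^sup>T = Q" "v \<in> carrier_vec n" "w \<in> carrier_vec n"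
  shows "(Q *\<^sub>v v) \<bullet> w = v \<bullet> (Q *\<^sub>v w)"
  using transpose_vec_mult_scalar[of Q n n w v] assms
  by (metis comm_scalar_prod mult_mat_vec_carrier)

lemma mat_eq_on_vecI:
  fixes A :: "'a::comm_ring_1 mat"
  assumes A: "A \<in> carrier_mat n m" and B: "B \<in> carrier_mat n m"
    and eq: "\<And>v. v \<in> carrier_vec m \<Longrightarrow> A *\<^sub>v v = B *\<^sub>v v"
  shows "A = B"
proof (rule eq_matI)
  fix i j assume "i < dim_row B" "j < dim_col B"
  then have ij: "i < n" "j < m" using B by auto
  have "(A *\<^sub>v unit_vec m j) $ i = (B *\<^sub>v unit_vec m j) $ i" using eq by simp
  then show "A $$ (i, j) = B $$ (i, j)" using A B ij by simp
qed (use A B in auto)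

definition outer :: "'a::semiring_0 vec \<Rightarrow> 'a mat" where
  "outer r = mat (dim_vec r) (dim_vec r) (\<lambda>(i, j). r $ i * r $ j)"

lemma outer_carrier: "r \<in> carrier_vec n \<Longrightarrow> outer r \<in> carrier_mat n n"
  by (auto simp: outer_def)

lemma outer_mult_vec:
  fixes r :: "'a::comm_ring_1 vec"
  assumes "r \<in> carrier_vec n" "v \<in> carrier_vec n"
  shows "outer r *\<^sub>v v = (r \<bullet> v) \<cdot>\<^sub>v r"
  by (rule eq_vecI)
    (use assms in \<open>auto simp: outer_def scalar_prod_def sum_distrib_left sum_distrib_right ac_simps\<close>)

lemma scalar_prod_self_eq_0_iff:
  assumes "(v::real vec) \<in> carrier_vec n"
  shows "v \<bullet> v = 0 \<longleftrightarrow> v = 0\<^sub>v n"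
proof
  assume "v \<bullet> v = 0"
  then have "\<forall>i\<in>{0..<n}. v $ i * v $ i = 0"
    using assms by (subst (asm) scalar_prod_def) (auto simp: sum_nonneg_eq_0_iff)
  then show "v = 0\<^sub>v n" using assms by (intro eq_vecI) auto
qed (use assms in auto)

lemma smult_mat_mult_vec:
  fixes A :: "'a::comm_ring_1 mat"
  assumes "A \<in> carrier_mat n m" "v \<in> carrier_vec m"
  shows "(c \<cdot>\<^sub>m A) *\<^sub>v v = c \<cdot>\<^sub>v (A *\<^sub>v v)"
  by (rule eq_vecI) (use assms in \<open>auto simp: scalar_prod_def sum_distrib_left mult.assoc\<close>)

text \<open>Gram-Schmidt on matrices: a new vector \<open>z\<close> adds the rank-one projector onto
  its component \<open>r\<close> orthogonal to the span so far, and nothing if that component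
  vanishes.\<close>

lemma orthogonal_projector_exists:
  fixes vs :: "real vec list"
  assumes "set vs \<subseteq> carrier_vec n"
  shows "\<exists>Q \<in> carrier_mat n n. Q\<^sup>T = Q \<and> Q * Q = Q \<and> (\<forall>z \<in> set vs. Q *\<^sub>v z = z) \<and>
    (\<forall>v \<in> carrier_vec n. Q *\<^sub>v v \<in> module.span class_ring (module_vec TYPE(real) n) (set vs))"
  using assms
proof (induction vs)
  case Nil
  interpret vec_space "TYPE(real)" n .
  show ?case
    by (rule bexI[of _ "0\<^sub>m n n"]) (auto simp: span_empty)
next
  case (Cons z vs)
  interpret vec_space "TYPE(real)" n .
  have z: "z \<in> carrier_vec n" and vs: "set vs \<subseteq> carrier_vec n" using Cons.prems by auto
  have zvs: "set (z # vs) \<subseteq> carrier_vec n" using z vs by auto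
  obtain Q where Q: "Q \<in> carrier_mat n n" and sym: "Q\<^sup>T = Q" and idem: "Q * Q = Q"
    and fxd: "\<forall>z \<in> set vs. Q *\<^sub>v z = z"
    and rng: "\<forall>v \<in> carrier_vec n. Q *\<^sub>v v \<in> span (set vs)"
    using Cons.IH[OF vs] by blast
  have mono: "span (set vs) \<subseteq> span (set (z # vs))" by (rule span_is_monotone) auto
  define r where "r = z - Q *\<^sub>v z"
  have r: "r \<in> carrier_vec n" using Q z by (simp add: r_def)
  have z_eq: "z = Q *\<^sub>v z + r" using Q z by (auto simp: r_def)
  have QQ: "Q *\<^sub>v (Q *\<^sub>v v) = Q *\<^sub>v v" if "v \<in> carrier_vec n" for v
    using Q idem that by (metis assoc_mult_mat_vec)
  have Qr: "Q *\<^sub>v r = 0\<^sub>v n"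
    using Q z QQ[OF z] by (simp add: r_def mult_minus_distrib_mat_vec[of _ n n])
  have orth: "r \<bullet> (Q *\<^sub>v v) = 0" if "v \<in> carrier_vec n" for v
    using symmetric_mult_vec_scalar_prod[OF Q sym r that] Qr that by simp
  show ?case
  proof (cases "r = 0\<^sub>v n")
    case True
    then have "Q *\<^sub>v z = z" using z_eq Q z by (metis mult_mat_vec_carrier right_zero_vec)
    then show ?thesis using Q sym idem fxd rng mono by (intro bexI[of _ Q]) auto
  next
    case False
    then have rr: "r \<bullet> r \<noteq> 0" using scalar_prod_self_eq_0_iff[OF r] by simp
    define P where "P = Q + (1 / (r \<bullet> r)) \<cdot>\<^sub>m outer r"
    have P: "P \<in> carrier_mat n n" using Q outer_carrier[OF r] by (simp add: P_def)
    have Pv: "P *\<^sub>v v = Q *\<^sub>v v + ((r \<bullet> v) / (r \<bullet> r)) \<cdot>\<^sub>v r" if "v \<in> carrier_vec n" for v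
      using Q outer_carrier[OF r] that r
      by (simp add: P_def add_mult_distrib_mat_vec[of _ n n] outer_mult_vec smult_mat_mult_vec[of _ n n]
        smult_smult_assoc)
    have "(a \<cdot>\<^sub>m outer r)\<^sup>T = a \<cdot>\<^sub>m outer r" for a
      by (rule eq_matI) (auto simp: outer_def mult.commute)
    then have symP: "P\<^sup>T = P"
      unfolding P_def using Q sym outer_carrier[OF r]
      by (simp add: transpose_add[of _ n n])
    have fixP: "P *\<^sub>v v = v" if "v \<in> carrier_vec n" "Q *\<^sub>v v = v" for v
    proof -
      have "r \<bullet> v = 0" using orth[OF that(1)] that by simp
      then show ?thesis using Pv[OF that(1)] that r by simp
    qed
    have Pr: "P *\<^sub>v r = r" using Pv[OF r] Qr r rr by simp
    have PPv: "P *\<^sub>v (P *\<^sub>v v) = P *\<^sub>v v" if v: "v \<in> carrier_vec n" for v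
    proof -
      have "P *\<^sub>v (P *\<^sub>v v) = P *\<^sub>v (Q *\<^sub>v v) + ((r \<bullet> v) / (r \<bullet> r)) \<cdot>\<^sub>v (P *\<^sub>v r)"
        unfolding Pv[OF v] using P Q r v by (simp add: mult_add_distrib_mat_vec[of _ n n] mult_mat_vec)
      then show ?thesis using fixP[OF _ QQ[OF v]] Q v Pr Pv[OF v] by simp
    qed
    have "P * P = P"
      by (rule mat_eq_on_vecI[of _ n n]) (use P PPv in auto)
    moreover have "P *\<^sub>v z = z"
    proof -
      have "P *\<^sub>v z = P *\<^sub>v (Q *\<^sub>v z) + P *\<^sub>v r"
        using z_eq P Q z r by (metis mult_add_distrib_mat_vec mult_mat_vec_carrier)
      then show ?thesis using fixP[OF _ QQ[OF z]] Pr Q z z_eq by simp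
    qed
    moreover have "P *\<^sub>v v \<in> span (set (z # vs))" if v: "v \<in> carrier_vec n" for v
    proof -
      have q: "Q *\<^sub>v w \<in> span (set (z # vs))" if "w \<in> carrier_vec n" for w
        using rng mono that by blast
      have zs: "z \<in> span (set (z # vs))" using span_mem[OF zvs] by simp
      have "r = z + (-1) \<cdot>\<^sub>v (Q *\<^sub>v z)" using z Q by (auto simp: r_def)
      then have "r \<in> span (set (z # vs))"
        using span_add1[OF zvs zs smult_in_span[OF zvs q[OF z]]] by simp
      then show ?thesis
        unfolding Pv[OF v] using span_add1[OF zvs q[OF v] smult_in_span[OF zvs]] by simp
    qed
    ultimately show ?thesis using P symP fxd fixP vs by (intro bexI[of _ P]) auto
  qed
qed

text \<open>\<open>orth_proj\<close> is a definite description, so existence and uniqueness must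
  both be settled. A symmetric idempotent fixes its column space; two of them with equal column
  spaces satisfy \<open>A * B = B\<close> and \<open>B * A = A\<close>, and transposing the latter
  gives \<open>A = B\<close>.\<close>

lemma orth_proj_props:
  assumes Z: "Z \<in> carrier_mat n m"
  shows orth_proj_carrier: "orth_proj n Z \<in> carrier_mat n n"
    and orth_proj_symmetric: "(orth_proj n Z)\<^sup>T = orth_proj n Z"
    and orth_proj_fixes: "y \<in> carrier_vec m \<Longrightarrow> orth_proj n Z *\<^sub>v (Z *\<^sub>v y) = Z *\<^sub>v y"
    and orth_proj_range: "v \<in> carrier_vec n \<Longrightarrow> \<exists>y \<in> carrier_vec m. orth_proj n Z *\<^sub>v v = Z *\<^sub>v y"
proof -
  interpret vec_space "TYPE(real)" n .
  let ?P = "\<lambda>Q. Q \<in> carrier_mat n n \<and> Q\<^sup>T = Q \<and> Q * Q = Q \<and> col_space Q = col_space Z"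
  have cols: "set (cols Z) \<subseteq> carrier_vec n" using Z cols_dim by blast
  obtain Q where Q: "Q \<in> carrier_mat n n" "Q\<^sup>T = Q" "Q * Q = Q"
    and fxd: "\<forall>z \<in> set (cols Z). Q *\<^sub>v z = z"
    and rng: "\<forall>v \<in> carrier_vec n. Q *\<^sub>v v \<in> span (set (cols Z))"
    using orthogonal_projector_exists[OF cols] by blast
  have "Q * Z = Z"
  proof (rule mat_col_eqI)
    fix j assume j: "j < dim_col Z"
    then have "col Z j \<in> set (cols Z)" by (metis cols_length cols_nth nth_mem)
    then show "col (Q * Z) j = col Z j" using fxd Q Z j by (subst col_mult2[of _ n n _ m]) auto
  qed (use Q Z in auto)
  then have QZ: "Q *\<^sub>v (Z *\<^sub>v y) = Z *\<^sub>v y" if "y \<in> carrier_vec m" for y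
    using Q(1) Z that by (metis assoc_mult_mat_vec)
  have "col_space Q = col_space Z"
  proof
    show "col_space Q \<subseteq> col_space Z"
      unfolding col_space_eq[OF Q(1)] using rng Q(1) by (auto simp: col_space_def)
    show "col_space Z \<subseteq> col_space Q"
      unfolding col_space_eq[OF Q(1)] col_space_eq[OF Z] using QZ Z Q(1)
      by (auto intro!: bexI[of _ "Z *\<^sub>v _"])
  qed
  then have ex: "?P Q" using Q by simp
  have fixed: "A *\<^sub>v v = v" if "?P A" "v \<in> col_space Z" for A v
  proof -
    have "A \<in> carrier_mat n n" "v \<in> col_space A" using that by simp_all
    then obtain x where "x \<in> carrier_vec n" "A *\<^sub>v x = v" using col_space_eq[of A n] by auto
    then show ?thesis using that(1) by (metis assoc_mult_mat_vec)
  qed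
  have in_cs: "A *\<^sub>v v \<in> col_space Z" if "?P A" "v \<in> carrier_vec n" for A v
  proof -
    have "A *\<^sub>v v \<in> col_space A" using that col_space_eq[of A n] by auto
    then show ?thesis using that by simp
  qed
  have prod: "A * B = B" if "?P A" "?P B" for A B
    by (rule mat_eq_on_vecI[of _ n n]) (use that fixed[OF that(1) in_cs[OF that(2)]] in auto)
  have uniq: "A = B" if "?P A" "?P B" for A B
  proof -
    have "A = A\<^sup>T" using that by simp
    also have "\<dots> = (B * A)\<^sup>T" using prod[OF that(2,1)] by simp
    also have "\<dots> = A\<^sup>T * B\<^sup>T" using that by (simp add: transpose_mult[of _ n n _ n])
    also have "\<dots> = B" using prod[OF that] that by simp
    finally show ?thesis .
  qed
  have P: "?P (orth_proj n Z)"
    unfolding orth_proj_def by (rule theI[of ?P Q]) (use ex uniq in blast)+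
  then show "orth_proj n Z \<in> carrier_mat n n" "(orth_proj n Z)\<^sup>T = orth_proj n Z" by simp_all
  show "orth_proj n Z *\<^sub>v (Z *\<^sub>v y) = Z *\<^sub>v y" if "y \<in> carrier_vec m"
    by (rule fixed[OF P]) (use col_space_eq[OF Z] Z that in auto)
  show "\<exists>y \<in> carrier_vec m. orth_proj n Z *\<^sub>v v = Z *\<^sub>v y" if "v \<in> carrier_vec n"
    using in_cs[OF P that] col_space_eq[OF Z] Z
    by (auto simp: eq_commute[of "orth_proj n Z *\<^sub>v v"])
qed

section \<open>The information matrix as a least-squares minimum\<close>

text \<open>The general element of the column space of the nuisance matrix, as a function on cells
  (period, subject). Least squares can then be done with finite sums over
  \<open>set (obs d)\<close>.\<close>

definition fitted :: "design \<Rightarrow> (nat \<Rightarrow> real) \<Rightarrow> (nat \<Rightarrow> real) \<Rightarrow> (nat \<Rightarrow> real) \<Rightarrow> nat \<times> nat \<Rightarrow> real"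
  where "fitted d a b c =
    (\<lambda>(k, i). a i + b k + (if 0 < k then c (assign d (k - 1) i) else 0))"

definition direct :: "design \<Rightarrow> (nat \<Rightarrow> real) \<Rightarrow> nat \<times> nat \<Rightarrow> real" where
  "direct d x = (\<lambda>(k, i). x (assign d k i))"

definition nuisance :: "design \<Rightarrow> real mat" where
  "nuisance d = mat_of_cols (length (obs d)) (cols (X\<^sub>S d) @ cols (X\<^sub>P d) @ cols (X\<^sub>C d))"

text \<open>A label outside the treatment range would produce a zero row in the direct or carry-over
  matrix, and \<open>direct\<close> and \<open>fitted\<close> would no longer describe the matrix
  products.\<close>

definition valid_assign :: "design \<Rightarrow> bool" where
  "valid_assign d \<longleftrightarrow> (\<forall>k<periods d. \<forall>i<subjects d. assign d k i < treatments d)"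

lemma set_obs: "set (obs d) = {(k, i). k < periods d \<and> i < subjects d \<and> (k, i) \<in> observed d}"
  by (auto simp: obs_def)

lemma distinct_obs: "distinct (obs d)"
  by (simp add: obs_def distinct_product)

definition obs_vec :: "design \<Rightarrow> (nat \<times> nat \<Rightarrow> real) \<Rightarrow> real vec" where
  "obs_vec d F = vec (length (obs d)) (\<lambda>j. F (obs d ! j))"

lemma obs_vec_carrier [simp]: "obs_vec d F \<in> carrier_vec (length (obs d))"
  by (simp add: obs_vec_def)

lemma obs_vec_minus: "obs_vec d F - obs_vec d G = obs_vec d (\<lambda>z. F z - G z)"
  by (rule eq_vecI) (auto simp: obs_vec_def)

lemma obs_vec_scalar_prod: "obs_vec d F \<bullet> obs_vec d G = (\<Sum>z\<in>set (obs d). F z * G z)"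
proof -
  have "obs_vec d F \<bullet> obs_vec d G = (\<Sum>j<length (obs d). F (obs d ! j) * G (obs d ! j))"
    by (simp add: obs_vec_def scalar_prod_def lessThan_atLeast0)
  also have "\<dots> = (\<Sum>z\<in>set (obs d). F z * G z)"
    by (rule sum.reindex_bij_betw[OF bij_betw_nth[OF distinct_obs]]) auto
  finally show ?thesis .
qed

lemma sum_lessThan_add:
  "sum f {..<a + b :: nat} = sum f {..<a} + (\<Sum>l<b. f (a + l))"
  for f :: "nat \<Rightarrow> 'a::comm_monoid_add"
  by (induction b) (auto simp: ac_simps)

lemma X\<^sub>D_carrier: "X\<^sub>D d \<in> carrier_mat (length (obs d)) (treatments d)"
  by (simp add: X\<^sub>D_def incidence_def)

lemma X\<^sub>D_mult_vec:
  assumes "valid_assign d"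
  shows "X\<^sub>D d *\<^sub>v vec (treatments d) x = obs_vec d (direct d x)"
proof (rule eq_vecI)
  fix j assume "j < dim_vec (obs_vec d (direct d x))"
  then have j: "j < length (obs d)" by (simp add: obs_vec_def)
  obtain k i where ki: "obs d ! j = (k, i)" by fastforce
  then have "(k, i) \<in> set (obs d)" using j by (metis nth_mem)
  then have lt: "assign d k i < treatments d" using assms by (auto simp: set_obs valid_assign_def)
  have "row (X\<^sub>D d) j = vec (treatments d) (\<lambda>l. if assign d k i = l then 1 else 0)"
    using j by (simp add: X\<^sub>D_def incidence_def ki)
  then have "(X\<^sub>D d *\<^sub>v vec (treatments d) x) $ j =
      (\<Sum>l\<in>{0..<treatments d}. (if assign d k i = l then 1 else 0) * x l)"
    using j X\<^sub>D_carrier[of d] by (simp add: scalar_prod_def)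
  also have "\<dots> = (\<Sum>l\<in>{0..<treatments d}. if assign d k i = l then x l else 0)"
    by (rule sum.cong) simp_all
  finally show "(X\<^sub>D d *\<^sub>v vec (treatments d) x) $ j = obs_vec d (direct d x) $ j"
    using j ki lt by (simp add: obs_vec_def direct_def)
qed (simp add: X\<^sub>D_def incidence_def obs_vec_def)

lemma nuisance_carrier:
  "nuisance d \<in> carrier_mat (length (obs d)) (subjects d + (periods d + treatments d))"
proof -
  have "length (cols (X\<^sub>S d) @ cols (X\<^sub>P d) @ cols (X\<^sub>C d)) =
      subjects d + (periods d + treatments d)"
    by (simp add: X\<^sub>S_def X\<^sub>P_def X\<^sub>C_def incidence_def)
  then show ?thesis unfolding nuisance_def by (metis mat_of_cols_carrier(1))
qed

lemma nuisance_mult_vec: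
  assumes "valid_assign d" "dim_vec y = subjects d + (periods d + treatments d)"
  shows "nuisance d *\<^sub>v y = obs_vec d (fitted d (\<lambda>i. y $ i) (\<lambda>k. y $ (subjects d + k))
    (\<lambda>h. y $ (subjects d + (periods d + h))))" (is "_ = obs_vec d ?F")
proof (rule eq_vecI)
  fix j assume "j < dim_vec (obs_vec d ?F)"
  then have j: "j < length (obs d)" by (simp add: obs_vec_def)
  obtain k i where ki: "obs d ! j = (k, i)" by fastforce
  then have "(k, i) \<in> set (obs d)" using j by (metis nth_mem)
  then have k: "k < periods d" and i: "i < subjects d"
    and h: "0 < k \<Longrightarrow> assign d (k - 1) i < treatments d"
    using assms by (auto simp: set_obs valid_assign_def)
  let ?M = "\<lambda>l. nuisance d $$ (j, l) * y $ l"
  have len: "length (cols (X\<^sub>S d)) = subjects d" "length (cols (X\<^sub>P d)) = periods d"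
    "length (cols (X\<^sub>C d)) = treatments d"
    by (simp_all add: X\<^sub>S_def X\<^sub>P_def X\<^sub>C_def incidence_def)
  have entry: "nuisance d $$ (j, l) = (cols (X\<^sub>S d) @ cols (X\<^sub>P d) @ cols (X\<^sub>C d)) ! l $ j"
    if "l < subjects d + (periods d + treatments d)" for l
    using that j len by (simp add: nuisance_def mat_of_cols_index)
  have S: "nuisance d $$ (j, l) = (if i = l then 1 else 0)" if "l < subjects d" for l
    using that j ki len by (subst entry) (auto simp: nth_append X\<^sub>S_def incidence_def)
  have P: "nuisance d $$ (j, subjects d + l) = (if k = l then 1 else 0)" if "l < periods d" for l
    using that j ki len by (subst entry) (auto simp: nth_append X\<^sub>P_def incidence_def)
  have C: "nuisance d $$ (j, subjects d + (periods d + l)) =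
      (if 0 < k \<and> assign d (k - 1) i = l then 1 else 0)" if "l < treatments d" for l
    using that j ki len by (subst entry) (auto simp: nth_append X\<^sub>C_def incidence_def)
  have "(nuisance d *\<^sub>v y) $ j = (\<Sum>l<subjects d + (periods d + treatments d). ?M l)"
    using nuisance_carrier[of d] assms(2) j by (simp add: scalar_prod_def lessThan_atLeast0)
  also have "\<dots> = (\<Sum>l<subjects d. ?M l) + ((\<Sum>l<periods d. ?M (subjects d + l)) +
      (\<Sum>l<treatments d. ?M (subjects d + (periods d + l))))"
    by (simp only: sum_lessThan_add)
  also have "(\<Sum>l<subjects d. ?M l) = (\<Sum>l<subjects d. if i = l then y $ l else 0)"
    by (rule sum.cong) (auto simp: S)
  also have "\<dots> = y $ i" using i by simp
  also have "(\<Sum>l<periods d. ?M (subjects d + l)) =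
      (\<Sum>l<periods d. if k = l then y $ (subjects d + l) else 0)"
    by (rule sum.cong) (auto simp: P)
  also have "\<dots> = y $ (subjects d + k)" using k by simp
  also have "(\<Sum>l<treatments d. ?M (subjects d + (periods d + l))) =
      (\<Sum>l<treatments d. if assign d (k - 1) i = l
         then (if 0 < k then y $ (subjects d + (periods d + l)) else 0) else 0)"
    by (rule sum.cong) (auto simp: C)
  also have "\<dots> = (if 0 < k then y $ (subjects d + (periods d + assign d (k - 1) i)) else 0)"
    using h by (cases "0 < k") (simp_all cong: if_cong)
  finally show "(nuisance d *\<^sub>v y) $ j = obs_vec d ?F $ j"
    using j ki by (simp add: obs_vec_def fitted_def)
qed (use nuisance_carrier[of d] in \<open>simp add: obs_vec_def\<close>)

lemma nuisance_range:
  assumes "valid_assign d"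
  shows "y \<in> carrier_vec (subjects d + (periods d + treatments d)) \<Longrightarrow>
      \<exists>a b c. nuisance d *\<^sub>v y = obs_vec d (fitted d a b c)"
    and "\<exists>y \<in> carrier_vec (subjects d + (periods d + treatments d)).
      nuisance d *\<^sub>v y = obs_vec d (fitted d a b c)"
proof -
  show "\<exists>a b c. nuisance d *\<^sub>v y = obs_vec d (fitted d a b c)"
    if "y \<in> carrier_vec (subjects d + (periods d + treatments d))"
    using nuisance_mult_vec[OF assms carrier_vecD[OF that]] by (intro exI)
  define y where "y = vec (subjects d + (periods d + treatments d)) (\<lambda>l.
      if l < subjects d then a l else if l < subjects d + periods d then b (l - subjects d)
      else c (l - (subjects d + periods d)))"
  have "obs_vec d (fitted d (\<lambda>i. y $ i) (\<lambda>k. y $ (subjects d + k))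
      (\<lambda>h. y $ (subjects d + (periods d + h)))) = obs_vec d (fitted d a b c)"
  proof (rule eq_vecI)
    fix j assume "j < dim_vec (obs_vec d (fitted d a b c))"
    then have j: "j < length (obs d)" by (simp add: obs_vec_def)
    obtain k i where ki: "obs d ! j = (k, i)" by fastforce
    then have "(k, i) \<in> set (obs d)" using j by (metis nth_mem)
    then have "k < periods d" "i < subjects d" "0 < k \<Longrightarrow> assign d (k - 1) i < treatments d"
      using assms by (auto simp: set_obs valid_assign_def)
    then show "obs_vec d (fitted d (\<lambda>i. y $ i) (\<lambda>k. y $ (subjects d + k))
      (\<lambda>h. y $ (subjects d + (periods d + h)))) $ j = obs_vec d (fitted d a b c) $ j"
      using j ki by (auto simp: obs_vec_def fitted_def y_def)
  qed (simp add: obs_vec_def)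
  moreover have y: "y \<in> carrier_vec (subjects d + (periods d + treatments d))" by (simp add: y_def)
  ultimately have "nuisance d *\<^sub>v y = obs_vec d (fitted d a b c)"
    using nuisance_mult_vec[OF assms carrier_vecD[OF y]] by simp
  then show "\<exists>y \<in> carrier_vec (subjects d + (periods d + treatments d)).
      nuisance d *\<^sub>v y = obs_vec d (fitted d a b c)"
    using y by blast
qed

lemma info_matrix_eq:
  "info_matrix d = (X\<^sub>D d)\<^sup>T * (1\<^sub>m (length (obs d)) - orth_proj (length (obs d)) (nuisance d)) * X\<^sub>D d"
  by (simp add: info_matrix_def nuisance_def Let_def)

lemma info_matrix_carrier: "info_matrix d \<in> carrier_mat (treatments d) (treatments d)"
  unfolding info_matrix_eq using X\<^sub>D_carrier[of d] by auto

section \<open>Projection onto the nuisance space and its residuals\<close>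

context
  fixes d :: design and n :: nat and Q :: "real mat"
  defines "n \<equiv> length (obs d)" and "Q \<equiv> orth_proj (length (obs d)) (nuisance d)"
  assumes valid: "valid_assign d"
begin

lemma Q_carrier: "Q \<in> carrier_mat n n"
  unfolding Q_def n_def by (rule orth_proj_carrier[OF nuisance_carrier])

lemma Q_symmetric: "Q\<^sup>T = Q"
  unfolding Q_def by (rule orth_proj_symmetric[OF nuisance_carrier])

lemma Q_fixes: "Q *\<^sub>v obs_vec d (fitted d a b c) = obs_vec d (fitted d a b c)"
proof -
  obtain y where y: "y \<in> carrier_vec (subjects d + (periods d + treatments d))"
    and eq: "nuisance d *\<^sub>v y = obs_vec d (fitted d a b c)"
    using nuisance_range(2)[OF valid] by blast
  show ?thesis
    using orth_proj_fixes[OF nuisance_carrier y] unfolding eq Q_def .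
qed

lemma Q_range:
  assumes "v \<in> carrier_vec n"
  shows "\<exists>a b c. Q *\<^sub>v v = obs_vec d (fitted d a b c)"
proof -
  obtain y where y: "y \<in> carrier_vec (subjects d + (periods d + treatments d))"
    and eq: "Q *\<^sub>v v = nuisance d *\<^sub>v y"
    using orth_proj_range[OF nuisance_carrier assms[unfolded n_def]] unfolding Q_def by blast
  show ?thesis unfolding eq by (rule nuisance_range(1)[OF valid y])
qed

lemma info_matrix_Q: "info_matrix d = (X\<^sub>D d)\<^sup>T * (1\<^sub>m n - Q) * X\<^sub>D d"
  by (simp add: info_matrix_eq Q_def n_def)

lemma info_matrix_mult_vec:
  assumes "v \<in> carrier_vec (treatments d)"
  shows "info_matrix d *\<^sub>v v = (X\<^sub>D d)\<^sup>T *\<^sub>v (X\<^sub>D d *\<^sub>v v - Q *\<^sub>v (X\<^sub>D d *\<^sub>v v))"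
proof -
  note X = X\<^sub>D_carrier[of d, folded n_def]
  let ?M = "1\<^sub>m n - Q"
  have M: "?M \<in> carrier_mat n n" by (rule minus_carrier_mat[OF Q_carrier])
  have "info_matrix d *\<^sub>v v = (X\<^sub>D d)\<^sup>T *\<^sub>v (?M *\<^sub>v (X\<^sub>D d *\<^sub>v v))"
    unfolding info_matrix_Q
    using X M assms by (simp add: assoc_mult_mat_vec[of _ "treatments d" n _ "treatments d"])
  also have "?M *\<^sub>v (X\<^sub>D d *\<^sub>v v) = X\<^sub>D d *\<^sub>v v - Q *\<^sub>v (X\<^sub>D d *\<^sub>v v)"
    using X Q_carrier assms by (simp add: minus_mult_distrib_mat_vec[of _ n n])
  finally show ?thesis .
qed

lemma info_matrix_symmetric: "(info_matrix d)\<^sup>T = info_matrix d"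
proof -
  note X = X\<^sub>D_carrier[of d, folded n_def]
  have M: "1\<^sub>m n - Q \<in> carrier_mat n n" by (rule minus_carrier_mat[OF Q_carrier])
  have "(1\<^sub>m n - Q)\<^sup>T = 1\<^sub>m n - Q"
    using Q_carrier Q_symmetric transpose_minus[of "1\<^sub>m n" n n Q] by simp
  then show ?thesis
    unfolding info_matrix_Q
    using X M by (simp add: transpose_mult[of _ "treatments d" n _ "treatments d"]
        transpose_mult[of _ n n _ "treatments d"]
        assoc_mult_mat[of _ "treatments d" n _ n _ "treatments d"])
qed

lemma info_quadratic_form:
  assumes "v \<in> carrier_vec (treatments d)" "w \<in> carrier_vec (treatments d)"
  shows "w \<bullet> (info_matrix d *\<^sub>v v) =
    (X\<^sub>D d *\<^sub>v w) \<bullet> (X\<^sub>D d *\<^sub>v v - Q *\<^sub>v (X\<^sub>D d *\<^sub>v v))"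
proof -
  note X = X\<^sub>D_carrier[of d, folded n_def]
  let ?e = "X\<^sub>D d *\<^sub>v v - Q *\<^sub>v (X\<^sub>D d *\<^sub>v v)"
  have e: "?e \<in> carrier_vec n" using X Q_carrier assms by simp
  have "(X\<^sub>D d)\<^sup>T *\<^sub>v ?e \<in> carrier_vec (treatments d)" using X e by simp
  then have "w \<bullet> ((X\<^sub>D d)\<^sup>T *\<^sub>v ?e) = ((X\<^sub>D d)\<^sup>T *\<^sub>v ?e) \<bullet> w"
    using assms comm_scalar_prod by blast
  also have "\<dots> = ?e \<bullet> (X\<^sub>D d *\<^sub>v w)"
    using transpose_vec_mult_scalar[OF X assms(2) e] by simp
  also have "\<dots> = (X\<^sub>D d *\<^sub>v w) \<bullet> ?e" using e X assms comm_scalar_prod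
    by (metis mult_mat_vec_carrier)
  finally show ?thesis using info_matrix_mult_vec[OF assms(1)] by simp
qed

text \<open>\<open>Q\<close> fixes its own image, so it kills the residual; by symmetry the residual
  is orthogonal to every fit, in particular to \<open>Q *\<^sub>v u\<close>, which yields the last
  equation.\<close>

lemma projection_residual:
  assumes "u = obs_vec d F"
  obtains a b c where "Q *\<^sub>v u = obs_vec d (fitted d a b c)"
    and "\<And>a' b' c'. (u - Q *\<^sub>v u) \<bullet> obs_vec d (fitted d a' b' c') = 0"
    and "u \<bullet> (u - Q *\<^sub>v u) = (u - Q *\<^sub>v u) \<bullet> (u - Q *\<^sub>v u)"
proof -
  have u: "u \<in> carrier_vec n" using assms by (simp add: n_def)
  then obtain a b c where Qu: "Q *\<^sub>v u = obs_vec d (fitted d a b c)" using Q_range by blast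
  let ?e = "u - Q *\<^sub>v u"
  have e: "?e \<in> carrier_vec n" and Quc: "Q *\<^sub>v u \<in> carrier_vec n" using u Q_carrier by auto
  have Qe: "Q *\<^sub>v ?e = 0\<^sub>v n"
  proof -
    have "Q *\<^sub>v ?e = Q *\<^sub>v u - Q *\<^sub>v (Q *\<^sub>v u)"
      using Q_carrier u Quc by (simp add: mult_minus_distrib_mat_vec[of _ n n])
    also have "Q *\<^sub>v (Q *\<^sub>v u) = Q *\<^sub>v u" using Qu Q_fixes by simp
    finally show ?thesis using Quc by simp
  qed
  have orth: "?e \<bullet> obs_vec d (fitted d a' b' c') = 0" for a' b' c'
  proof -
    let ?f = "obs_vec d (fitted d a' b' c')"
    have f: "?f \<in> carrier_vec n" by (simp add: n_def)
    have "?e \<bullet> ?f = ?e \<bullet> (Q *\<^sub>v ?f)" by (simp add: Q_fixes)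
    also have "\<dots> = (Q *\<^sub>v ?e) \<bullet> ?f"
      using symmetric_mult_vec_scalar_prod[OF Q_carrier Q_symmetric e f] by simp
    finally show ?thesis using Qe f by simp
  qed
  have "?e \<bullet> ?e = u \<bullet> ?e - (Q *\<^sub>v u) \<bullet> ?e"
    using u Quc e by (simp add: minus_scalar_prod_distrib[of _ n])
  also have "(Q *\<^sub>v u) \<bullet> ?e = 0"
    using orth[of a b c] Qu comm_scalar_prod[OF Quc e] by simp
  finally show thesis using that[OF Qu orth] by simp
qed

lemma info_le_residual:
  "vec (treatments d) x \<bullet> (info_matrix d *\<^sub>v vec (treatments d) x)
    \<le> (\<Sum>z\<in>set (obs d). (direct d x z - fitted d a b c z)\<^sup>2)"
proof -
  let ?u = "obs_vec d (direct d x)" and ?f = "obs_vec d (fitted d a b c)"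
  let ?e = "?u - Q *\<^sub>v ?u"
  obtain a' b' c' where Qu: "Q *\<^sub>v ?u = obs_vec d (fitted d a' b' c')"
    and orth: "\<And>a b c. (?u - Q *\<^sub>v ?u) \<bullet> obs_vec d (fitted d a b c) = 0"
    and ee: "?u \<bullet> (?u - Q *\<^sub>v ?u) = (?u - Q *\<^sub>v ?u) \<bullet> (?u - Q *\<^sub>v ?u)"
    by (rule projection_residual[where F = "direct d x", OF refl]) (rule that)
  let ?E = "\<lambda>z. direct d x z - fitted d a' b' c' z"
  have e: "?e = obs_vec d ?E" by (simp add: Qu obs_vec_minus)
  have E: "(\<Sum>z\<in>set (obs d). ?E z * fitted d a b c z) = 0" for a b c
    using orth[of a b c] by (simp add: e obs_vec_scalar_prod)
  have "vec (treatments d) x \<bullet> (info_matrix d *\<^sub>v vec (treatments d) x) = ?e \<bullet> ?e"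
    using info_quadratic_form[of "vec (treatments d) x" "vec (treatments d) x"] ee
    by (simp add: X\<^sub>D_mult_vec[OF valid])
  also have "\<dots> = (\<Sum>z\<in>set (obs d). (?E z)\<^sup>2)"
    by (simp add: e obs_vec_scalar_prod power2_eq_square)
  also have "\<dots> \<le> (\<Sum>z\<in>set (obs d). (?E z)\<^sup>2) +
      (\<Sum>z\<in>set (obs d). (fitted d a' b' c' z - fitted d a b c z)\<^sup>2)"
    by (simp add: sum_nonneg)
  \<comment> \<open>Pythagoras: the inserted cross terms sum to zero and complete the square of the
    optimal residual plus the difference of the two fits.\<close>
  also have "\<dots> = (\<Sum>z\<in>set (obs d). (?E z)\<^sup>2 + 2 * (?E z * fitted d a' b' c' z) -
      2 * (?E z * fitted d a b c z) + (fitted d a' b' c' z - fitted d a b c z)\<^sup>2)"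
    using E by (simp add: sum.distrib sum_subtractf sum_distrib_left[symmetric])
  also have "\<dots> = (\<Sum>z\<in>set (obs d). (direct d x z - fitted d a b c z)\<^sup>2)"
    by (rule sum.cong) (auto simp: power2_eq_square algebra_simps)
  finally show ?thesis .
qed

lemma info_eq_residual:
  "\<exists>a b c. vec (treatments d) x \<bullet> (info_matrix d *\<^sub>v vec (treatments d) x)
    = (\<Sum>z\<in>set (obs d). (direct d x z - fitted d a b c z)\<^sup>2)"
proof -
  let ?u = "obs_vec d (direct d x)"
  let ?e = "?u - Q *\<^sub>v ?u"
  obtain a b c where Qu: "Q *\<^sub>v ?u = obs_vec d (fitted d a b c)" and orth: "\<And>a b c. (?u - Q *\<^sub>v ?u) \<bullet> obs_vec d (fitted d a b c) = 0"
    and ee: "?u \<bullet> (?u - Q *\<^sub>v ?u) = (?u - Q *\<^sub>v ?u) \<bullet> (?u - Q *\<^sub>v ?u)"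
    by (rule projection_residual[where F = "direct d x", OF refl]) (rule that)
  have "vec (treatments d) x \<bullet> (info_matrix d *\<^sub>v vec (treatments d) x) = ?e \<bullet> ?e"
    using info_quadratic_form[of "vec (treatments d) x" "vec (treatments d) x"] ee
    by (simp add: X\<^sub>D_mult_vec[OF valid])
  also have "\<dots> = (\<Sum>z\<in>set (obs d). (direct d x z - fitted d a b c z)\<^sup>2)"
    by (simp add: Qu obs_vec_minus obs_vec_scalar_prod power2_eq_square)
  finally show ?thesis by blast
qed

text \<open>Effects are not identifiable, but fits are: any solution of the normal equations has the
  fit given by the projection. So a guessed solution suffices, and the free vector \<open>w\<close>
  reads off the whole image of \<open>x\<close>.\<close>

lemma info_normal_equations:
  assumes normal: "\<And>a' b' c'.
    (\<Sum>z\<in>set (obs d). (direct d x z - fitted d a b c z) * fitted d a' b' c' z) = 0"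
  shows "vec (treatments d) w \<bullet> (info_matrix d *\<^sub>v vec (treatments d) x)
    = (\<Sum>z\<in>set (obs d). (direct d x z - fitted d a b c z) * direct d w z)"
proof -
  let ?u = "obs_vec d (direct d x)" and ?f = "obs_vec d (fitted d a b c)"
  obtain a' b' c' where Qu: "Q *\<^sub>v ?u = obs_vec d (fitted d a' b' c')"
    and orth: "\<And>a b c. (?u - Q *\<^sub>v ?u) \<bullet> obs_vec d (fitted d a b c) = 0"
    and ee: "?u \<bullet> (?u - Q *\<^sub>v ?u) = (?u - Q *\<^sub>v ?u) \<bullet> (?u - Q *\<^sub>v ?u)"
    by (rule projection_residual[where F = "direct d x", OF refl]) (rule that)
  let ?E = "\<lambda>z. direct d x z - fitted d a' b' c' z"
  have E: "(\<Sum>z\<in>set (obs d). ?E z * fitted d a b c z) = 0" for a b c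
    using orth[of a b c] by (simp add: Qu obs_vec_minus obs_vec_scalar_prod)
  \<comment> \<open>The difference of the fits is also the difference of the residuals, so its
    square splits into four products of a residual with a fit, each summing to zero.\<close>
  have "(\<Sum>z\<in>set (obs d). (fitted d a b c z - fitted d a' b' c' z)\<^sup>2) =
      (\<Sum>z\<in>set (obs d). ?E z * fitted d a b c z - ?E z * fitted d a' b' c' z
        - (direct d x z - fitted d a b c z) * fitted d a b c z
        + (direct d x z - fitted d a b c z) * fitted d a' b' c' z)"
    by (rule sum.cong) (auto simp: power2_eq_square algebra_simps)
  also have "\<dots> = 0" using E normal by (simp add: sum.distrib sum_subtractf)
  finally have eq: "fitted d a b c z = fitted d a' b' c' z" if "z \<in> set (obs d)" for z
    using that by (subst (asm) sum_nonneg_eq_0_iff) auto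
  have "vec (treatments d) w \<bullet> (info_matrix d *\<^sub>v vec (treatments d) x) =
      obs_vec d (direct d w) \<bullet> (?u - Q *\<^sub>v ?u)"
    using info_quadratic_form[of "vec (treatments d) x" "vec (treatments d) w"]
    by (simp add: X\<^sub>D_mult_vec[OF valid])
  also have "\<dots> = (\<Sum>z\<in>set (obs d). direct d w z * ?E z)"
    by (simp add: Qu obs_vec_minus obs_vec_scalar_prod)
  also have "\<dots> = (\<Sum>z\<in>set (obs d). (direct d x z - fitted d a b c z) * direct d w z)"
    by (rule sum.cong) (auto simp: eq)
  finally show ?thesis .
qed

end

text \<open>A constant direct effect is fitted exactly by constant subject effects, so the residual
  vanishes.\<close>

lemma info_matrix_one:
  assumes "valid_assign d"
  shows "info_matrix d *\<^sub>v vec (treatments d) (\<lambda>_. 1) = 0\<^sub>v (treatments d)"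
proof -
  define v where "v = info_matrix d *\<^sub>v vec (treatments d) (\<lambda>_. 1)"
  have v: "v \<in> carrier_vec (treatments d)" using info_matrix_carrier[of d] by (simp add: v_def)
  have "vec (treatments d) w \<bullet> v = 0" for w
    using info_normal_equations[OF assms, of "\<lambda>_. 1" "\<lambda>_. 1" "\<lambda>_. 0" "\<lambda>_. 0" w]
    by (simp add: v_def direct_def fitted_def case_prod_unfold)
  moreover have "vec (treatments d) (\<lambda>i. v $ i) = v" by (rule eq_vecI) (use v in auto)
  ultimately have "v \<bullet> v = 0" by metis
  then show ?thesis using scalar_prod_self_eq_0_iff[OF v] by (simp add: v_def)
qed

text \<open>The best fit for the larger set of observations is a competitor for the smaller set,
  where fewer squares are added.\<close>

lemma info_matrix_mono:
  assumes "valid_assign d" "valid_assign d'" "treatments d' = treatments d"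
    "assign d' = assign d" "set (obs d) \<subseteq> set (obs d')"
  shows "vec (treatments d) x \<bullet> (info_matrix d *\<^sub>v vec (treatments d) x)
    \<le> vec (treatments d) x \<bullet> (info_matrix d' *\<^sub>v vec (treatments d) x)"
proof -
  obtain a b c where *: "vec (treatments d) x \<bullet> (info_matrix d' *\<^sub>v vec (treatments d) x)
      = (\<Sum>z\<in>set (obs d'). (direct d' x z - fitted d' a b c z)\<^sup>2)"
    using info_eq_residual[OF assms(2)] assms(3) by metis
  have "vec (treatments d) x \<bullet> (info_matrix d *\<^sub>v vec (treatments d) x)
      \<le> (\<Sum>z\<in>set (obs d). (direct d x z - fitted d a b c z)\<^sup>2)"
    by (rule info_le_residual[OF assms(1)])
  also have "\<dots> = (\<Sum>z\<in>set (obs d). (direct d' x z - fitted d' a b c z)\<^sup>2)"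
    by (rule sum.cong) (auto simp: direct_def fitted_def assms(4))
  also have "\<dots> \<le> (\<Sum>z\<in>set (obs d'). (direct d' x z - fitted d' a b c z)\<^sup>2)"
    by (rule sum_mono2) (use assms(5) in auto)
  finally show ?thesis using * by simp
qed

section \<open>Moore-Penrose inverses of centred positive definite matrices\<close>

definition one_vec :: "nat \<Rightarrow> real vec" where
  "one_vec t = vec t (\<lambda>_. 1)"

definition avg :: "nat \<Rightarrow> real mat" where
  "avg t = mat t t (\<lambda>_. 1 / real t)"

text \<open>Connectedness in a form suited to comparison: it gives rank \<open>t - 1\<close>
  (\<open>centered_pd_rank\<close>) and is inherited by every symmetric matrix that kills the
  constants and has a larger quadratic form.\<close>

definition centered_pd :: "nat \<Rightarrow> real mat \<Rightarrow> bool" where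
  "centered_pd t C \<longleftrightarrow> C \<in> carrier_mat t t \<and> C\<^sup>T = C \<and> C *\<^sub>v one_vec t = 0\<^sub>v t \<and>
     (\<forall>v \<in> carrier_vec t. v \<noteq> 0\<^sub>v t \<longrightarrow> one_vec t \<bullet> v = 0 \<longrightarrow> v \<bullet> (C *\<^sub>v v) > 0)"

lemma one_vec_carrier [simp]: "one_vec t \<in> carrier_vec t"
  by (simp add: one_vec_def)

lemma avg_carrier [simp]: "avg t \<in> carrier_mat t t"
  by (simp add: avg_def)

lemma avg_mult_vec: "v \<in> carrier_vec t \<Longrightarrow> avg t *\<^sub>v v = ((one_vec t \<bullet> v) / real t) \<cdot>\<^sub>v one_vec t"
  by (rule eq_vecI)
    (auto simp: avg_def one_vec_def scalar_prod_def sum_divide_distrib)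

lemma avg_transpose: "(avg t)\<^sup>T = avg t"
  by (rule eq_matI) (auto simp: avg_def)

lemma one_one: "one_vec t \<bullet> one_vec t = real t"
  by (simp add: one_vec_def scalar_prod_def)

lemma smult_zero_vec [simp]: "(a::'a::mult_zero) \<cdot>\<^sub>v 0\<^sub>v t = 0\<^sub>v t"
  by (rule eq_vecI) auto

lemma zero_smult_vec: "v \<in> carrier_vec t \<Longrightarrow> (0::'a::mult_zero) \<cdot>\<^sub>v v = 0\<^sub>v t"
  by (rule eq_vecI) auto

lemma zero_mat_mult_vec: "v \<in> carrier_vec m \<Longrightarrow> 0\<^sub>m t m *\<^sub>v v = (0\<^sub>v t :: 'a::semiring_0 vec)"
  by (rule eq_vecI) (auto simp: scalar_prod_def)

lemma minus_zero_mat: "A \<in> carrier_mat n m \<Longrightarrow> A - 0\<^sub>m n m = (A :: 'a::group_add mat)"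
  by (rule eq_matI) auto

lemma smult_one_zero: "C \<in> carrier_mat t t \<Longrightarrow> C *\<^sub>v one_vec t = 0\<^sub>v t \<Longrightarrow>
    C *\<^sub>v (a \<cdot>\<^sub>v one_vec t) = 0\<^sub>v t"
  by (simp add: mult_mat_vec[of _ t t])

lemma avg_idem: assumes "0 < t" shows "avg t * avg t = avg t"
  by (rule mat_eq_on_vecI[of _ t t])
    (use assms in \<open>simp_all add: avg_mult_vec one_one smult_smult_assoc
      mult_carrier_mat[of _ t t] assoc_mult_mat_vec[of _ t t _ t] mult_mat_vec[of _ t t]\<close>)

lemma mult_avg_zero:
  assumes "C \<in> carrier_mat t t" "C *\<^sub>v one_vec t = 0\<^sub>v t"
  shows "C * avg t = 0\<^sub>m t t"
  by (rule mat_eq_on_vecI[of _ t t])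
    (use assms in \<open>simp_all add: avg_mult_vec smult_one_zero zero_mat_mult_vec
      mult_carrier_mat[of _ t t] assoc_mult_mat_vec[of _ t t _ t]\<close>)

text \<open>Penrose's argument: \<open>G * C\<close> equals \<open>(G * C) * (H * C)\<close>; both
  factors are symmetric, so transposing swaps them and the product collapses to
  \<open>H * C\<close>. The same on the other side gives \<open>C * G = C * H\<close>.\<close>

lemma moore_penrose_unique:
  fixes C :: "real mat"
  assumes C: "C \<in> carrier_mat n n"
    and G: "G \<in> carrier_mat n n" "C * G * C = C" "G * C * G = G" "(C * G)\<^sup>T = C * G" "(G * C)\<^sup>T = G * C"
    and H: "H \<in> carrier_mat n n" "C * H * C = C" "H * C * H = H" "(C * H)\<^sup>T = C * H" "(H * C)\<^sup>T = H * C"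
  shows "G = H"
proof -
  have carr: "G * C \<in> carrier_mat n n" "H * C \<in> carrier_mat n n" "C * G \<in> carrier_mat n n"
    "C * H \<in> carrier_mat n n"
    using C G(1) H(1) by (auto intro: mult_carrier_mat[of _ n n _ n])
  note assoc = assoc_mult_mat[of _ n n _ n _ n]
  have "G * C = G * (C * H * C)" using H by simp
  also have "\<dots> = (G * C) * (H * C)" using C G(1) H(1) by (simp add: assoc)
  finally have "(G * C)\<^sup>T = (H * C)\<^sup>T * (G * C)\<^sup>T"
    using transpose_mult[OF carr(1,2)] by metis
  also have "\<dots> = H * (C * G * C)" unfolding G(5) H(5) using C G(1) H(1) by (simp add: assoc)
  finally have GC: "G * C = H * C" using G by simp
  have "C * G = (C * H * C) * G" using H by simp
  also have "\<dots> = (C * H) * (C * G)" using C G(1) H(1) by (simp add: assoc)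
  finally have "(C * G)\<^sup>T = (C * G)\<^sup>T * (C * H)\<^sup>T"
    using transpose_mult[OF carr(4,3)] by metis
  also have "\<dots> = (C * G * C) * H" unfolding G(4) H(4) using C G(1) H(1) by (simp add: assoc)
  finally have CG: "C * G = C * H" using G by simp
  have "G = G * C * G" using G by simp
  also have "\<dots> = H * (C * G)" using GC C G(1) H(1) by (simp add: assoc)
  also have "\<dots> = H" using CG C H by (simp add: assoc)
  finally show ?thesis .
qed

text \<open>Pairing a kernel vector with the constants removes the \<open>C\<close> part and shows
  that the vector is centred; there \<open>C\<close> is definite, so the vector is zero.\<close>

lemma centered_pd_regular:
  assumes "centered_pd t C" "0 < t"
  shows "det (C + avg t) \<noteq> 0"
proof
  have C: "C \<in> carrier_mat t t" "C\<^sup>T = C" "C *\<^sub>v one_vec t = 0\<^sub>v t"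
    and pd: "\<And>v. v \<in> carrier_vec t \<Longrightarrow> v \<noteq> 0\<^sub>v t \<Longrightarrow> one_vec t \<bullet> v = 0 \<Longrightarrow> v \<bullet> (C *\<^sub>v v) > 0"
    using assms by (auto simp: centered_pd_def)
  assume "det (C + avg t) = 0"
  moreover have "C + avg t \<in> carrier_mat t t" using C by simp
  ultimately obtain v where v: "v \<in> carrier_vec t" "v \<noteq> 0\<^sub>v t" "(C + avg t) *\<^sub>v v = 0\<^sub>v t"
    using det_0_iff_vec_prod_zero_field by blast
  let ?a = "(one_vec t \<bullet> v) / real t"
  have eq: "C *\<^sub>v v + ?a \<cdot>\<^sub>v one_vec t = 0\<^sub>v t"
    using v C by (simp add: add_mult_distrib_mat_vec[of _ t t] avg_mult_vec)
  have Cv: "C *\<^sub>v v \<in> carrier_vec t" using C v by simp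
  have "one_vec t \<bullet> (C *\<^sub>v v) = 0"
    using symmetric_mult_vec_scalar_prod[OF C(1,2) one_vec_carrier v(1)] C(3) v by simp
  then have "one_vec t \<bullet> (C *\<^sub>v v + ?a \<cdot>\<^sub>v one_vec t) = one_vec t \<bullet> v"
    using Cv assms(2) by (simp add: scalar_prod_add_distrib[of _ t] one_one)
  then have one: "one_vec t \<bullet> v = 0" using eq by simp
  then have "C *\<^sub>v v = 0\<^sub>v t" using eq Cv by (simp add: zero_smult_vec[OF one_vec_carrier])
  then show False using pd[OF v(1,2) one] v by simp
qed

text \<open>The pseudoinverse is \<open>B - avg t\<close> with \<open>B\<close> the inverse of
  \<open>C + avg t\<close>. Since \<open>C\<close> and \<open>avg t\<close> annihilate each other,
  \<open>B\<close> is the identity on constants, and subtracting \<open>avg t\<close> leaves zero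
  there and the inverse of \<open>C\<close> on centred vectors.\<close>

lemma centered_pd_pinv:
  assumes cpd: "centered_pd t C" and t: "0 < t"
  obtains G where "moore_penrose C = G" "G \<in> carrier_mat t t" "G\<^sup>T = G"
    "C * G = 1\<^sub>m t - avg t" "G * C = 1\<^sub>m t - avg t" "G *\<^sub>v one_vec t = 0\<^sub>v t" "G * C * G = G"
proof -
  note [simp] = assoc_mult_mat[of _ t t _ t _ t]
  have C: "C \<in> carrier_mat t t" "C\<^sup>T = C" "C *\<^sub>v one_vec t = 0\<^sub>v t"
    using cpd by (auto simp: centered_pd_def)
  define A where "A = C + avg t"
  have A: "A \<in> carrier_mat t t" using C by (simp add: A_def)
  have "det A \<noteq> 0" unfolding A_def by (rule centered_pd_regular[OF cpd t])
  from det_non_zero_imp_unit[OF A this, of "()"]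
  obtain B where B: "B \<in> carrier_mat t t" and BA: "B * A = 1\<^sub>m t" and AB: "A * B = 1\<^sub>m t"
    by (auto simp: Units_def ring_mat_def)
  let ?J = "avg t"
  have CJ: "C * ?J = 0\<^sub>m t t" by (rule mult_avg_zero[OF C(1,3)])
  have JC: "?J * C = 0\<^sub>m t t"
    using arg_cong[OF CJ, of transpose_mat] transpose_mult[OF C(1) avg_carrier] C(2)
    by (simp add: avg_transpose)
  have JJ: "?J * ?J = ?J" by (rule avg_idem[OF t])
  have AJ: "A * ?J = ?J" using CJ JJ C by (simp add: A_def add_mult_distrib_mat[of _ t t _ _ t])
  have JA: "?J * A = ?J" using JC JJ C by (simp add: A_def mult_add_distrib_mat[of _ t t _ t])
  have BJ: "B * ?J = ?J"
  proof -
    have "B * ?J = B * (A * ?J)" using AJ by simp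
    also have "\<dots> = (B * A) * ?J" using A B by simp
    finally show ?thesis unfolding BA by (simp only: left_mult_one_mat[OF avg_carrier])
  qed
  have JB: "?J * B = ?J"
  proof -
    have "?J * B = (?J * A) * B" using JA by simp
    also have "\<dots> = ?J * (A * B)" using A B by simp
    finally show ?thesis unfolding AB by (simp only: right_mult_one_mat[OF avg_carrier])
  qed
  have symA: "A\<^sup>T = A" using C by (simp add: A_def transpose_add[of _ t t] avg_transpose)
  have symB: "B\<^sup>T = B"
  proof -
    have "B\<^sup>T * A = 1\<^sub>m t" using arg_cong[OF AB, of transpose_mat] transpose_mult[OF A B] symA by simp
    then have "B = (B\<^sup>T * A) * B" using B by simp
    also have "\<dots> = B\<^sup>T * (A * B)" using A B by simp
    finally show ?thesis using AB B by simp
  qed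
  define G where "G = B - ?J"
  have G: "G \<in> carrier_mat t t" by (simp add: G_def minus_carrier_mat)
  have C_eq: "C = A - ?J" by (rule eq_matI) (use C in \<open>auto simp: A_def avg_def\<close>)
  have symG: "G\<^sup>T = G" using B symB by (simp add: G_def transpose_minus[of _ t t] avg_transpose)
  have AG: "A * G = 1\<^sub>m t - ?J" using A B AB AJ by (simp add: G_def mult_minus_distrib_mat[of _ t t _ t])
  have JG: "?J * G = 0\<^sub>m t t" using B JB JJ by (simp add: G_def mult_minus_distrib_mat[of _ t t _ t])
  have CG: "C * G = 1\<^sub>m t - ?J"
    using A G AG JG minus_zero_mat[OF minus_carrier_mat[OF avg_carrier]]
    by (simp add: C_eq minus_mult_distrib_mat[of _ t t _ _ t])
  have GC: "G * C = 1\<^sub>m t - ?J"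
    using arg_cong[OF CG, of transpose_mat] transpose_mult[OF C(1) G] C(2) symG
    by (simp add: transpose_minus[of _ t t] avg_transpose)
  have CGC: "C * G * C = C"
    unfolding CG using C(1) JC by (simp add: minus_zero_mat minus_mult_distrib_mat[of _ t t _ _ t])
  have GCG: "G * C * G = G"
    unfolding GC using G JG by (simp add: minus_zero_mat minus_mult_distrib_mat[of _ t t _ _ t])
  have sym: "(1\<^sub>m t - ?J)\<^sup>T = 1\<^sub>m t - ?J" by (simp add: transpose_minus[of _ t t] avg_transpose)
  have GJ: "G * ?J = 0\<^sub>m t t" using B BJ JJ by (simp add: G_def minus_mult_distrib_mat[of _ t t _ _ t])
  have "?J *\<^sub>v one_vec t = one_vec t" using t by (simp add: avg_mult_vec one_one)
  then have "G *\<^sub>v one_vec t = G *\<^sub>v (?J *\<^sub>v one_vec t)" by simp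
  also have "\<dots> = (G * ?J) *\<^sub>v one_vec t"
    using G by (simp add: assoc_mult_mat_vec[of _ t t _ t])
  finally have G1: "G *\<^sub>v one_vec t = 0\<^sub>v t" by (simp add: GJ zero_mat_mult_vec)
  have "moore_penrose C = G"
    unfolding moore_penrose_def
  proof (rule the_equality)
    show "G \<in> carrier_mat (dim_col C) (dim_row C) \<and> C * G * C = C \<and> G * C * G = G \<and>
        (C * G)\<^sup>T = C * G \<and> (G * C)\<^sup>T = G * C"
      using C G CGC GCG CG GC sym by auto
    fix H assume "H \<in> carrier_mat (dim_col C) (dim_row C) \<and> C * H * C = C \<and> H * C * H = H \<and>
        (C * H)\<^sup>T = C * H \<and> (H * C)\<^sup>T = H * C"
    then show "H = G"
      using moore_penrose_unique[OF C(1), of H G] C G CGC GCG CG GC sym by auto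
  qed
  then show thesis using that G symG CG GC G1 GCG by blast
qed

lemma mat_trace_unit:
  fixes G :: "real mat"
  assumes "G \<in> carrier_mat t t"
  shows "mat_trace G = (\<Sum>h<t. unit_vec t h \<bullet> (G *\<^sub>v unit_vec t h))"
proof -
  have "G $$ (h, h) = unit_vec t h \<bullet> (G *\<^sub>v unit_vec t h)" if "h < t" for h
  proof -
    have "unit_vec t h \<bullet> (G *\<^sub>v unit_vec t h) = (G *\<^sub>v unit_vec t h) $ h"
      by (rule scalar_prod_left_unit[OF _ that]) (use assms in simp)
    then show ?thesis using assms that by simp
  qed
  then show ?thesis using assms by (simp add: mat_trace_def)
qed

lemma centered_pd_quadratic:
  fixes e :: "real vec"
  assumes C: "C \<in> carrier_mat t t" and G: "G \<in> carrier_mat t t" "G\<^sup>T = G" "G * C * G = G"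
    and e: "e \<in> carrier_vec t"
  shows "(G *\<^sub>v e) \<bullet> (C *\<^sub>v (G *\<^sub>v e)) = e \<bullet> (G *\<^sub>v e)"
proof -
  have "(G *\<^sub>v e) \<bullet> (C *\<^sub>v (G *\<^sub>v e)) = e \<bullet> (G *\<^sub>v (C *\<^sub>v (G *\<^sub>v e)))"
    using C G e by (intro symmetric_mult_vec_scalar_prod[of _ t]) auto
  also have "G *\<^sub>v (C *\<^sub>v (G *\<^sub>v e)) = (G * C * G) *\<^sub>v e"
    using C G(1) e by (simp add: assoc_mult_mat_vec[of _ t t _ t])
  finally show ?thesis using G by simp
qed

text \<open>With \<open>y\<^sub>i = G\<^sub>i e\<close> the quadratic form of \<open>C\<^sub>1\<close> at \<open>y\<^sub>1 - y\<^sub>2\<close> is at most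
  \<open>e \<bullet> G\<^sub>1 e - e \<bullet> G\<^sub>2 e\<close>.\<close>
lemma trace_pinv_antimono:
  assumes C1: "centered_pd t C1" and C2: "centered_pd t C2" and t: "0 < t"
    and le: "\<And>v. v \<in> carrier_vec t \<Longrightarrow> v \<bullet> (C1 *\<^sub>v v) \<le> v \<bullet> (C2 *\<^sub>v v)"
  shows "mat_trace (moore_penrose C2) \<le> mat_trace (moore_penrose C1)"
proof -
  have C: "C1 \<in> carrier_mat t t" "C2 \<in> carrier_mat t t" "C1\<^sup>T = C1" "C1 *\<^sub>v one_vec t = 0\<^sub>v t"
    using C1 C2 by (auto simp: centered_pd_def)
  have psd: "v \<bullet> (C1 *\<^sub>v v) \<ge> 0" if "v \<in> carrier_vec t" "one_vec t \<bullet> v = 0" for v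
  proof (cases "v = 0\<^sub>v t")
    case True
    then show ?thesis using C by simp
  next
    case False
    then show ?thesis using C1 that unfolding centered_pd_def by (meson less_imp_le)
  qed
  obtain G where G: "moore_penrose C1 = G" "G \<in> carrier_mat t t" "G\<^sup>T = G"
    "C1 * G = 1\<^sub>m t - avg t" "G * C1 = 1\<^sub>m t - avg t" "G *\<^sub>v one_vec t = 0\<^sub>v t" "G * C1 * G = G"
    by (rule centered_pd_pinv[OF C1 t])
  obtain H where H: "moore_penrose C2 = H" "H \<in> carrier_mat t t" "H\<^sup>T = H"
    "C2 * H = 1\<^sub>m t - avg t" "H * C2 = 1\<^sub>m t - avg t" "H *\<^sub>v one_vec t = 0\<^sub>v t" "H * C2 * H = H"
    by (rule centered_pd_pinv[OF C2 t])
  have "e \<bullet> (H *\<^sub>v e) \<le> e \<bullet> (G *\<^sub>v e)" if e: "e \<in> carrier_vec t" for e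
  proof -
    let ?y = "G *\<^sub>v e" and ?z = "H *\<^sub>v e"
    have y: "?y \<in> carrier_vec t" and z: "?z \<in> carrier_vec t" using G H e by auto
    have one: "one_vec t \<bullet> ?y = 0" "one_vec t \<bullet> ?z = 0"
      using symmetric_mult_vec_scalar_prod[OF G(2,3) one_vec_carrier e]
        symmetric_mult_vec_scalar_prod[OF H(2,3) one_vec_carrier e] G(6) H(6) e by simp_all
    have C1y: "C1 *\<^sub>v ?y = e - avg t *\<^sub>v e"
      using C(1) G(2,4) e by (simp flip: assoc_mult_mat_vec add: minus_mult_distrib_mat_vec[of _ t t])
    \<comment> \<open>\<open>C1 *\<^sub>v ?y\<close> differs from \<open>e\<close> by a constant
      vector, to which the centred \<open>?z\<close> is orthogonal.\<close>
    have "?z \<bullet> (C1 *\<^sub>v ?y) = ?z \<bullet> e"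
      unfolding C1y using z e one(2) comm_scalar_prod[OF z one_vec_carrier]
      by (simp add: avg_mult_vec scalar_prod_minus_distrib[of _ t])
    then have zCy: "?z \<bullet> (C1 *\<^sub>v ?y) = e \<bullet> ?z" using comm_scalar_prod[OF z e] by simp
    have yCz: "?y \<bullet> (C1 *\<^sub>v ?z) = e \<bullet> ?z"
      using symmetric_mult_vec_scalar_prod[OF C(1,3) y z] zCy C y z
      by (metis comm_scalar_prod mult_mat_vec_carrier)
    have "0 \<le> (?y - ?z) \<bullet> (C1 *\<^sub>v (?y - ?z))"
      using y z one by (intro psd) (auto simp: scalar_prod_minus_distrib[of _ t])
    also have "\<dots> = ?y \<bullet> (C1 *\<^sub>v ?y) - ?y \<bullet> (C1 *\<^sub>v ?z) - (?z \<bullet> (C1 *\<^sub>v ?y) - ?z \<bullet> (C1 *\<^sub>v ?z))"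
      using y z C by (simp add: mult_minus_distrib_mat_vec[of _ t t] scalar_prod_minus_distrib[of _ t]
          minus_scalar_prod_distrib[of _ t])
    \<comment> \<open>The order of the two forms enters only here, at \<open>?z\<close>; the form of
      \<open>C2\<close> at its own solution is \<open>e \<bullet> ?z\<close>.\<close>
    also have "\<dots> \<le> ?y \<bullet> (C1 *\<^sub>v ?y) - 2 * (e \<bullet> ?z) + ?z \<bullet> (C2 *\<^sub>v ?z)"
      using le[OF z] zCy yCz by simp
    also have "\<dots> = e \<bullet> ?y - e \<bullet> ?z"
      using centered_pd_quadratic[OF C(1) G(2,3,7) e] centered_pd_quadratic[OF C(2) H(2,3,7) e]
      by simp
    finally show ?thesis by simp
  qed
  then show ?thesis
    unfolding G(1) H(1) mat_trace_unit[OF G(2)] mat_trace_unit[OF H(2)] by (intro sum_mono) simp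
qed

lemma centered_pd_mono:
  assumes C1: "centered_pd t C1"
    and C2: "C2 \<in> carrier_mat t t" "C2\<^sup>T = C2" "C2 *\<^sub>v one_vec t = 0\<^sub>v t"
    and le: "\<And>v. v \<in> carrier_vec t \<Longrightarrow> v \<bullet> (C1 *\<^sub>v v) \<le> v \<bullet> (C2 *\<^sub>v v)"
  shows "centered_pd t C2"
  using assms unfolding centered_pd_def by (auto intro: less_le_trans)

text \<open>Adding the rank-one matrix \<open>avg t\<close> gives full rank, so at most one
  dimension is missing; the constants in the kernel show that one is.\<close>

lemma centered_pd_rank:
  assumes C1: "centered_pd t C" and t: "0 < t"
  shows "vec_space.rank t C = t - 1"
proof -
  interpret vec_space "TYPE(real)" t .
  have C: "C \<in> carrier_mat t t" "C *\<^sub>v one_vec t = 0\<^sub>v t" using C1 by (auto simp: centered_pd_def)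
  have "rank (C + avg t) = t"
    using det_rank_iff[of "C + avg t"] centered_pd_regular[OF C1 t] C by simp
  moreover have "rank (avg t) \<le> 1"
    by (rule rank_le_1_product_entries[of _ t "\<lambda>_. 1 / real t" "\<lambda>_. 1"]) (auto simp: avg_def)
  ultimately have "t \<le> rank C + 1"
    using rank_subadditive[OF C(1) avg_carrier] by simp
  moreover have "one_vec t \<noteq> 0\<^sub>v t" using one_one[of t] t by auto
  then have "det C = 0" using det_0_iff_vec_prod_zero_field[OF C(1)] C(2) one_vec_carrier by blast
  then have "rank C < t" by (rule det_zero_low_rank[OF C(1)])
  ultimately show ?thesis by simp
qed

text \<open>The rank-one matrices of the \<open>w j\<close> add up to \<open>T\<close> times the
  identity. Traces and quadratic forms therefore expand over \<open>K\<close> as over an orthogonal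
  basis, while the \<open>w j\<close> may be dependent or zero.\<close>

lemma trace_pinv_frame:
  fixes w :: "'j \<Rightarrow> nat \<Rightarrow> real" and l :: "'j \<Rightarrow> real"
  assumes C: "C \<in> carrier_mat t t" "C\<^sup>T = C" "C *\<^sub>v one_vec t = 0\<^sub>v t" and t: "0 < t"
    and T: "0 < T"
    and eig: "\<And>j. j \<in> K \<Longrightarrow> C *\<^sub>v vec t (w j) = l j \<cdot>\<^sub>v vec t (w j)"
    and nonneg: "\<And>j. j \<in> K \<Longrightarrow> 0 \<le> l j"
    and const: "\<And>j. j \<in> K \<Longrightarrow> l j = 0 \<Longrightarrow> \<exists>a. \<forall>h<t. w j h = a"
    and frame: "\<And>m n. m < t \<Longrightarrow> n < t \<Longrightarrow> (\<Sum>j\<in>K. w j m * w j n) = (if m = n then T else 0)"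
  shows "centered_pd t C" and "mat_trace (moore_penrose C) = (\<Sum>j\<in>K. (1 / l j) * (\<Sum>m<t. (w j m)\<^sup>2)) / T"
proof -
  \<comment> \<open>Multiplying \<open>A\<close> by the frame identity recovers its entries from the
    images of the frame vectors.\<close>
  have reconstruct: "T * A $$ (m, n) = (\<Sum>j\<in>K. (A *\<^sub>v vec t (w j)) $ m * w j n)"
    if A: "A \<in> carrier_mat t t" and mn: "m < t" "n < t" for A :: "real mat" and m n
  proof -
    have "(\<Sum>j\<in>K. (A *\<^sub>v vec t (w j)) $ m * w j n) = (\<Sum>j\<in>K. \<Sum>k<t. A $$ (m, k) * (w j k * w j n))"
      using A mn by (intro sum.cong) (auto simp: scalar_prod_def sum_distrib_right lessThan_atLeast0 mult.assoc)
    also have "\<dots> = (\<Sum>k<t. \<Sum>j\<in>K. A $$ (m, k) * (w j k * w j n))" by (rule sum.swap)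
    also have "\<dots> = (\<Sum>k<t. if n = k then A $$ (m, k) * T else 0)"
      using mn by (intro sum.cong) (auto simp: sum_distrib_left[symmetric] frame)
    finally show ?thesis using mn by simp
  qed
  have quad: "T * (v \<bullet> (A *\<^sub>v v)) = (\<Sum>j\<in>K. a j * (vec t (w j) \<bullet> v)\<^sup>2)"
    if A: "A \<in> carrier_mat t t" and v: "v \<in> carrier_vec t"
      and e: "\<And>j. j \<in> K \<Longrightarrow> A *\<^sub>v vec t (w j) = a j \<cdot>\<^sub>v vec t (w j)" for A :: "real mat" and v a
  proof -
    have ent: "T * A $$ (m, n) = (\<Sum>j\<in>K. a j * w j m * w j n)" if "m < t" "n < t" for m n
      using that e unfolding reconstruct[OF A that] by (intro sum.cong) auto
    have "T * (v \<bullet> (A *\<^sub>v v)) = (\<Sum>m<t. \<Sum>n<t. v $ m * (T * A $$ (m, n)) * v $ n)"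
      using A v by (auto simp: scalar_prod_def lessThan_atLeast0 sum_distrib_left mult_ac intro!: sum.cong)
    also have "\<dots> = (\<Sum>m<t. \<Sum>n<t. \<Sum>j\<in>K. a j * (w j m * v $ m) * (w j n * v $ n))"
      by (intro sum.cong) (auto simp: ent sum_distrib_left sum_distrib_right mult_ac)
    also have "\<dots> = (\<Sum>m<t. \<Sum>j\<in>K. \<Sum>n<t. a j * (w j m * v $ m) * (w j n * v $ n))"
      by (intro sum.cong refl sum.swap)
    also have "\<dots> = (\<Sum>j\<in>K. \<Sum>m<t. \<Sum>n<t. a j * (w j m * v $ m) * (w j n * v $ n))"
      by (rule sum.swap)
    also have "\<dots> = (\<Sum>j\<in>K. a j * (vec t (w j) \<bullet> v)\<^sup>2)"
    proof (intro sum.cong refl)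
      fix j
      have "vec t (w j) \<bullet> v = (\<Sum>m<t. w j m * v $ m)"
        using v by (simp add: scalar_prod_def lessThan_atLeast0)
      then show "(\<Sum>m<t. \<Sum>n<t. a j * (w j m * v $ m) * (w j n * v $ n)) =
          a j * (vec t (w j) \<bullet> v)\<^sup>2"
        by (simp add: power2_eq_square sum_product) (simp add: sum_distrib_left mult.assoc)
    qed
    finally show ?thesis .
  qed
  \<comment> \<open>A sum over an infinite set is 0 by convention, contradicting the diagonal frame
    identity with \<open>T > 0\<close>.\<close>
  have fin: "finite K"
    using frame[of 0 0] t T by (metis less_irrefl sum.infinite)
  show cpd: "centered_pd t C"
    unfolding centered_pd_def
  proof (intro conjI ballI impI)
    fix v :: "real vec" assume v: "v \<in> carrier_vec t" "v \<noteq> 0\<^sub>v t" "one_vec t \<bullet> v = 0"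
    \<comment> \<open>Parseval's identity: a nonzero \<open>v\<close> is not orthogonal to all frame
      vectors.\<close>
    have "T * (v \<bullet> v) = (\<Sum>j\<in>K. (vec t (w j) \<bullet> v)\<^sup>2)"
      using quad[of "1\<^sub>m t" v "\<lambda>_. 1"] v by simp
    moreover have "v \<bullet> v \<noteq> 0" using scalar_prod_self_eq_0_iff v by blast
    ultimately have "(\<Sum>j\<in>K. (vec t (w j) \<bullet> v)\<^sup>2) \<noteq> 0" using T by (metis mult_eq_0_iff less_irrefl)
    then obtain j where j: "j \<in> K" "vec t (w j) \<bullet> v \<noteq> 0"
      by (metis (no_types, lifting) sum.neutral power_zero_numeral)
    have "l j \<noteq> 0"
    proof
      assume "l j = 0"
      then obtain a where "\<forall>h<t. w j h = a" using const j by blast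
      then have "vec t (w j) = a \<cdot>\<^sub>v one_vec t" by (intro eq_vecI) (auto simp: one_vec_def)
      then show False using j v by simp
    qed
    then have "0 < l j * (vec t (w j) \<bullet> v)\<^sup>2" using nonneg[OF j(1)] j(2) by simp
    then have "0 < (\<Sum>j\<in>K. l j * (vec t (w j) \<bullet> v)\<^sup>2)"
      using fin j nonneg by (intro sum_pos2[of _ j]) auto
    then have "0 < T * (v \<bullet> (C *\<^sub>v v))" using quad[OF C(1) v(1) eig] by simp
    then show "0 < v \<bullet> (C *\<^sub>v v)" using T by (simp add: zero_less_mult_iff)
  qed (use C in auto)
  obtain G where G: "moore_penrose C = G" "G \<in> carrier_mat t t" "G\<^sup>T = G"
    "C * G = 1\<^sub>m t - avg t" "G * C = 1\<^sub>m t - avg t" "G *\<^sub>v one_vec t = 0\<^sub>v t" "G * C * G = G"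
    by (rule centered_pd_pinv[OF cpd t])
  \<comment> \<open>For \<open>l j = 0\<close> both sides vanish: \<open>w j\<close> is constant,
    which \<open>G\<close> kills, and \<open>1 / 0 = 0\<close> in HOL.\<close>
  have Gw: "G *\<^sub>v vec t (w j) = (1 / l j) \<cdot>\<^sub>v vec t (w j)" if j: "j \<in> K" for j
  proof (cases "l j = 0")
    case True
    then obtain a where "\<forall>h<t. w j h = a" using const j by blast
    then have "vec t (w j) = a \<cdot>\<^sub>v one_vec t" by (intro eq_vecI) (auto simp: one_vec_def)
    then have "G *\<^sub>v vec t (w j) = 0\<^sub>v t" using smult_one_zero[OF G(2,6)] by simp
    then show ?thesis using True by (intro eq_vecI) auto
  next
    case False
    let ?w = "vec t (w j)"
    have w: "?w \<in> carrier_vec t" by simp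
    have "l j * (one_vec t \<bullet> ?w) = one_vec t \<bullet> (C *\<^sub>v ?w)" using eig[OF j] by simp
    also have "\<dots> = 0"
      using symmetric_mult_vec_scalar_prod[OF C(1,2) one_vec_carrier w] C(3) by simp
    finally have one: "one_vec t \<bullet> ?w = 0" using False by simp
    have "G *\<^sub>v (C *\<^sub>v ?w) = (1\<^sub>m t - avg t) *\<^sub>v ?w"
      using C(1) G(2) w by (simp flip: assoc_mult_mat_vec G(5))
    also have "\<dots> = ?w" using one
      by (simp add: minus_mult_distrib_mat_vec[of _ t t] avg_mult_vec zero_smult_vec[OF one_vec_carrier])
    finally have "l j \<cdot>\<^sub>v (G *\<^sub>v ?w) = ?w" using eig[OF j] G(2) by (simp add: mult_mat_vec[of _ t t])
    then have "(1 / l j) \<cdot>\<^sub>v (l j \<cdot>\<^sub>v (G *\<^sub>v ?w)) = (1 / l j) \<cdot>\<^sub>v ?w" by simp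
    then show ?thesis using False by (simp add: smult_smult_assoc)
  qed
  have "T * mat_trace G = (\<Sum>m<t. \<Sum>j\<in>K. (1 / l j) * (w j m)\<^sup>2)"
    unfolding mat_trace_def sum_distrib_left using G(2) Gw
    by (auto intro!: sum.cong simp: reconstruct power2_eq_square)
  also have "\<dots> = (\<Sum>j\<in>K. (1 / l j) * (\<Sum>m<t. (w j m)\<^sup>2))"
    unfolding sum_distrib_left by (rule sum.swap)
  finally show "mat_trace (moore_penrose C) = (\<Sum>j\<in>K. (1 / l j) * (\<Sum>m<t. (w j m)\<^sup>2)) / T"
    using T G(1) by (simp add: field_simps)
qed

section \<open>Normal equations of the crossover model\<close>

text \<open>The letters stand for pairings of \<open>c\<close>, \<open>x\<close> and their images
  under \<open>forward\<close> and \<open>backward\<close> with a test function. Writing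
  \<open>g\<close> as a multiple of \<open>T - 1\<close> makes the identity polynomial.\<close>

lemma carry_over_identity:
  fixes g T c x fx fc bc :: real
  assumes "T - 1 \<noteq> 0"
  shows "- g * x - g * fx - (- (g / (T - 1) * (c + bc - x)) - g / (T - 1) * (fc + c - fx)) -
      (T - 2) * (g * c) = g / (T - 1) * (- T * (T - 3) * c + fc + bc - T * (x + fx))"
proof -
  define q where "q = g / (T - 1)"
  have g: "g = q * (T - 1)" using assms by (simp add: q_def)
  show ?thesis unfolding q_def[symmetric] unfolding g by (simp add: algebra_simps)
qed

lemma direct_identity:
  fixes g T c x bc :: real
  assumes "T - 1 \<noteq> 0"
  shows "(T - 1) * (g * x) - - (g / (T - 1) * (c + bc - x)) - (- g * c - g * bc) =
      g * T / (T - 1) * ((T - 2) * x + c + bc)"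
proof -
  define q where "q = g / (T - 1)"
  have g: "g = q * (T - 1)" using assms by (simp add: q_def)
  have "g * T / (T - 1) = q * T" by (simp add: q_def)
  then show ?thesis unfolding q_def[symmetric] unfolding g by (simp add: algebra_simps)
qed

text \<open>\<open>g * N h h'\<close> is the number of subjects that change from \<open>h\<close> to \<open>h'\<close> between the last two periods.\<close>
locale crossover_layout =
  fixes t s :: nat and g :: real and D :: arr and N :: "nat \<Rightarrow> nat \<Rightarrow> real"
  assumes t: "2 \<le> t" and g: "0 < g"
    and range: "\<And>k i. k < t \<Longrightarrow> i < s \<Longrightarrow> D k i < t"
    and uniform_subject: "\<And>i (f :: nat \<Rightarrow> real). i < s \<Longrightarrow> (\<Sum>k<t. f (D k i)) = (\<Sum>h<t. f h)"
    and uniform_period: "\<And>k (f :: nat \<Rightarrow> real). k < t \<Longrightarrow> (\<Sum>i<s. f (D k i)) = g * (\<Sum>h<t. f h)"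
    and balanced: "\<And>F :: nat \<Rightarrow> nat \<Rightarrow> real. (\<Sum>k<t - 1. \<Sum>i<s. F (D k i) (D (Suc k) i)) =
      g * (\<Sum>h<t. (\<Sum>h'<t. F h h') - F h h)"
    and last_transition: "\<And>F :: nat \<Rightarrow> nat \<Rightarrow> real. (\<Sum>i<s. F (D (t - 2) i) (D (t - 1) i)) =
      g * (\<Sum>h<t. \<Sum>h'<t. N h h' * F h h')"
begin

declare One_nat_def [simp del]

text \<open>With \<open>backward\<close>: \<open>N\<close> and its transpose as operators on
  functions of treatments. For a permutation they are composition with it and with its
  inverse.\<close>

definition forward :: "(nat \<Rightarrow> real) \<Rightarrow> nat \<Rightarrow> real" where
  "forward f h = (\<Sum>h'<t. N h h' * f h')"

definition backward :: "(nat \<Rightarrow> real) \<Rightarrow> nat \<Rightarrow> real" where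
  "backward f h = (\<Sum>h'<t. N h' h * f h')"

lemma last_transition_forward:
  "(\<Sum>i<s. f (D (t - 2) i) * e (D (t - 1) i)) = g * (\<Sum>h<t. f h * forward e h)"
  unfolding last_transition[of "\<lambda>h h'. f h * e h'"] forward_def
  by (simp add: sum_distrib_left mult_ac)

lemma last_transition_backward:
  "(\<Sum>i<s. f (D (t - 2) i) * e (D (t - 1) i)) = g * (\<Sum>h<t. e h * backward f h)"
  unfolding last_transition[of "\<lambda>h h'. f h * e h'"] backward_def
  by (subst sum.swap) (simp add: sum_distrib_left mult_ac)

lemma all_transitions:
  "(\<Sum>k<t - 1. \<Sum>i<s. f (D k i) * e (D (Suc k) i)) =
    g * ((\<Sum>h<t. f h) * (\<Sum>h<t. e h) - (\<Sum>h<t. f h * e h))"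
  unfolding balanced[of "\<lambda>h h'. f h * e h'"] sum_subtractf sum_product ..

lemma one_period:
  "k < t \<Longrightarrow> (\<Sum>i<s. f (D k i) * e (D k i)) = g * (\<Sum>h<t. f h * e h)"
  for f e :: "nat \<Rightarrow> real"
  using uniform_period[of k "\<lambda>h. f h * e h"] by simp

lemma zero_first_shift:
  "(\<Sum>k<Suc n. F k * (if 0 < k then E (k - 1) else 0)) = (\<Sum>k<n. F (Suc k) * E k)"
  for F E :: "nat \<Rightarrow> real"
  by (simp add: sum.lessThan_Suc_shift del: sum.lessThan_Suc)

lemma zero_first_shift_sum:
  "(\<Sum>i<m. \<Sum>k<Suc n. F k i * (if 0 < k then E (k - 1) i else 0)) =
    (\<Sum>i<m. \<Sum>k<n. F (Suc k) i * E k i)"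
  for F E :: "nat \<Rightarrow> nat \<Rightarrow> real"
  by (rule sum.cong[OF refl zero_first_shift])

lemma sum_linear:
  "(\<Sum>h<t. e h * (K * (a * x h + c h + y h))) =
    K * (a * (\<Sum>h<t. x h * e h) + (\<Sum>h<t. c h * e h) + (\<Sum>h<t. e h * y h))"
  for K a :: real and e x c y :: "nat \<Rightarrow> real"
  by (simp add: sum.distrib distrib_left sum_distrib_left mult_ac)

text \<open>No period effect appears: for centred \<open>x\<close> and \<open>c\<close> the period
  sums already vanish.\<close>

definition residual where
  "residual x a c k i = x (D k i) - a i - (if 0 < k then c (D (k - 1) i) else (0::real))"

lemma normal_equationsI:
  assumes subj: "\<And>i. i < s \<Longrightarrow> (\<Sum>k<p. residual x a c k i) = 0"
    and per: "\<And>k. k < p \<Longrightarrow> (\<Sum>i<s. residual x a c k i) = 0"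
    and carry: "\<And>c'. (\<Sum>k<p. \<Sum>i<s. residual x a c k i * (if 0 < k then c' (D (k - 1) i) else 0)) = 0"
  shows "(\<Sum>k<p. \<Sum>i<s. residual x a c k i * (a' i + b' k + (if 0 < k then c' (D (k - 1) i) else 0))) = 0"
proof -
  have "(\<Sum>k<p. \<Sum>i<s. residual x a c k i * a' i) = (\<Sum>i<s. \<Sum>k<p. residual x a c k i * a' i)"
    by (rule sum.swap)
  also have "\<dots> = 0" using subj by (simp flip: sum_distrib_right)
  finally have 1: "(\<Sum>k<p. \<Sum>i<s. residual x a c k i * a' i) = 0" .
  have 2: "(\<Sum>k<p. \<Sum>i<s. residual x a c k i * b' k) = 0"
    using per by (simp flip: sum_distrib_right)
  show ?thesis using 1 2 carry[of c'] by (simp add: distrib_left sum.distrib)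
qed

section \<open>Solving the normal equations for centred direct and carry-over effects\<close>

context
  fixes x c :: "nat \<Rightarrow> real"
  assumes x0: "(\<Sum>h<t. x h) = 0" and c0: "(\<Sum>h<t. c h) = 0"
begin

text \<open>Solves the subject equation over the first \<open>t - 1\<close> periods. By uniformity a
  centred function sums over these periods to minus its value in the dropped one; \<open>c\<close>
  lags by one period, so for it the last two treatments are missing. This is how the unobserved
  treatment gets in.\<close>

definition subj_short where
  "subj_short i = (c (D (t - 1) i) + c (D (t - 2) i) - x (D (t - 1) i)) / (real t - 1)"

text \<open>Over all \<open>t\<close> periods the sum of \<open>x\<close> vanishes, and the lag
  makes \<open>c\<close> miss only the last treatment.\<close>

definition subj_full where
  "subj_full i = c (D (t - 1) i) / real t"

lemma subj_short_sum: "(\<Sum>i<s. subj_short i) = 0"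
  using uniform_period[of "t - 1" c] uniform_period[of "t - 2" c] uniform_period[of "t - 1" x] t x0 c0
  by (simp add: subj_short_def sum.distrib sum_subtractf flip: sum_divide_distrib)

lemma subj_full_sum: "(\<Sum>i<s. subj_full i) = 0"
  using uniform_period[of "t - 1" c] t c0 by (simp add: subj_full_def flip: sum_divide_distrib)

text \<open>\<open>backward c\<close> arises because the subject effect contains the penultimate
  treatment while \<open>e\<close> is evaluated at the last one.\<close>

lemma subj_short_last:
  "(\<Sum>i<s. subj_short i * e (D (t - 1) i)) =
    g / (real t - 1) * ((\<Sum>h<t. c h * e h) + (\<Sum>h<t. e h * backward c h) - (\<Sum>h<t. x h * e h))"
proof -
  have "(\<Sum>i<s. subj_short i * e (D (t - 1) i)) =
    ((\<Sum>i<s. c (D (t - 1) i) * e (D (t - 1) i)) + (\<Sum>i<s. c (D (t - 2) i) * e (D (t - 1) i)) -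
      (\<Sum>i<s. x (D (t - 1) i) * e (D (t - 1) i))) / (real t - 1)"
    unfolding sum.distrib[symmetric] sum_subtractf[symmetric] sum_divide_distrib
    by (rule sum.cong) (simp_all add: subj_short_def algebra_simps)
  also have "\<dots> = (g * (\<Sum>h<t. c h * e h) + g * (\<Sum>h<t. e h * backward c h) - g * (\<Sum>h<t. x h * e h))
      / (real t - 1)"
    using t by (simp only: last_transition_backward one_period[of "t - 1"])
  finally show ?thesis by (simp add: algebra_simps add_divide_distrib diff_divide_distrib)
qed

lemma subj_short_penultimate:
  "(\<Sum>i<s. subj_short i * e (D (t - 2) i)) =
    g / (real t - 1) * ((\<Sum>h<t. e h * forward c h) + (\<Sum>h<t. c h * e h) - (\<Sum>h<t. e h * forward x h))"
proof -
  have "(\<Sum>i<s. subj_short i * e (D (t - 2) i)) =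
    ((\<Sum>i<s. e (D (t - 2) i) * c (D (t - 1) i)) + (\<Sum>i<s. c (D (t - 2) i) * e (D (t - 2) i)) -
      (\<Sum>i<s. e (D (t - 2) i) * x (D (t - 1) i))) / (real t - 1)"
    unfolding sum.distrib[symmetric] sum_subtractf[symmetric] sum_divide_distrib
    by (rule sum.cong) (simp_all add: subj_short_def algebra_simps)
  also have "\<dots> = (g * (\<Sum>h<t. e h * forward c h) + g * (\<Sum>h<t. c h * e h) - g * (\<Sum>h<t. e h * forward x h))
      / (real t - 1)"
    using t by (simp only: last_transition_forward one_period[of "t - 2"])
  finally show ?thesis by (simp add: algebra_simps add_divide_distrib diff_divide_distrib)
qed

lemma short_sum: "i < s \<Longrightarrow> (\<Sum>k<t - 1. f (D k i)) = (\<Sum>h<t. f h) - f (D (t - 1) i)"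
  for f :: "nat \<Rightarrow> real"
  using uniform_subject[of i f] t sum.lessThan_Suc[of "\<lambda>k. f (D k i)" "t - 1"] by simp

lemma shorter_sum: "i < s \<Longrightarrow> (\<Sum>k<t - 2. f (D k i)) = (\<Sum>h<t. f h) - f (D (t - 1) i) - f (D (t - 2) i)"
  for f :: "nat \<Rightarrow> real"
proof -
  assume i: "i < s"
  have "t - 1 = Suc (t - 2)" using t by simp
  then have "(\<Sum>k<t - 1. f (D k i)) = (\<Sum>k<t - 2. f (D k i)) + f (D (t - 2) i)"
    by (metis sum.lessThan_Suc)
  then show ?thesis using short_sum[OF i, of f] by simp
qed

text \<open>Balance counts all \<open>t - 1\<close> transitions together, so removing the last one
  is what brings \<open>N\<close> into the truncated design.\<close>

lemma transitions_but_last: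
  "(\<Sum>k<t - 2. \<Sum>i<s. f (D k i) * e (D (Suc k) i)) =
    g * ((\<Sum>h<t. f h) * (\<Sum>h<t. e h) - (\<Sum>h<t. f h * e h)) -
    (\<Sum>i<s. f (D (t - 2) i) * e (D (t - 1) i))"
proof -
  have eq: "t - 1 = Suc (t - 2)" using t by simp
  show ?thesis
    using all_transitions[of f e] unfolding eq sum.lessThan_Suc by (simp add: eq)
qed

text \<open>Subject sums vanish by the choice of \<open>subj_short\<close>, period sums by centring.
  The assumption is what remains, the carry-over equation with subject effects eliminated, stated
  pointwise and scaled by \<open>(t - 1) / g\<close>.\<close>

lemma normal_equations_short:
  assumes eq: "\<And>h. h < t \<Longrightarrow> real t * (x h + forward x h) =
      - real t * (real t - 3) * c h + forward c h + backward c h"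
  shows "(\<Sum>k<t - 1. \<Sum>i<s. residual x subj_short c k i *
      (a' i + b' k + (if 0 < k then c' (D (k - 1) i) else 0))) = 0"
proof (rule normal_equationsI)
  have T: "t - 1 = Suc (t - 2)" and p: "real t - 1 > 0" using t by simp_all
  show "(\<Sum>k<t - 1. residual x subj_short c k i) = 0" if i: "i < s" for i
  proof -
    have "(\<Sum>k<t - 1. if 0 < k then c (D (k - 1) i) else 0) = (\<Sum>k<t - 2. c (D k i))"
      unfolding T using zero_first_shift[of "\<lambda>_. 1" "\<lambda>k. c (D k i)" "t - 2"] by simp
    then have "(\<Sum>k<t - 1. residual x subj_short c k i) =
        - x (D (t - 1) i) - real (t - 1) * subj_short i + c (D (t - 1) i) + c (D (t - 2) i)"
      using i x0 c0 by (simp add: residual_def sum_subtractf short_sum shorter_sum)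
    then show ?thesis using p t by (simp add: subj_short_def of_nat_diff)
  qed
  show "(\<Sum>i<s. residual x subj_short c k i) = 0" if k: "k < t - 1" for k
  proof -
    have "(\<Sum>i<s. if 0 < k then c (D (k - 1) i) else 0) = 0"
      using uniform_period[of "k - 1" c] k c0 by (cases "0 < k") simp_all
    then show ?thesis
      using k x0 subj_short_sum uniform_period[of k x] by (simp add: residual_def sum_subtractf)
  qed
  fix e :: "nat \<Rightarrow> real"
  let ?c = "\<Sum>h<t. c h * e h" and ?x = "\<Sum>h<t. x h * e h" and ?fx = "\<Sum>h<t. e h * forward x h"
    and ?fc = "\<Sum>h<t. e h * forward c h" and ?bc = "\<Sum>h<t. e h * backward c h"
  have summed: "real t * (?x + ?fx) = - real t * (real t - 3) * ?c + ?fc + ?bc"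
  proof -
    have "real t * (?x + ?fx) = (\<Sum>h<t. e h * (real t * (x h + forward x h)))"
      by (simp add: sum_distrib_left sum.distrib algebra_simps)
    also have "\<dots> = (\<Sum>h<t. e h * (- real t * (real t - 3) * c h + forward c h + backward c h))"
      by (rule sum.cong) (auto simp: eq)
    also have "\<dots> = - real t * (real t - 3) * ?c + ?fc + ?bc"
      by (simp add: sum_distrib_left sum.distrib sum_subtractf algebra_simps)
    finally show ?thesis .
  qed
  have "(\<Sum>k<t - 1. \<Sum>i<s. residual x subj_short c k i * (if 0 < k then e (D (k - 1) i) else 0)) =
      (\<Sum>i<s. \<Sum>k<t - 1. residual x subj_short c k i * (if 0 < k then e (D (k - 1) i) else 0))"
    by (rule sum.swap)
  also have "\<dots> = (\<Sum>i<s. \<Sum>k<t - 2. residual x subj_short c (Suc k) i * e (D k i))"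
    unfolding T by (rule zero_first_shift_sum[where m = s and F = "residual x subj_short c" and E = "\<lambda>k i. e (D k i)"])
  also have "\<dots> = (\<Sum>i<s. \<Sum>k<t - 2. e (D k i) * x (D (Suc k) i) - subj_short i * e (D k i) - c (D k i) * e (D k i))"
    by (simp add: residual_def algebra_simps)
  also have "\<dots> = (\<Sum>k<t - 2. \<Sum>i<s. e (D k i) * x (D (Suc k) i)) - (\<Sum>i<s. subj_short i * (\<Sum>k<t - 2. e (D k i)))
      - (\<Sum>k<t - 2. \<Sum>i<s. c (D k i) * e (D k i))"
    by (simp add: sum_subtractf sum_distrib_left sum.swap[of _ "{..<s}" "{..<t - 2}"])
  also have "(\<Sum>k<t - 2. \<Sum>i<s. e (D k i) * x (D (Suc k) i)) = - g * ?x - g * ?fx"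
    unfolding transitions_but_last last_transition_forward x0 by (simp add: mult.commute)
  also have "(\<Sum>k<t - 2. \<Sum>i<s. c (D k i) * e (D k i)) = (real t - 2) * (g * ?c)"
    using t by (simp add: one_period of_nat_diff)
  \<comment> \<open>Uniformity replaces the sum over the first \<open>t - 2\<close> periods by the
    total minus the last two treatments; the total then drops out because the subject effects sum to
    zero.\<close>
  also have "(\<Sum>i<s. subj_short i * (\<Sum>k<t - 2. e (D k i))) =
      (\<Sum>i<s. subj_short i * (\<Sum>h<t. e h)) - (\<Sum>i<s. subj_short i * e (D (t - 1) i))
       - (\<Sum>i<s. subj_short i * e (D (t - 2) i))"
    by (simp add: shorter_sum sum_subtractf algebra_simps)
  also have "\<dots> = - (g / (real t - 1) * (?c + ?bc - ?x)) - g / (real t - 1) * (?fc + ?c - ?fx)"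
    using subj_short_sum by (simp add: subj_short_last subj_short_penultimate flip: sum_distrib_right)
  also have "- g * ?x - g * ?fx - (- (g / (real t - 1) * (?c + ?bc - ?x)) - g / (real t - 1) * (?fc + ?c - ?fx)) -
      (real t - 2) * (g * ?c) = g / (real t - 1) * (- real t * (real t - 3) * ?c + ?fc + ?bc - real t * (?x + ?fx))"
    by (rule carry_over_identity) (use p in simp)
  also have "\<dots> = 0" unfolding summed by simp
  finally show "(\<Sum>k<t - 1. \<Sum>i<s. residual x subj_short c k i * (if 0 < k then e (D (k - 1) i) else 0)) = 0" .
qed

text \<open>Once the normal equations hold, this pairing is the image of \<open>x\<close> under the
  information matrix, tested against \<open>e\<close>. \<open>backward c\<close> stems both from the
  missing transition and from the subject effects.\<close>

lemma direct_short:
  "(\<Sum>k<t - 1. \<Sum>i<s. residual x subj_short c k i * e (D k i)) =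
    (\<Sum>h<t. e h * (g * real t / (real t - 1) * ((real t - 2) * x h + c h + backward c h)))"
proof -
  have T: "t - 1 = Suc (t - 2)" and p: "real t - 1 > 0" using t by simp_all
  let ?c = "\<Sum>h<t. c h * e h" and ?x = "\<Sum>h<t. x h * e h" and ?bc = "\<Sum>h<t. e h * backward c h"
  have "(\<Sum>k<t - 1. \<Sum>i<s. residual x subj_short c k i * e (D k i)) =
      (\<Sum>k<t - 1. \<Sum>i<s. x (D k i) * e (D k i)) - (\<Sum>k<t - 1. \<Sum>i<s. subj_short i * e (D k i)) -
      (\<Sum>k<t - 1. \<Sum>i<s. e (D k i) * (if 0 < k then c (D (k - 1) i) else 0))"
    by (simp add: residual_def algebra_simps sum_subtractf)
  also have "(\<Sum>k<t - 1. \<Sum>i<s. x (D k i) * e (D k i)) = (real t - 1) * (g * ?x)"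
    using t by (simp add: one_period of_nat_diff)
  also have "(\<Sum>k<t - 1. \<Sum>i<s. subj_short i * e (D k i)) = (\<Sum>i<s. subj_short i * (\<Sum>k<t - 1. e (D k i)))"
    by (subst sum.swap) (simp add: sum_distrib_left)
  also have "\<dots> = (\<Sum>i<s. subj_short i * (\<Sum>h<t. e h)) - (\<Sum>i<s. subj_short i * e (D (t - 1) i))"
    by (simp add: short_sum sum_subtractf algebra_simps)
  also have "\<dots> = - (g / (real t - 1) * (?c + ?bc - ?x))"
    using subj_short_sum by (simp add: subj_short_last flip: sum_distrib_right)
  also have "(\<Sum>k<t - 1. \<Sum>i<s. e (D k i) * (if 0 < k then c (D (k - 1) i) else 0)) =
      (\<Sum>i<s. \<Sum>k<t - 1. e (D k i) * (if 0 < k then c (D (k - 1) i) else 0))"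
    by (rule sum.swap)
  also have "\<dots> = (\<Sum>i<s. \<Sum>k<t - 2. e (D (Suc k) i) * c (D k i))"
    unfolding T by (rule zero_first_shift_sum[where m = s and F = "\<lambda>k i. e (D k i)" and E = "\<lambda>k i. c (D k i)"])
  also have "\<dots> = (\<Sum>k<t - 2. \<Sum>i<s. c (D k i) * e (D (Suc k) i))"
    by (subst sum.swap) (simp add: mult.commute)
  also have "\<dots> = - g * ?c - g * ?bc"
    unfolding transitions_but_last last_transition_backward c0 by simp
  also have "(real t - 1) * (g * ?x) - - (g / (real t - 1) * (?c + ?bc - ?x)) - (- g * ?c - g * ?bc) =
      g * real t / (real t - 1) * ((real t - 2) * ?x + ?c + ?bc)"
    by (rule direct_identity) (use p in simp)
  also have "\<dots> = (\<Sum>h<t. e h * (g * real t / (real t - 1) * ((real t - 2) * x h + c h + backward c h)))"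
    by (rule sum_linear[symmetric])
  finally show ?thesis .
qed

text \<open>With all periods observed every transition is covered by balance, so \<open>N\<close>
  disappears and the carry-over equation is a scalar relation between \<open>x\<close> and
  \<open>c\<close>.\<close>

lemma normal_equations_full:
  assumes eq: "\<And>h. h < t \<Longrightarrow> real t * x h = - ((real t)\<^sup>2 - real t - 1) * c h"
  shows "(\<Sum>k<t. \<Sum>i<s. residual x subj_full c k i *
      (a' i + b' k + (if 0 < k then c' (D (k - 1) i) else 0))) = 0"
proof (rule normal_equationsI)
  have T: "t = Suc (t - 1)" and p: "real t > 0" using t by simp_all
  have shift: "(\<Sum>k<t. F k * (if 0 < k then E (k - 1) else 0)) = (\<Sum>k<t - 1. F (Suc k) * E k)"
    for F E :: "nat \<Rightarrow> real"
    using zero_first_shift[of F E "t - 1"] T by simp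
  show "(\<Sum>k<t. residual x subj_full c k i) = 0" if i: "i < s" for i
  proof -
    have "(\<Sum>k<t. if 0 < k then c (D (k - 1) i) else 0) = (\<Sum>k<t - 1. c (D k i))"
      using shift[of "\<lambda>_. 1" "\<lambda>k. c (D k i)"] by simp
    then have "(\<Sum>k<t. residual x subj_full c k i) = - real t * subj_full i + c (D (t - 1) i)"
      using i x0 c0 by (simp add: residual_def sum_subtractf short_sum uniform_subject)
    then show ?thesis using p by (simp add: subj_full_def)
  qed
  show "(\<Sum>i<s. residual x subj_full c k i) = 0" if k: "k < t" for k
  proof -
    have "(\<Sum>i<s. if 0 < k then c (D (k - 1) i) else 0) = 0"
      using uniform_period[of "k - 1" c] k c0 by (cases "0 < k") simp_all
    then show ?thesis
      using k x0 subj_full_sum uniform_period[of k x] by (simp add: residual_def sum_subtractf)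
  qed
  fix e :: "nat \<Rightarrow> real"
  let ?c = "\<Sum>h<t. c h * e h" and ?x = "\<Sum>h<t. x h * e h"
  have summed: "real t * ?x = - ((real t)\<^sup>2 - real t - 1) * ?c"
  proof -
    have "real t * ?x = (\<Sum>h<t. (real t * x h) * e h)" by (simp add: sum_distrib_left mult.assoc)
    also have "\<dots> = (\<Sum>h<t. - ((real t)\<^sup>2 - real t - 1) * c h * e h)"
      by (rule sum.cong) (auto simp: eq)
    finally show ?thesis by (simp add: sum_distrib_left mult.assoc)
  qed
  have "(\<Sum>k<t. \<Sum>i<s. residual x subj_full c k i * (if 0 < k then e (D (k - 1) i) else 0)) =
      (\<Sum>i<s. \<Sum>k<t. residual x subj_full c k i * (if 0 < k then e (D (k - 1) i) else 0))"
    by (rule sum.swap)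
  also have "\<dots> = (\<Sum>i<s. \<Sum>k<t - 1. residual x subj_full c (Suc k) i * e (D k i))"
    using zero_first_shift_sum[where m = s and n = "t - 1" and F = "residual x subj_full c" and E = "\<lambda>k i. e (D k i)"] T by simp
  also have "\<dots> = (\<Sum>i<s. \<Sum>k<t - 1. e (D k i) * x (D (Suc k) i) - subj_full i * e (D k i) - c (D k i) * e (D k i))"
    by (simp add: residual_def algebra_simps)
  also have "\<dots> = (\<Sum>k<t - 1. \<Sum>i<s. e (D k i) * x (D (Suc k) i)) - (\<Sum>i<s. subj_full i * (\<Sum>k<t - 1. e (D k i)))
      - (\<Sum>k<t - 1. \<Sum>i<s. c (D k i) * e (D k i))"
    by (simp add: sum_subtractf sum_distrib_left sum.swap[of _ "{..<s}" "{..<t - 1}"])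
  also have "(\<Sum>k<t - 1. \<Sum>i<s. e (D k i) * x (D (Suc k) i)) = - g * ?x"
    unfolding all_transitions x0 by (simp add: mult.commute)
  also have "(\<Sum>k<t - 1. \<Sum>i<s. c (D k i) * e (D k i)) = (real t - 1) * (g * ?c)"
    using t by (simp add: one_period of_nat_diff)
  also have "(\<Sum>i<s. subj_full i * (\<Sum>k<t - 1. e (D k i))) =
      (\<Sum>i<s. subj_full i * (\<Sum>h<t. e h)) - (\<Sum>i<s. c (D (t - 1) i) * e (D (t - 1) i)) / real t"
    by (simp add: short_sum sum_subtractf algebra_simps subj_full_def sum_divide_distrib)
  also have "\<dots> = - (g * ?c / real t)"
    using subj_full_sum t by (simp add: one_period flip: sum_distrib_right)
  also have "- g * ?x - - (g * ?c / real t) - (real t - 1) * (g * ?c) =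
      g / real t * (- ((real t)\<^sup>2 - real t - 1) * ?c - real t * ?x)"
    using p by (simp add: field_simps power2_eq_square)
  also have "\<dots> = 0" unfolding summed by simp
  finally show "(\<Sum>k<t. \<Sum>i<s. residual x subj_full c k i * (if 0 < k then e (D (k - 1) i) else 0)) = 0" .
qed

lemma direct_full:
  "(\<Sum>k<t. \<Sum>i<s. residual x subj_full c k i * e (D k i)) =
    (\<Sum>h<t. e h * (g * (real t * x h + c h)))"
proof -
  have T: "t = Suc (t - 1)" using t by simp
  have shift: "(\<Sum>k<t. F k * (if 0 < k then E (k - 1) else 0)) = (\<Sum>k<t - 1. F (Suc k) * E k)"
    for F E :: "nat \<Rightarrow> real"
    using zero_first_shift[of F E "t - 1"] T by simp
  let ?c = "\<Sum>h<t. c h * e h" and ?x = "\<Sum>h<t. x h * e h"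
  have "(\<Sum>k<t. \<Sum>i<s. residual x subj_full c k i * e (D k i)) =
      (\<Sum>k<t. \<Sum>i<s. x (D k i) * e (D k i)) - (\<Sum>k<t. \<Sum>i<s. subj_full i * e (D k i)) -
      (\<Sum>k<t. \<Sum>i<s. e (D k i) * (if 0 < k then c (D (k - 1) i) else 0))"
    by (simp add: residual_def algebra_simps sum_subtractf)
  also have "(\<Sum>k<t. \<Sum>i<s. x (D k i) * e (D k i)) = real t * (g * ?x)"
    by (simp add: one_period)
  also have "(\<Sum>k<t. \<Sum>i<s. subj_full i * e (D k i)) = (\<Sum>i<s. subj_full i * (\<Sum>k<t. e (D k i)))"
    by (subst sum.swap) (simp add: sum_distrib_left)
  also have "\<dots> = 0"
    using subj_full_sum by (simp add: uniform_subject flip: sum_distrib_right)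
  also have "(\<Sum>k<t. \<Sum>i<s. e (D k i) * (if 0 < k then c (D (k - 1) i) else 0)) =
      (\<Sum>i<s. \<Sum>k<t. e (D k i) * (if 0 < k then c (D (k - 1) i) else 0))"
    by (rule sum.swap)
  also have "\<dots> = (\<Sum>i<s. \<Sum>k<t - 1. e (D (Suc k) i) * c (D k i))"
    using zero_first_shift_sum[where m = s and n = "t - 1" and F = "\<lambda>k i. e (D k i)" and E = "\<lambda>k i. c (D k i)"] T by simp
  also have "\<dots> = (\<Sum>k<t - 1. \<Sum>i<s. c (D k i) * e (D (Suc k) i))"
    by (subst sum.swap) (simp add: mult.commute)
  also have "\<dots> = - g * ?c"
    unfolding all_transitions c0 by simp
  finally show ?thesis
    using sum_linear[of e g "real t" x c "\<lambda>_. 0"] by (simp add: algebra_simps)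
qed

end

text \<open>Turns a solution of the normal equations, with period effects zero, into a matrix
  equation: testing against unit vectors gives the coordinates of the image.\<close>

lemma info_matrix_mult_vecI:
  assumes d: "treatments d = t" "subjects d = s" "assign d = D" "valid_assign d"
    and obs: "set (obs d) = {..<p} \<times> {..<s}"
    and normal: "\<And>a' b' c'. (\<Sum>k<p. \<Sum>i<s. residual x a c k i *
      (a' i + b' k + (if 0 < k then c' (D (k - 1) i) else 0))) = 0"
    and dir: "\<And>e. (\<Sum>k<p. \<Sum>i<s. residual x a c k i * e (D k i)) = (\<Sum>h<t. e h * y h)"
  shows "info_matrix d *\<^sub>v vec t x = vec t y"
proof (rule eq_vecI)
  have res: "direct d x (k, i) - fitted d a (\<lambda>_. 0) c (k, i) = residual x a c k i" for k i
    using d by (simp add: direct_def fitted_def residual_def)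
  have "(\<Sum>z\<in>set (obs d). (direct d x z - fitted d a (\<lambda>_. 0) c z) * fitted d a' b' c' z) = 0"
    for a' b' c'
    unfolding obs sum.cartesian_product[symmetric] using normal[of a' b' c'] d(3)
    by (simp add: sum.cartesian_product' res) (simp add: fitted_def d(3) cong: if_cong)
  from info_normal_equations[OF d(4) this]
  have "vec t e \<bullet> (info_matrix d *\<^sub>v vec t x) =
      (\<Sum>z\<in>set (obs d). (direct d x z - fitted d a (\<lambda>_. 0) c z) * direct d e z)" for e
    using d(1) by simp
  also have "\<dots> e = (\<Sum>h<t. e h * y h)" for e
    unfolding obs using dir[of e] d(3)
    by (simp add: sum.cartesian_product' res) (simp add: direct_def d(3))
  finally have *: "vec t e \<bullet> (info_matrix d *\<^sub>v vec t x) = (\<Sum>h<t. e h * y h)" for e .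
  have carr: "info_matrix d *\<^sub>v vec t x \<in> carrier_vec t" using info_matrix_carrier[of d] d(1) by simp
  fix h assume "h < dim_vec (vec t y)"
  then have h: "h < t" by simp
  have "vec t (\<lambda>i. if i = h then 1 else 0) = (unit_vec t h :: real vec)"
    by (simp add: unit_vec_def)
  then have "(info_matrix d *\<^sub>v vec t x) $ h = (\<Sum>i<t. (if i = h then 1 else 0) * y i)"
    using *[of "\<lambda>i. if i = h then 1 else 0"] scalar_prod_left_unit[OF carr h] by simp
  also have "\<dots> = (\<Sum>i<t. if i = h then y i else 0)" by (rule sum.cong) auto
  finally show "(info_matrix d *\<^sub>v vec t x) $ h = vec t y $ h" using h by simp
qed (use info_matrix_carrier[of d] d(1) in simp)

end

section \<open>Simple eigenvalue 1 and cyclic permutations\<close>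

definition perm_mat :: "nat \<Rightarrow> (nat \<Rightarrow> nat) \<Rightarrow> real mat" where
  "perm_mat t \<sigma> = mat t t (\<lambda>(h, h'). if h = \<sigma> h' then 1 else 0)"

text \<open>If \<open>S\<close> is invariant, replacing rows \<open>a \<in> S\<close> and \<open>b \<notin> S\<close> of \<open>x I - \<Pi>\<close> by the sums of
  the rows in \<open>S\<close> and outside \<open>S\<close> is a unimodular operation, and makes both rows divisible by
  \<open>x - 1\<close>.\<close>
lemma char_poly_perm_mat_dvd:
  assumes \<sigma>: "\<And>j. j < t \<Longrightarrow> \<sigma> j < t" and inv: "\<And>j. j < t \<Longrightarrow> \<sigma> j \<in> S \<longleftrightarrow> j \<in> S"
    and a: "a < t" "a \<in> S" and b: "b < t" "b \<notin> S"
  shows "[:-1, 1:] ^ 2 dvd char_poly (perm_mat t \<sigma>)"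
proof -
  define q :: "real poly" where "q = [:-1, 1:]"
  define M where "M = char_poly_matrix (perm_mat t \<sigma>)"
  have M: "M \<in> carrier_mat t t" by (simp add: M_def perm_mat_def)
  have ab: "a \<noteq> b" using a b by auto
  have Mij: "M $$ (i, j) = (if i = j then [:0, 1:] else 0) - (if i = \<sigma> j then 1 else 0)"
    if "i < t" "j < t" for i j
    using that by (simp add: M_def char_poly_matrix_def perm_mat_def one_pCons)
  define E :: "real poly mat" where "E = mat t t (\<lambda>(i, j).
    if i = a then (if j \<in> S then 1 else 0) else if i = b then (if j \<notin> S then 1 else 0)
    else if i = j then 1 else 0)"
  \<comment> \<open>\<open>E\<close> is the identity plus a matrix of square zero: its only nonzero
    rows are \<open>a\<close> and \<open>b\<close>, and they vanish in columns \<open>a\<close> and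
    \<open>b\<close>. So twice the identity minus \<open>E\<close> is the inverse.\<close>
  define F :: "real poly mat" where "F = mat t t (\<lambda>(i, j). (if i = j then 2 else 0) - E $$ (i, j))"
  define Dg :: "real poly mat" where "Dg = mat t t (\<lambda>(i, j).
    if i = j then (if i = a \<or> i = b then q else 1) else 0)"
  \<comment> \<open>Rows \<open>a\<close> and \<open>b\<close> of \<open>E * M\<close> are
    \<open>q\<close> times the indicators of \<open>S\<close> and of its complement;
    \<open>Dg\<close> takes the two factors \<open>q\<close> and \<open>M'\<close> keeps the
    rest.\<close>
  define M' where "M' = mat t t (\<lambda>(i, j).
    if i = a then (if j \<in> S then 1 else 0) else if i = b then (if j \<notin> S then 1 else 0)
    else M $$ (i, j))"
  have carr: "E \<in> carrier_mat t t" "F \<in> carrier_mat t t" "Dg \<in> carrier_mat t t" "M' \<in> carrier_mat t t"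
    by (simp_all add: E_def F_def Dg_def M'_def)
  have mult: "(A * B) $$ (i, j) = (\<Sum>k<t. A $$ (i, k) * B $$ (k, j))"
    if "A \<in> carrier_mat t t" "B \<in> carrier_mat t t" "i < t" "j < t" for A B :: "real poly mat" and i j
    using that by (simp add: scalar_prod_def lessThan_atLeast0)
  have E_row: "(\<Sum>k<t. E $$ (i, k) * f k) =
      (if i = a then \<Sum>k\<in>{..<t} \<inter> S. f k else if i = b then \<Sum>k\<in>{..<t} - S. f k else f i)"
    if i: "i < t" for i and f :: "nat \<Rightarrow> real poly"
  proof -
    have "(\<Sum>k<t. E $$ (i, k) * f k) = (\<Sum>k<t. if i = a then (if k \<in> S then f k else 0)
        else if i = b then (if k \<in> - S then f k else 0) else if i = k then f k else 0)"
      using i by (intro sum.cong) (auto simp: E_def)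
    also have "\<dots> = (if i = a then \<Sum>k\<in>{..<t} \<inter> S. f k else if i = b then \<Sum>k\<in>{..<t} \<inter> - S. f k else f i)"
      using i by (simp only: sum.inter_restrict[OF finite_lessThan]) (auto simp: sum.inter_restrict)
    finally show ?thesis by (simp add: Diff_eq)
  qed
  have indicator: "(\<Sum>k\<in>{..<t} \<inter> S. if k = j then u else 0) = (if j \<in> S then u else 0)"
    "(\<Sum>k\<in>{..<t} - S. if k = j then u else 0) = (if j \<notin> S then u else 0)"
    if "j < t" for j and u :: "real poly"
    using that by auto
  have "E * F = 1\<^sub>m t"
  proof (rule eq_matI)
    fix i j assume "i < dim_row (1\<^sub>m t :: real poly mat)" "j < dim_col (1\<^sub>m t :: real poly mat)"
    then have ij: "i < t" "j < t" by simp_all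
    have FS: "(\<Sum>k\<in>{..<t} \<inter> S. F $$ (k, j)) = (if a = j then 1 else 0)"
    proof -
      have "(\<Sum>k\<in>{..<t} \<inter> S. F $$ (k, j)) = (\<Sum>k\<in>{..<t} \<inter> S. (if k = j then 1 else 0) +
          (if k = a then (if a = j then 1 else 0) - (if j \<in> S then 1 else 0) else 0))"
        using ij a b by (intro sum.cong) (auto simp: F_def E_def)
      then show ?thesis using ij a by (simp add: sum.distrib indicator)
    qed
    have FN: "(\<Sum>k\<in>{..<t} - S. F $$ (k, j)) = (if b = j then 1 else 0)"
    proof -
      have "(\<Sum>k\<in>{..<t} - S. F $$ (k, j)) = (\<Sum>k\<in>{..<t} - S. (if k = j then 1 else 0) +
          (if k = b then (if b = j then 1 else 0) - (if j \<notin> S then 1 else 0) else 0))"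
        using ij a b by (intro sum.cong) (auto simp: F_def E_def)
      then show ?thesis using ij b by (simp add: sum.distrib indicator)
    qed
    have "(E * F) $$ (i, j) = (if i = j then 1 else 0)"
      unfolding mult[OF carr(1,2) ij] E_row[OF ij(1)] FS FN using ij by (auto simp: F_def E_def)
    then show "(E * F) $$ (i, j) = 1\<^sub>m t $$ (i, j)" using ij by simp
  qed (simp_all add: E_def F_def)
  then have detEF: "det E * det F = 1" using det_mult[OF carr(1,2)] by simp
  have "E * M = Dg * M'"
  proof (rule eq_matI)
    fix i j assume "i < dim_row (Dg * M')" "j < dim_col (Dg * M')"
    then have ij: "i < t" "j < t" by (simp_all add: Dg_def M'_def)
    have q: "q = [:0, 1:] - 1" by (simp add: q_def one_pCons)
    \<comment> \<open>Column \<open>j\<close> carries the indeterminate in row \<open>j\<close> and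
      -1 in row \<open>\<sigma> j\<close>. These rows are both in \<open>S\<close> or both outside,
      so the entries enter the sum together or not at all.\<close>
    have MS: "(\<Sum>k\<in>{..<t} \<inter> S. M $$ (k, j)) = (if j \<in> S then q else 0)"
    proof -
      have "(\<Sum>k\<in>{..<t} \<inter> S. M $$ (k, j)) =
          (\<Sum>k\<in>{..<t} \<inter> S. (if k = j then [:0, 1:] else 0) - (if k = \<sigma> j then 1 else 0))"
        using ij by (intro sum.cong) (auto simp: Mij)
      then show ?thesis using ij \<sigma>[OF ij(2)] inv[OF ij(2)] by (simp add: sum_subtractf indicator q)
    qed
    have MN: "(\<Sum>k\<in>{..<t} - S. M $$ (k, j)) = (if j \<notin> S then q else 0)"
    proof -
      have "(\<Sum>k\<in>{..<t} - S. M $$ (k, j)) =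
          (\<Sum>k\<in>{..<t} - S. (if k = j then [:0, 1:] else 0) - (if k = \<sigma> j then 1 else 0))"
        using ij by (intro sum.cong) (auto simp: Mij)
      then show ?thesis using ij \<sigma>[OF ij(2)] inv[OF ij(2)] by (simp add: sum_subtractf indicator q)
    qed
    have "(Dg * M') $$ (i, j) = (\<Sum>k<t. if i = k then (if i = a \<or> i = b then q else 1) * M' $$ (k, j) else 0)"
      unfolding mult[OF carr(3,4) ij] using ij by (intro sum.cong) (auto simp: Dg_def)
    also have "\<dots> = (if i = a \<or> i = b then q else 1) * M' $$ (i, j)" using ij by simp
    finally show "(E * M) $$ (i, j) = (Dg * M') $$ (i, j)"
      unfolding mult[OF carr(1) M ij] E_row[OF ij(1)] MS MN using ij ab by (auto simp: M'_def)
  qed (use M in \<open>simp_all add: E_def Dg_def M'_def\<close>)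
  then have "det E * det M = det Dg * det M'"
    using det_mult[OF carr(1) M] det_mult[OF carr(3,4)] by simp
  note EM = this
  have "det M = (det E * det F) * det M" unfolding detEF by simp
  also have "\<dots> = det F * (det E * det M)" by (simp only: mult_ac)
  also have "\<dots> = det Dg * (det F * det M')" unfolding EM by (simp only: mult_ac)
  finally have "det M = det Dg * (det F * det M')" .
  moreover have "det Dg = (\<Prod>i<t. if i = a \<or> i = b then q else 1)"
  proof -
    have "det Dg = prod_list (diag_mat Dg)"
      by (rule det_upper_triangular[OF _ carr(3)]) (auto simp: upper_triangular_def Dg_def)
    also have "\<dots> = (\<Prod>i<t. Dg $$ (i, i))"
      using carr(3) by (simp add: prod_list_diag_prod lessThan_atLeast0)
    also have "\<dots> = (\<Prod>i<t. if i = a \<or> i = b then q else 1)"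
      by (rule prod.cong) (simp_all add: Dg_def)
    finally show ?thesis .
  qed
  moreover have "(\<Prod>i<t. if i = a \<or> i = b then q else 1) = q ^ 2"
  proof -
    have "(\<Prod>i<t. if i = a \<or> i = b then q else 1) = (\<Prod>i\<in>{a, b}. q)"
      using a b by (intro prod.mono_neutral_cong_right) auto
    then show ?thesis using ab by (simp add: power2_eq_square)
  qed
  ultimately show ?thesis unfolding char_poly_def M_def[symmetric] q_def[symmetric] by simp
qed

text \<open>The orbit of 0 is invariant; if it missed some \<open>b\<close>, the divisibility above
  would make 1 a root of multiplicity at least two.\<close>

lemma eigenvalue_one_simple_transitive:
  assumes \<sigma>: "\<sigma> permutes {..<t}" and simple: "eigenvalue_one_simple (perm_mat t \<sigma>)" and t: "0 < t"
  shows "orbit \<sigma> 0 = {..<t}"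
proof (rule ccontr)
  have perm: "permutation \<sigma>" using \<sigma> by (auto simp: permutation_permutes)
  have sub: "orbit \<sigma> 0 \<subseteq> {..<t}" using permutes_orbit_subset[OF \<sigma>] t by simp
  assume "orbit \<sigma> 0 \<noteq> {..<t}"
  then obtain b where b: "b < t" "b \<notin> orbit \<sigma> 0" using sub by auto
  have "[:-1, 1:] ^ 2 dvd char_poly (perm_mat t \<sigma>)"
  proof (rule char_poly_perm_mat_dvd[of t \<sigma> "orbit \<sigma> 0" 0 b])
    show "\<sigma> j < t" if "j < t" for j using permutes_in_image[OF \<sigma>, of j] that by simp
    show "\<sigma> j \<in> orbit \<sigma> 0 \<longleftrightarrow> j \<in> orbit \<sigma> 0" for j
    proof
      assume "\<sigma> j \<in> orbit \<sigma> 0"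
      then have "orbit \<sigma> (\<sigma> j) = orbit \<sigma> 0"
        using cyclic_on_orbit'[OF perm] by (rule orbit_cyclic_eq3[rotated])
      then show "j \<in> orbit \<sigma> 0"
        using permutation_orbit_step[OF perm] permutation_self_in_orbit[OF perm] by metis
    qed (rule orbit.step)
    show "0 \<in> orbit \<sigma> 0" by (rule permutation_self_in_orbit[OF perm])
  qed (use t b in auto)
  \<comment> \<open>The order of a root is tied to divisibility only for a nonzero polynomial; a
    characteristic polynomial is monic.\<close>
  moreover have "char_poly (perm_mat t \<sigma>) \<noteq> 0"
    using degree_monic_char_poly[of "perm_mat t \<sigma>" t] by (auto simp: perm_mat_def)
  ultimately have "2 \<le> Polynomial.order 1 (char_poly (perm_mat t \<sigma>))"
    by (simp add: order_divides)
  then show False using simple by (simp add: eigenvalue_one_simple_def)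
qed

text \<open>\<open>pos\<close> inverts the listing \<open>(\<sigma> ^^ n) 0\<close> of the orbit.
  The first return time is the size of the orbit, hence \<open>t\<close>, so the listing closes up
  exactly there.\<close>

lemma cycle_positions:
  assumes \<sigma>: "\<sigma> permutes {..<t}" and orbit: "orbit \<sigma> 0 = {..<t}" and t: "0 < t"
  obtains pos where "bij_betw pos {..<t} {..<t}" "\<And>h. h < t \<Longrightarrow> pos (\<sigma> h) = Suc (pos h) mod t"
proof -
  have perm: "permutation \<sigma>" using \<sigma> by (auto simp: permutation_permutes)
  have self: "0 \<in> orbit \<sigma> 0" by (rule permutation_self_in_orbit[OF perm])
  define e where "e n = (\<sigma> ^^ n) 0" for n
  define n where "n = funpow_dist1 \<sigma> 0 0"
  have inj: "inj_on e {0..<n}" unfolding e_def n_def by (rule inj_on_funpow_dist1[OF self])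
  have img: "e ` {0..<n} = {..<t}"
    using orbit_conv_funpow_dist1[OF self] orbit by (simp add: e_def n_def)
  have "n = t" using card_image[OF inj] img by simp
  then have bij: "bij_betw e {..<t} {..<t}" using inj img by (simp add: bij_betw_def lessThan_atLeast0)
  have "e n = 0" unfolding e_def n_def by (rule funpow_dist1_prop[OF self])
  then have et: "e t = 0" by (simp only: \<open>n = t\<close>)
  define pos where "pos = the_inv_into {..<t} e"
  have pos: "bij_betw pos {..<t} {..<t}" unfolding pos_def by (rule bij_betw_the_inv_into[OF bij])
  have pos_e: "pos (e k) = k" if "k < t" for k
    unfolding pos_def using that bij by (intro the_inv_into_f_f) (auto simp: bij_betw_def)
  have "pos (\<sigma> h) = Suc (pos h) mod t" if h: "h < t" for h
  proof -
    obtain k where k: "k < t" "h = e k" using bij h by (metis bij_betw_def imageE lessThan_iff)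
    have step: "\<sigma> h = e (Suc k)" using k by (simp add: e_def)
    show ?thesis
    proof (cases "Suc k < t")
      case True
      then show ?thesis using k pos_e step by simp
    next
      case False
      then have "Suc k = t" using k by simp
      then have "\<sigma> h = e 0" using step et by (simp add: e_def)
      then show ?thesis using k pos_e t \<open>Suc k = t\<close> by simp
    qed
  qed
  then show thesis using that pos by blast
qed

text \<open>Real part of a geometric series in a \<open>t\<close>-th root of unity, with the phase
  as a constant factor. The ratio is 1 exactly when \<open>t\<close> divides
  \<open>z\<close>.\<close>

lemma sum_cos_arith:
  fixes z :: int and t :: nat
  assumes "0 < t"
  shows "(\<Sum>k<t. cos (2 * pi * real k * real_of_int z / real t - \<delta>)) =
    (if int t dvd z then real t * cos \<delta> else 0)"
proof -
  define \<theta> where "\<theta> = 2 * pi * real_of_int z / real t"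
  have "(\<Sum>k<t. cos (2 * pi * real k * real_of_int z / real t - \<delta>)) = Re (\<Sum>k<t. cis (- \<delta>) * cis \<theta> ^ k)"
    by (simp add: DeMoivre cis_mult \<theta>_def mult_ac)
  also have "(\<Sum>k<t. cis (- \<delta>) * cis \<theta> ^ k) = cis (- \<delta>) * (\<Sum>k<t. cis \<theta> ^ k)"
    by (simp add: sum_distrib_left)
  also have "(\<Sum>k<t. cis \<theta> ^ k) = (if int t dvd z then of_nat t else 0)"
  proof (cases "int t dvd z")
    case True
    then obtain m where "z = int t * m" by auto
    then have "\<theta> = 2 * pi * real_of_int m" using assms by (simp add: \<theta>_def)
    then have "cis \<theta> = 1" using cis_multiple_2pi[of "real_of_int m"] by simp
    then show ?thesis using True by simp
  next
    case False
    have ne: "cis \<theta> \<noteq> 1"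
    proof
      assume "cis \<theta> = 1"
      then have "cos \<theta> = 1" by (metis cis.sel(1) one_complex.sel(1))
      then obtain m :: int where "\<theta> = of_int m * 2 * pi" using cos_one_2pi_int by auto
      then have "real_of_int z = real_of_int (int t * m)"
        using assms pi_gt_zero by (simp add: \<theta>_def field_simps)
      then show False using False by (metis dvd_triv_left of_int_eq_iff)
    qed
    have "cis \<theta> ^ t = 1"
      using assms cis_multiple_2pi[of "real_of_int z"] by (simp add: DeMoivre \<theta>_def)
    then show ?thesis using False ne geometric_sum[OF ne, of t] by simp
  qed
  finally show ?thesis by (simp split: if_splits)
qed

section \<open>Counting in the planned designs\<close>

lemma sum_fibres:
  fixes f :: "'b \<Rightarrow> real"
  assumes "finite A" "finite B" "\<And>z. z \<in> A \<Longrightarrow> p z \<in> B"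
    and "\<And>y. y \<in> B \<Longrightarrow> card {z \<in> A. p z = y} = n y"
  shows "(\<Sum>z\<in>A. f (p z)) = (\<Sum>y\<in>B. real (n y) * f y)"
  using sum_fun_comp[of A B p f] assms by (simp add: image_subset_iff)

text \<open>Uniformity asserts only that the class sizes agree; adding them up determines their
  common value.\<close>

lemma uniform_count:
  assumes "finite A" "\<And>z. z \<in> A \<Longrightarrow> p z < t" "card A = n * t" "0 < t"
    and "\<exists>r. \<forall>h<t. card {z \<in> A. p z = h} = r" and "h < t"
  shows "card {z \<in> A. p z = h} = n"
proof -
  obtain r where r: "\<And>h. h < t \<Longrightarrow> card {z \<in> A. p z = h} = r" using assms by blast
  have "real (card A) = (\<Sum>y<t. real r * 1)"
    using sum_fibres[of A "{..<t}" p "\<lambda>_. r" "\<lambda>_. 1"] assms r by simp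
  then have "real (n * t) = real (t * r)" using assms(3) by simp
  then have "n * t = t * r" by (simp only: of_nat_eq_iff)
  then show ?thesis using assms(4,6) r by simp
qed

lemma UBRMD_sums:
  fixes f :: "nat \<Rightarrow> real" and F :: "nat \<Rightarrow> nat \<Rightarrow> real"
  assumes W: "UBRMD t (n * t) W" and t: "2 \<le> t"
  shows UBRMD_subject: "i < n * t \<Longrightarrow> (\<Sum>k<t. f (W k i)) = (\<Sum>h<t. f h)"
    and UBRMD_period: "k < t \<Longrightarrow> (\<Sum>i<n * t. f (W k i)) = real n * (\<Sum>h<t. f h)"
    and UBRMD_period_count: "k < t \<Longrightarrow> h < t \<Longrightarrow> card {i. i < n * t \<and> W k i = h} = n"
    and UBRMD_transitions: "(\<Sum>k<t - 1. \<Sum>i<n * t. F (W k i) (W (Suc k) i)) =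
      real n * (\<Sum>h<t. (\<Sum>h'<t. F h h') - F h h)"
proof -
  have range: "W k i < t" if "k < t" "i < n * t" for k i using W that by (auto simp: UBRMD_def)
  have us: "\<exists>r. \<forall>h<t. card {k. k < t \<and> W k i = h} = r" if "i < n * t" for i
    using W that by (auto simp: UBRMD_def uniform_arr_def)
  have up: "\<exists>r. \<forall>h<t. card {i. i < n * t \<and> W k i = h} = r" if "k < t" for k
    using W that by (auto simp: UBRMD_def uniform_arr_def)
  have cs: "card {k \<in> {..<t}. W k i = h} = 1" if "i < n * t" "h < t" for i h
    using uniform_count[of "{..<t}" "\<lambda>k. W k i" t 1 h] range us that t by simp
  have cp: "card {i \<in> {..<n * t}. W k i = h} = n" if "k < t" "h < t" for k h
    using uniform_count[of "{..<n * t}" "W k" t n h] range up that t by simp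
  show "(\<Sum>k<t. f (W k i)) = (\<Sum>h<t. f h)" if "i < n * t"
    using sum_fibres[of "{..<t}" "{..<t}" "\<lambda>k. W k i" "\<lambda>_. 1" f] range cs that by simp
  show "(\<Sum>i<n * t. f (W k i)) = real n * (\<Sum>h<t. f h)" if "k < t"
    using sum_fibres[of "{..<n * t}" "{..<t}" "W k" "\<lambda>_. n" f] range cp that
    by (simp add: sum_distrib_left)
  show "card {i. i < n * t \<and> W k i = h} = n" if "k < t" "h < t" using cp[OF that] by simp
  obtain l where l: "\<And>h h'. h < t \<Longrightarrow> h' < t \<Longrightarrow> predecessors t (n * t) W h h' = (if h = h' then 0 else l)"
    using W unfolding UBRMD_def balanced_arr_def by blast
  have transitions: "(\<Sum>k<t - 1. \<Sum>i<n * t. G (W k i) (W (Suc k) i)) =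
      real l * (\<Sum>h<t. (\<Sum>h'<t. G h h') - G h h)" for G :: "nat \<Rightarrow> nat \<Rightarrow> real"
  proof -
    let ?p = "\<lambda>z. (W (fst z) (snd z), W (Suc (fst z)) (snd z))"
    have "card {z \<in> {..<t - 1} \<times> {..<n * t}. ?p z = y} = (if fst y = snd y then 0 else l)"
      if "y \<in> {..<t} \<times> {..<t}" for y
    proof -
      have "{z \<in> {..<t - 1} \<times> {..<n * t}. ?p z = y} =
          {(k, i). Suc k < t \<and> i < n * t \<and> W k i = fst y \<and> W (Suc k) i = snd y}"
        by (cases y) (auto simp: less_diff_conv)
      \<comment> \<open>\<open>predecessors\<close> takes the later treatment first, while
        \<open>y\<close> lists the earlier one first.\<close>
      also have "card \<dots> = predecessors t (n * t) W (snd y) (fst y)" by (simp add: predecessors_def)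
      finally show ?thesis using l[of "snd y" "fst y"] that by (cases y) auto
    qed
    then have "(\<Sum>z\<in>{..<t - 1} \<times> {..<n * t}. case_prod G (?p z)) =
        (\<Sum>y\<in>{..<t} \<times> {..<t}. real (if fst y = snd y then 0 else l) * case_prod G y)"
      using range by (intro sum_fibres) auto
    then have "(\<Sum>k<t - 1. \<Sum>i<n * t. G (W k i) (W (Suc k) i)) =
        (\<Sum>h<t. \<Sum>h'<t. real (if h = h' then 0 else l) * G h h')"
      by (simp add: sum.cartesian_product')
    also have "\<dots> = (\<Sum>h<t. \<Sum>h'<t. real l * G h h' - (if h = h' then real l * G h h' else 0))"
      by (intro sum.cong) auto
    finally show ?thesis by (simp add: sum_subtractf sum_distrib_left right_diff_distrib)
  qed
  \<comment> \<open>Counting all transitions, with the constant function 1, identifies the unknown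
    balance constant \<open>l\<close> with \<open>n\<close>.\<close>
  have "real (t - 1) * real (n * t) = real l * (real t * (real t - 1))"
    using transitions[of "\<lambda>_ _. 1"] by (simp add: sum_subtractf algebra_simps)
  then have "real l = real n" using t by (simp add: of_nat_diff)
  then show "(\<Sum>k<t - 1. \<Sum>i<n * t. F (W k i) (W (Suc k) i)) =
      real n * (\<Sum>h<t. (\<Sum>h'<t. F h h') - F h h)"
    using transitions[of F] by simp
qed

text \<open>Replication multiplies every sum over columns by \<open>c\<close>, so the identities of
  the array persist with factor \<open>n * c\<close>. This is \<open>g\<close> in both classes: one
  square with \<open>g\<close> copies, or two with \<open>g div 2\<close> copies.\<close>

lemma layout_of_plan:
  assumes W: "UBRMD t (n * t) W" and t: "2 \<le> t" and c: "0 < c"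
    and plan: "plan t (n * t) c W d"
    and last: "\<And>F :: nat \<Rightarrow> nat \<Rightarrow> real. (\<Sum>i<n * t. F (W (t - 2) i) (W (t - 1) i)) =
      real n * (\<Sum>h<t. \<Sum>h'<t. N h h' * F h h')"
  shows "crossover_layout t (subjects d) (real (n * c)) (assign d) N"
proof -
  obtain q where s: "subjects d = n * t * c" and q: "\<And>i. i < n * t * c \<Longrightarrow> q i < n * t"
    and fib: "\<And>j. j < n * t \<Longrightarrow> card {i. i < n * t * c \<and> q i = j} = c"
    and assign: "\<And>k i. k < t \<Longrightarrow> i < n * t * c \<Longrightarrow> assign d k i = W k (q i)"
  proof -
    from plan have "subjects d = n * t * c" and "\<exists>q. (\<forall>i<n * t * c. q i < n * t) \<and>
        (\<forall>j<n * t. card {i. i < n * t * c \<and> q i = j} = c) \<and>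
        (\<forall>k<t. \<forall>i<n * t * c. assign d k i = W k (q i))"
      unfolding plan_def by blast+
    then show thesis using that by blast
  qed
  have transfer: "(\<Sum>i<subjects d. f (q i)) = real c * (\<Sum>j<n * t. f j)" for f :: "nat \<Rightarrow> real"
    unfolding s using sum_fibres[of "{..<n * t * c}" "{..<n * t}" q "\<lambda>_. c" f] q fib
    by (simp add: sum_distrib_left)
  have range: "W k i < t" if "k < t" "i < n * t" for k i using W that by (auto simp: UBRMD_def)
  have n: "0 < n" using W t by (auto simp: UBRMD_def)
  note sums = UBRMD_sums[OF W t]
  show ?thesis
  proof
    show "2 \<le> t" by fact
    show "0 < real (n * c)" using n c by simp
    show "assign d k i < t" if "k < t" "i < subjects d" for k i
      using that range q assign s by simp
    show "(\<Sum>k<t. f (assign d k i)) = (\<Sum>h<t. f h)" if "i < subjects d" for i and f :: "nat \<Rightarrow> real"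
      using that sums(1)[OF q, of i f] assign s by simp
    show "(\<Sum>i<subjects d. f (assign d k i)) = real (n * c) * (\<Sum>h<t. f h)" if "k < t"
      for k and f :: "nat \<Rightarrow> real"
    proof -
      have "(\<Sum>i<subjects d. f (assign d k i)) = (\<Sum>i<subjects d. f (W k (q i)))"
        using that assign s by simp
      then show ?thesis using sums(2)[OF that, of f] by (simp add: transfer[of "\<lambda>j. f (W k j)"])
    qed
    show "(\<Sum>k<t - 1. \<Sum>i<subjects d. F (assign d k i) (assign d (Suc k) i)) =
        real (n * c) * (\<Sum>h<t. (\<Sum>h'<t. F h h') - F h h)" for F :: "nat \<Rightarrow> nat \<Rightarrow> real"
    proof -
      have "(\<Sum>k<t - 1. \<Sum>i<subjects d. F (assign d k i) (assign d (Suc k) i)) =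
          (\<Sum>k<t - 1. \<Sum>i<subjects d. F (W k (q i)) (W (Suc k) (q i)))"
        using assign s by (intro sum.cong) auto
      also have "\<dots> = (\<Sum>k<t - 1. real c * (\<Sum>j<n * t. F (W k j) (W (Suc k) j)))"
        by (intro sum.cong refl) (rule transfer)
      also have "\<dots> = real c * (\<Sum>k<t - 1. \<Sum>j<n * t. F (W k j) (W (Suc k) j))"
        by (rule sum_distrib_left[symmetric])
      also have "\<dots> = real (n * c) * (\<Sum>h<t. (\<Sum>h'<t. F h h') - F h h)"
        unfolding sums(4)[of F] by simp
      finally show ?thesis .
    qed
    show "(\<Sum>i<subjects d. F (assign d (t - 2) i) (assign d (t - 1) i)) =
        real (n * c) * (\<Sum>h<t. \<Sum>h'<t. N h h' * F h h')" for F :: "nat \<Rightarrow> nat \<Rightarrow> real"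
    proof -
      have "(\<Sum>i<subjects d. F (assign d (t - 2) i) (assign d (t - 1) i)) =
          (\<Sum>i<subjects d. F (W (t - 2) (q i)) (W (t - 1) (q i)))"
        using assign s t by (intro sum.cong) auto
      also have "\<dots> = real c * (\<Sum>j<n * t. F (W (t - 2) j) (W (t - 1) j))" by (rule transfer)
      finally show ?thesis using last[of F] by simp
    qed
  qed
qed

text \<open>\<open>\<sigma>\<close> is the last row composed with the inverse of the row before it,
  and the identity outside \<open>{..<t}\<close> so that it fits \<open>permutes\<close>.\<close>

lemma last_rows_permutation:
  assumes "row_permutation t W (t - 2)" "row_permutation t W (t - 1)"
    and range: "\<And>k i. k < t \<Longrightarrow> i < t \<Longrightarrow> W k i < t" and t: "2 \<le> t"
  obtains \<sigma> where "\<sigma> permutes {..<t}" "Pi_mat t W = perm_mat t \<sigma>"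
    "\<And>F :: nat \<Rightarrow> nat \<Rightarrow> real. (\<Sum>i<t. F (W (t - 2) i) (W (t - 1) i)) = (\<Sum>h<t. F h (\<sigma> h))"
proof -
  have bij: "bij_betw (W k) {..<t} {..<t}" if rp: "row_permutation t W k" and k: "k < t" for k
  proof -
    have "\<exists>!i. i < t \<and> W k i = h" if "h < t" for h
      using rp that by (simp add: row_permutation_def)
    then have "inj_on (W k) {..<t}"
      using range[OF k] by (intro inj_onI) (metis lessThan_iff)
    moreover have "W k ` {..<t} \<subseteq> {..<t}" using range[OF k] by auto
    ultimately show ?thesis
      by (simp add: bij_betw_def endo_inj_surj)
  qed
  let ?a = "W (t - 2)" and ?b = "W (t - 1)"
  have a: "bij_betw ?a {..<t} {..<t}" and b: "bij_betw ?b {..<t} {..<t}" using bij assms t by auto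
  define \<sigma> where "\<sigma> h = (if h < t then ?b (the_inv_into {..<t} ?a h) else h)" for h
  have \<sigma>a: "\<sigma> (?a i) = ?b i" if "i < t" for i
    using that a range t by (auto simp: \<sigma>_def bij_betw_def the_inv_into_f_f)
  have "bij_betw (\<lambda>h. ?b (the_inv_into {..<t} ?a h)) {..<t} {..<t}"
    using bij_betw_trans[OF bij_betw_the_inv_into[OF a] b] by (simp add: comp_def)
  then have "bij_betw \<sigma> {..<t} {..<t}" by (rule bij_betw_cong[THEN iffD1, rotated]) (simp add: \<sigma>_def)
  then have perm: "\<sigma> permutes {..<t}" by (rule bij_imp_permutes) (simp add: \<sigma>_def)
  have sum: "(\<Sum>i<t. F (?a i) (?b i)) = (\<Sum>h<t. F h (\<sigma> h))" for F :: "nat \<Rightarrow> nat \<Rightarrow> real"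
    using sum.reindex_bij_betw[OF a, of "\<lambda>h. F h (\<sigma> h)"] \<sigma>a by simp
  have "Pi_mat t W = perm_mat t \<sigma>"
  proof (rule eq_matI)
    fix h h' assume "h < dim_row (perm_mat t \<sigma>)" "h' < dim_col (perm_mat t \<sigma>)"
    then have h: "h < t" "h' < t" by (simp_all add: perm_mat_def)
    have "Pi_mat t W $$ (h, h') = (\<Sum>i<t. (if ?b i = h then 1 else 0) * (if ?a i = h' then 1 else 0))"
      using h by (simp add: Pi_mat_def P_mat_def scalar_prod_def lessThan_atLeast0)
    also have "\<dots> = (\<Sum>x<t. (if \<sigma> x = h then 1 else 0) * (if x = h' then 1 else 0))"
      by (rule sum)
    also have "\<dots> = (\<Sum>x<t. if x = h' then (if \<sigma> x = h then 1 else 0) else 0)"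
      by (rule sum.cong) auto
    finally show "Pi_mat t W $$ (h, h') = perm_mat t \<sigma> $$ (h, h')"
      using h by (auto simp: perm_mat_def)
  qed (simp_all add: Pi_mat_def P_mat_def perm_mat_def)
  then show thesis using that perm sum by blast
qed

lemma row_permutationI:
  assumes "\<And>h. h < t \<Longrightarrow> card {i. i < t \<and> W k i = h} = 1"
  shows "row_permutation t W k"
  unfolding row_permutation_def
proof (intro allI impI)
  fix h assume "h < t"
  then obtain i where "{i. i < t \<and> W k i = h} = {i}" using assms by (meson card_1_singletonE)
  then show "\<exists>!i. i < t \<and> W k i = h" by (intro ex1I[of _ i]) auto
qed

section \<open>Real Fourier vectors along the cycle\<close>

definition wave :: "nat \<Rightarrow> (nat \<Rightarrow> nat) \<Rightarrow> nat \<Rightarrow> real \<Rightarrow> nat \<Rightarrow> real" where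
  "wave t pos r \<delta> h = cos (2 * pi * real (pos h) * real r / real t - \<delta>)"

text \<open>Along the cycle: one step forward plus one step back multiplies a wave by
  \<open>2 * cos \<phi>\<close>, the quantity in the denominator of
  \<open>\<theta> r\<close>.\<close>

lemma wave_shift_sum:
  "wave t pos r (\<delta> - \<phi>) h + wave t pos r (\<delta> + \<phi>) h = 2 * cos \<phi> * wave t pos r \<delta> h"
  by (simp add: wave_def cos_diff cos_add sin_diff sin_add algebra_simps)

lemma wave_sum_zero:
  assumes "bij_betw pos {..<t} {..<t}" "0 < r" "r < t"
  shows "(\<Sum>h<t. wave t pos r \<delta> h) = 0"
proof -
  have "(\<Sum>h<t. wave t pos r \<delta> h) = (\<Sum>k<t. cos (2 * pi * real k * real_of_int (int r) / real t - \<delta>))"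
    using sum.reindex_bij_betw[OF assms(1), of "\<lambda>k. cos (2 * pi * real k * real r / real t - \<delta>)"]
    by (simp add: wave_def)
  then show ?thesis using sum_cos_arith[of t "int r" \<delta>] assms by (auto dest: dvd_imp_le)
qed

text \<open>The free phase keeps the real waves closed under the cycle: a step lowers
  \<open>\<delta>\<close> by a fixed angle, in place of a complex eigenvalue. Wrapping around modulo
  \<open>t\<close> costs a multiple of \<open>2 * pi\<close>.\<close>

lemma wave_next:
  assumes "pos h' = Suc (pos h) mod t" "0 < t"
  shows "wave t pos r \<delta> h' = wave t pos r (\<delta> - 2 * pi * real r / real t) h"
proof -
  define m where "m = Suc (pos h) div t"
  have "Suc (pos h) = m * t + pos h'" by (simp add: m_def assms(1))
  then have "real (Suc (pos h)) = real (m * t + pos h')" by (simp only:)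
  then have eq: "real (pos h) = real m * real t + real (pos h') - 1" by simp
  have "2 * pi * real (pos h) * real r / real t - (\<delta> - 2 * pi * real r / real t) =
      2 * pi * real (pos h') * real r / real t - \<delta> + 2 * real (m * r) * pi"
    unfolding eq using assms(2) by (simp add: field_simps)
  then show ?thesis
    unfolding wave_def by (simp only: cos_add[of _ "2 * real (m * r) * pi"] cos_2npi sin_2npi)
qed

text \<open>All frequencies with the phases 0 and \<open>pi / 2\<close> form a tight frame of
  constant \<open>t\<close>. Although \<open>r\<close> and \<open>t - r\<close> span the same space,
  using both makes the two squared norms at each \<open>r\<close> add up to \<open>t\<close>, so
  each \<open>r\<close> contributes exactly \<open>1 / l r\<close>.\<close>

lemma trace_pinv_waves:
  assumes C: "C \<in> carrier_mat t t" "C\<^sup>T = C" "C *\<^sub>v one_vec t = 0\<^sub>v t" and t: "0 < t"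
    and pos: "bij_betw pos {..<t} {..<t}"
    and eig: "\<And>r \<delta>. 0 < r \<Longrightarrow> r < t \<Longrightarrow> C *\<^sub>v vec t (wave t pos r \<delta>) = l r \<cdot>\<^sub>v vec t (wave t pos r \<delta>)"
    and lpos: "\<And>r. 0 < r \<Longrightarrow> r < t \<Longrightarrow> 0 < l r"
  shows "centered_pd t C" and "mat_trace (moore_penrose C) = (\<Sum>r = 1..t-1. 1 / l r)"
proof -
  define K where "K = {..<t} \<times> {0, pi / 2}"
  define w where "w j = wave t pos (fst j) (snd j)" for j
  define l' where "l' j = (if fst j = 0 then 0 else l (fst j))" for j :: "nat \<times> real"
  have const: "\<exists>a. \<forall>h<t. w j h = a" if "fst j = 0" for j
    using that by (simp add: w_def wave_def)
  have sumK: "(\<Sum>j\<in>K. f j) = (\<Sum>r<t. f (r, 0) + f (r, pi / 2))" for f :: "nat \<times> real \<Rightarrow> real"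
    unfolding K_def by (simp add: sum.cartesian_product')
  have "C *\<^sub>v vec t (w j) = l' j \<cdot>\<^sub>v vec t (w j)" if "j \<in> K" for j
  proof (cases "fst j = 0")
    case True
    then obtain a where "\<forall>h<t. w j h = a" using const by blast
    then have "vec t (w j) = a \<cdot>\<^sub>v one_vec t" by (intro eq_vecI) (auto simp: one_vec_def)
    then have "C *\<^sub>v vec t (w j) = 0\<^sub>v t" using smult_one_zero[OF C(1,3)] by simp
    moreover have "l' j \<cdot>\<^sub>v vec t (w j) = 0\<^sub>v t" using True zero_smult_vec[of "vec t (w j)" t] by (simp add: l'_def)
    ultimately show ?thesis by simp
  next
    case False
    then show ?thesis using that eig[of "fst j" "snd j"] by (auto simp: K_def w_def l'_def)
  qed
  moreover have "0 \<le> l' j" if "j \<in> K" for j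
    using that lpos[of "fst j"] by (auto simp: l'_def K_def intro: less_imp_le)
  moreover have "\<exists>a. \<forall>h<t. w j h = a" if "j \<in> K" "l' j = 0" for j
  proof (rule const, rule ccontr)
    assume "fst j \<noteq> 0"
    then show False using that lpos[of "fst j"] by (auto simp: l'_def K_def)
  qed
  moreover have "(\<Sum>j\<in>K. w j m * w j n) = (if m = n then real t else 0)" if "m < t" "n < t" for m n
  proof -
    let ?z = "int (pos m) - int (pos n)"
    have lt: "pos m < t" "pos n < t" using pos that by (auto dest: bij_betwE)
    \<comment> \<open>The cosine and sine products combine to the cosine of a difference, leaving a
      sum over roots of unity in the frequency.\<close>
    have "(\<Sum>j\<in>K. w j m * w j n) = (\<Sum>r<t. cos (2 * pi * real r * real_of_int ?z / real t - 0))"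
      unfolding sumK
    proof (rule sum.cong[OF refl])
      fix r
      have *: "2 * pi * real r * real_of_int ?z / real t - 0 =
          2 * pi * real (pos m) * real r / real t - 2 * pi * real (pos n) * real r / real t"
        by (simp add: algebra_simps diff_divide_distrib)
      show "w (r, 0) m * w (r, 0) n + w (r, pi / 2) m * w (r, pi / 2) n =
          cos (2 * pi * real r * real_of_int ?z / real t - 0)"
        unfolding * cos_diff by (simp add: w_def wave_def cos_diff)
    qed
    also have "\<dots> = (if int t dvd ?z then real t * cos 0 else 0)" by (rule sum_cos_arith[OF t])
    also have "int t dvd ?z \<longleftrightarrow> m = n"
    proof
      assume "int t dvd ?z"
      then have "?z = 0" using lt dvd_imp_le_int[of ?z "int t"] by fastforce
      then show "m = n" using pos that by (auto simp: bij_betw_def inj_on_def)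
    qed simp
    finally show ?thesis by simp
  qed
  ultimately have frame: "centered_pd t C"
    "mat_trace (moore_penrose C) = (\<Sum>j\<in>K. (1 / l' j) * (\<Sum>m<t. (w j m)\<^sup>2)) / real t"
    using trace_pinv_frame[OF C t, of "real t" K w l'] t by auto
  show "centered_pd t C" by (rule frame(1))
  have "(\<Sum>m<t. (w (r, 0) m)\<^sup>2) + (\<Sum>m<t. (w (r, pi / 2) m)\<^sup>2) = real t" for r
    unfolding sum.distrib[symmetric] by (simp add: w_def wave_def cos_diff)
  then have "(1 / l' (r, 0)) * (\<Sum>m<t. (w (r, 0) m)\<^sup>2) + (1 / l' (r, pi / 2)) * (\<Sum>m<t. (w (r, pi / 2) m)\<^sup>2)
      = (if r = 0 then 0 else real t * (1 / l r))" for r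
    by (simp add: l'_def add_divide_distrib[symmetric])
  then have "mat_trace (moore_penrose C) = (\<Sum>r<t. if r = 0 then 0 else real t * (1 / l r)) / real t"
    unfolding frame(2) sumK by simp
  also have "(\<Sum>r<t. if r = 0 then 0 else real t * (1 / l r)) = (\<Sum>r = 1..t-1. real t * (1 / l r))"
    using t by (intro sum.mono_neutral_cong_right) auto
  finally show "mat_trace (moore_penrose C) = (\<Sum>r = 1..t-1. 1 / l r)"
    using t by (simp add: sum_divide_distrib)
qed

section \<open>Eigenvalues and loss of precision\<close>

context crossover_layout
begin

lemma forward_linear: "forward (\<lambda>h. K * (u h + v h)) h = K * (forward u h + forward v h)"
  by (simp add: forward_def sum_distrib_left distrib_left sum.distrib mult_ac)

lemma backward_linear: "backward (\<lambda>h. K * (u h + v h)) h = K * (backward u h + backward v h)"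
  by (simp add: backward_def sum_distrib_left distrib_left sum.distrib mult_ac)

lemma forward_scale: "forward (\<lambda>h. K * u h) h = K * forward u h"
  by (simp add: forward_def sum_distrib_left mult_ac)

lemma backward_scale: "backward (\<lambda>h. K * u h) h = K * backward u h"
  by (simp add: backward_def sum_distrib_left mult_ac)

text \<open>With q = t^2 - t - 1 the carry-over equation gives \<open>c\<close> as -t/q times
  \<open>x\<close>. The eigenvalue is then g t (1 - 1/q), and q - 1 factors as (t - 2)(t +
  1).\<close>

lemma info_full_eigenvector:
  assumes d: "treatments d = t" "subjects d = s" "assign d = D" "valid_assign d"
    and obs: "set (obs d) = {..<t} \<times> {..<s}"
    and x0: "(\<Sum>h<t. x h) = 0"
  shows "info_matrix d *\<^sub>v vec t x =
    (g * real t * (real t - 2) * (real t + 1) / ((real t)\<^sup>2 - real t - 1)) \<cdot>\<^sub>v vec t x"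
proof -
  define q where "q = (real t)\<^sup>2 - real t - 1"
  have q: "q > 0"
  proof -
    have "2 * real t \<le> real t * real t" using t by (intro mult_right_mono) auto
    then show ?thesis using t unfolding q_def power2_eq_square by linarith
  qed
  define c where "c h = - (real t / q) * x h" for h
  have c0: "(\<Sum>h<t. c h) = 0" 
    unfolding c_def sum_distrib_left[symmetric] x0 by simp
  have eq: "real t * x h = - ((real t)\<^sup>2 - real t - 1) * c h" for h
    using q by (simp add: c_def flip: q_def)
  have "info_matrix d *\<^sub>v vec t x = vec t (\<lambda>h. g * (real t * x h + c h))"
    by (rule info_matrix_mult_vecI[OF d obs normal_equations_full[OF x0 c0 eq] direct_full[OF x0 c0]])
  also have "\<dots> = (g * real t * (real t - 2) * (real t + 1) / q) \<cdot>\<^sub>v vec t x"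
  proof (rule eq_vecI)
    fix h assume "h < dim_vec ((g * real t * (real t - 2) * (real t + 1) / q) \<cdot>\<^sub>v vec t x)"
    have "g * (real t * x h + c h) = g * real t * (q - 1) / q * x h"
      using q by (simp add: c_def field_simps)
    also have "q - 1 = (real t - 2) * (real t + 1)"
      by (simp add: q_def power2_eq_square algebra_simps)
    finally show "vec t (\<lambda>h. g * (real t * x h + c h)) $ h =
        ((g * real t * (real t - 2) * (real t + 1) / q) \<cdot>\<^sub>v vec t x) $ h"
      using \<open>h < _\<close> by (simp add: mult.assoc)
  qed simp
  finally show ?thesis by (simp add: q_def)
qed

text \<open>Separates what depends on the class: the carry-over solution \<open>c\<close> and the
  scalar \<open>\<mu>\<close> that it causes to be subtracted from \<open>t - 2\<close>.\<close>

lemma info_short_eigenvector: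
  assumes d: "treatments d = t" "subjects d = s" "assign d = D" "valid_assign d"
    and obs: "set (obs d) = {..<t - 1} \<times> {..<s}"
    and x0: "(\<Sum>h<t. x h) = 0" and c0: "(\<Sum>h<t. c h) = 0"
    and eq: "\<And>h. h < t \<Longrightarrow> real t * (x h + forward x h) =
      - real t * (real t - 3) * c h + forward c h + backward c h"
    and mu: "\<And>h. h < t \<Longrightarrow> c h + backward c h = - \<mu> * x h"
  shows "info_matrix d *\<^sub>v vec t x = (g * (real t / (real t - 1) * (real t - 2 - \<mu>))) \<cdot>\<^sub>v vec t x"
proof -
  have "info_matrix d *\<^sub>v vec t x =
      vec t (\<lambda>h. g * real t / (real t - 1) * ((real t - 2) * x h + c h + backward c h))"
    by (rule info_matrix_mult_vecI[OF d obs normal_equations_short[OF x0 c0 eq] direct_short[OF x0 c0]])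
  also have "\<dots> = (g * (real t / (real t - 1) * (real t - 2 - \<mu>))) \<cdot>\<^sub>v vec t x"
  proof (rule eq_vecI)
    fix h assume "h < dim_vec ((g * (real t / (real t - 1) * (real t - 2 - \<mu>))) \<cdot>\<^sub>v vec t x)"
    then have h: "h < t" by simp
    have "(real t - 2) * x h + c h + backward c h = (real t - 2 - \<mu>) * x h"
      using mu[OF h] by (simp add: algebra_simps)
    then show "vec t (\<lambda>h. g * real t / (real t - 1) * ((real t - 2) * x h + c h + backward c h)) $ h =
        ((g * (real t / (real t - 1) * (real t - 2 - \<mu>))) \<cdot>\<^sub>v vec t x) $ h"
      using h by simp
  qed simp
  finally show ?thesis .
qed

text \<open>\<open>forward\<close> plus \<open>backward\<close> is the scalar
  \<open>2 * cos \<phi>\<close> on waves, so \<open>c\<close> is \<open>- t / ?\<Delta>\<close>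
  times \<open>x + forward x\<close>, a mix of two phases. In \<open>c + backward c\<close> the
  phases recombine to \<open>2 + 2 * cos \<phi>\<close> times the original wave.\<close>

lemma info_short_wave_A:
  assumes d: "treatments d = t" "subjects d = s" "assign d = D" "valid_assign d"
    and obs: "set (obs d) = {..<t - 1} \<times> {..<s}"
    and w0: "\<And>\<delta>. (\<Sum>h<t. w \<delta> h) = 0"
    and fw: "\<And>\<delta> h. h < t \<Longrightarrow> forward (w \<delta>) h = w (\<delta> - \<phi>) h"
    and bw: "\<And>\<delta> h. h < t \<Longrightarrow> backward (w \<delta>) h = w (\<delta> + \<phi>) h"
    and shift: "\<And>\<delta> h. w (\<delta> - \<phi>) h + w (\<delta> + \<phi>) h = 2 * cos \<phi> * w \<delta> h"
    and \<Delta>: "0 < real t * (real t - 3) - 2 * cos \<phi>" (is "0 < ?\<Delta>")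
  shows "info_matrix d *\<^sub>v vec t (w \<delta>) = (g * (real t / (real t - 1) *
    (real t - 2 - 2 * real t * (1 + cos \<phi>) / ?\<Delta>))) \<cdot>\<^sub>v vec t (w \<delta>)"
proof -
  define K where "K = - real t / ?\<Delta>"
  have K: "K * ?\<Delta> = - real t" using \<Delta> by (simp add: K_def)
  define c where "c h = K * (w \<delta> h + w (\<delta> - \<phi>) h)" for h
  have c_eq: "c = (\<lambda>h. K * (w \<delta> h + w (\<delta> - \<phi>) h))" by (simp add: c_def fun_eq_iff)
  have c0: "(\<Sum>h<t. c h) = 0"
    using w0[of \<delta>] w0[of "\<delta> - \<phi>"] by (simp add: c_def sum.distrib flip: sum_distrib_left)
  show ?thesis
  proof (rule info_short_eigenvector[OF d obs w0 c0])
    fix h assume h: "h < t"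
    have fc: "forward c h = K * (w (\<delta> - \<phi>) h + w (\<delta> - \<phi> - \<phi>) h)"
      unfolding c_eq forward_linear using fw[OF h] by simp
    have bc: "backward c h = K * (w (\<delta> + \<phi>) h + w \<delta> h)"
      unfolding c_eq backward_linear using bw[OF h] by simp
    have "forward c h + backward c h = K * ((w (\<delta> - \<phi>) h + w (\<delta> + \<phi>) h) +
        (w (\<delta> - \<phi> - \<phi>) h + w (\<delta> - \<phi> + \<phi>) h))"
      unfolding fc bc by (simp add: algebra_simps)
    also have "\<dots> = 2 * cos \<phi> * c h" unfolding shift c_def by (simp add: algebra_simps)
    finally have "- real t * (real t - 3) * c h + forward c h + backward c h = - ?\<Delta> * c h"
      by (simp add: algebra_simps)
    also have "\<dots> = - (K * ?\<Delta>) * (w \<delta> h + w (\<delta> - \<phi>) h)"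
      by (simp add: c_def algebra_simps)
    finally show "real t * (w \<delta> h + forward (w \<delta>) h) =
        - real t * (real t - 3) * c h + forward c h + backward c h"
      unfolding K fw[OF h] by simp
    have "c h + backward c h = K * (2 * w \<delta> h + (w (\<delta> - \<phi>) h + w (\<delta> + \<phi>) h))"
      unfolding bc c_def by (simp add: algebra_simps)
    also have "\<dots> = - (2 * real t * (1 + cos \<phi>) / ?\<Delta>) * w \<delta> h"
      unfolding shift K_def by (simp add: algebra_simps add_divide_distrib)
    finally show "c h + backward c h = - (2 * real t * (1 + cos \<phi>) / ?\<Delta>) * w \<delta> h" .
  qed
qed

text \<open>Here \<open>forward\<close> and \<open>backward\<close> are each the scalar
  \<open>cos \<phi>\<close>, so \<open>c\<close> is a multiple of \<open>w\<close>. The square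
  arises because \<open>1 + cos \<phi>\<close> enters through \<open>x + forward x\<close> and again
  through \<open>c + backward c\<close>.\<close>

lemma info_short_wave_B:
  assumes d: "treatments d = t" "subjects d = s" "assign d = D" "valid_assign d"
    and obs: "set (obs d) = {..<t - 1} \<times> {..<s}"
    and w0: "(\<Sum>h<t. w h) = 0"
    and fw: "\<And>h. h < t \<Longrightarrow> forward w h = cos \<phi> * w h"
    and bw: "\<And>h. h < t \<Longrightarrow> backward w h = cos \<phi> * w h"
    and \<Delta>: "0 < real t * (real t - 3) - 2 * cos \<phi>" (is "0 < ?\<Delta>")
  shows "info_matrix d *\<^sub>v vec t w = (g * (real t / (real t - 1) *
    (real t - 2 - real t * (1 + cos \<phi>)\<^sup>2 / ?\<Delta>))) \<cdot>\<^sub>v vec t w"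
proof -
  define K where "K = - real t / ?\<Delta> * (1 + cos \<phi>)"
  have K: "K * ?\<Delta> = - real t * (1 + cos \<phi>)" using \<Delta> by (simp add: K_def)
  have c0: "(\<Sum>h<t. K * w h) = 0" using w0 by (simp flip: sum_distrib_left)
  show ?thesis
  proof (rule info_short_eigenvector[OF d obs w0 c0])
    fix h assume h: "h < t"
    have "- real t * (real t - 3) * (K * w h) + forward (\<lambda>h. K * w h) h + backward (\<lambda>h. K * w h) h =
        - (K * ?\<Delta>) * w h"
      unfolding forward_scale backward_scale fw[OF h] bw[OF h] by (simp add: algebra_simps)
    then show "real t * (w h + forward w h) =
        - real t * (real t - 3) * (K * w h) + forward (\<lambda>h. K * w h) h + backward (\<lambda>h. K * w h) h"
      unfolding K fw[OF h] by (simp add: algebra_simps)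
    have "K * w h + backward (\<lambda>h. K * w h) h = K * (1 + cos \<phi>) * w h"
      unfolding backward_scale bw[OF h] by (simp add: algebra_simps)
    also have "\<dots> = - (real t * (1 + cos \<phi>)\<^sup>2 / ?\<Delta>) * w h"
      unfolding K_def by (simp add: power2_eq_square)
    finally show "K * w h + backward (\<lambda>h. K * w h) h = - (real t * (1 + cos \<phi>)\<^sup>2 / ?\<Delta>) * w h" .
  qed
qed

end

section \<open>Positivity of the eigenvalues\<close>

lemma denominator_pos:
  assumes "5 \<le> t"
  shows "0 < real t * (real t - 3) - 2 * cos x" "2 * real t - 2 \<le> real t * (real t - 3) - 2 * cos x"
proof -
  have "real t * 2 \<le> real t * (real t - 3)" using assms by (intro mult_left_mono) auto
  then show "2 * real t - 2 \<le> real t * (real t - 3) - 2 * cos x" using cos_le_one[of x] by linarith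
  then show "0 < real t * (real t - 3) - 2 * cos x" using assms by linarith
qed

text \<open>The bound 4 on \<open>u\<close> serves both classes, with \<open>2 * (1 + cos x)\<close>
  and \<open>(1 + cos x)\<^sup>2\<close>. It is beaten since 4t < 3(2t - 2) and 3 \<le> t - 2 from
  five treatments on.\<close>

lemma theta_pos:
  assumes t: "5 \<le> t" and u: "u \<le> 4"
  shows "0 < real t / (real t - 1) * (real t - 2 - real t * u / (real t * (real t - 3) - 2 * cos x))"
proof -
  let ?\<Delta> = "real t * (real t - 3) - 2 * cos x"
  have "real t * u \<le> real t * 4" using u t by (intro mult_left_mono) auto
  also have "\<dots> < 3 * (2 * real t - 2)" using t by simp
  also have "\<dots> \<le> 3 * ?\<Delta>" using denominator_pos(2)[OF t, of x] by simp
  also have "\<dots> \<le> (real t - 2) * ?\<Delta>" using t denominator_pos(1)[OF t, of x] by (intro mult_right_mono) auto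
  finally have "real t * u / ?\<Delta> < real t - 2"
    using denominator_pos(1)[OF t, of x] by (simp add: pos_divide_less_eq)
  then show ?thesis using t by (intro mult_pos_pos divide_pos_pos) auto
qed

section \<open>Comparing implemented designs\<close>

lemma set_obs_implemented:
  assumes "A \<subseteq> {..<subjects d}" "1 \<le> periods d"
  shows "set (obs (implemented d A)) = {..<periods d - 1} \<times> {..<subjects d} \<union> {periods d - 1} \<times> A"
  using assms by (auto simp: set_obs implemented_def)

lemma implemented_simps [simp]:
  "treatments (implemented d A) = treatments d" "subjects (implemented d A) = subjects d"
  "periods (implemented d A) = periods d" "assign (implemented d A) = assign d"
  by (simp_all add: implemented_def)

text \<open>Serves twice: from \<open>d_min\<close> to the implemented design, where it also yields
  connectedness, and from there to the planned design.\<close>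

lemma centered_pd_info_mono:
  assumes "centered_pd (treatments d) (info_matrix d)" "valid_assign d" "valid_assign d'"
    "treatments d' = treatments d" "assign d' = assign d" "set (obs d) \<subseteq> set (obs d')"
    "0 < treatments d"
  shows "centered_pd (treatments d) (info_matrix d')"
    and "mat_trace (moore_penrose (info_matrix d')) \<le> mat_trace (moore_penrose (info_matrix d))"
proof -
  have le: "v \<bullet> (info_matrix d *\<^sub>v v) \<le> v \<bullet> (info_matrix d' *\<^sub>v v)"
    if "v \<in> carrier_vec (treatments d)" for v
  proof -
    have "vec (treatments d) (\<lambda>i. v $ i) = v" using that by (intro eq_vecI) auto
    then show ?thesis using info_matrix_mono[OF assms(2-6), of "\<lambda>i. v $ i"] by simp
  qed
  show "centered_pd (treatments d) (info_matrix d')"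
    by (rule centered_pd_mono[OF assms(1) _ _ _ le])
      (use info_matrix_carrier[of d'] info_matrix_symmetric[OF assms(3)] info_matrix_one[OF assms(3)]
        assms(4) in \<open>auto simp: one_vec_def\<close>)
  then show "mat_trace (moore_penrose (info_matrix d')) \<le> mat_trace (moore_penrose (info_matrix d))"
    by (rule trace_pinv_antimono[OF assms(1) _ assms(7) le])
qed

lemma H_eff_centered_pd:
  assumes "centered_pd (treatments d) (info_matrix d)" "0 < treatments d"
  shows "H_eff d = real (treatments d - 1) / mat_trace (moore_penrose (info_matrix d))"
  using centered_pd_rank[OF assms] by (simp add: H_eff_def is_connected_def)

text \<open>Both classes end here and differ only in the eigenvalues \<open>g * \<theta> r\<close>.
  The planned design contributes \<open>(t - 1) / L\<close>, the origin of the rational factor in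
  \<open>t\<close>, and \<open>g\<close> cancels in the ratio.\<close>

lemma loss_of_layout:
  assumes t5: "5 \<le> t" and layout: "crossover_layout t (subjects d) g (assign d) N"
    and d: "treatments d = t" "periods d = t" "observed d = {..<t} \<times> {..<subjects d}"
    and pos: "bij_betw pos {..<t} {..<t}"
    and eig: "\<And>r \<delta>. 0 < r \<Longrightarrow> r < t \<Longrightarrow> info_matrix (d_min d) *\<^sub>v vec t (wave t pos r \<delta>) =
      (g * \<theta> r) \<cdot>\<^sub>v vec t (wave t pos r \<delta>)"
    and \<theta>: "\<And>r. 0 < r \<Longrightarrow> r < t \<Longrightarrow> 0 < \<theta> r"
    and A: "A \<subseteq> {..<subjects d}"
  shows "loss (implemented d A) d \<le> loss (d_min d) d"
    and "loss (d_min d) d = 1 - (real t - 1) * ((real t)\<^sup>2 - real t - 1) /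
      (real t * (real t - 2) * (real t + 1)) * inverse (\<Sum>r = 1..t-1. 1 / \<theta> r)"
proof -
  interpret crossover_layout t "subjects d" g "assign d" N by (rule layout)
  have valid: "valid_assign d" using range d by (auto simp: valid_assign_def)
  have valid': "valid_assign (implemented d B)" for B using valid by (simp add: valid_assign_def)
  have t0: "0 < t" using t5 by simp
  define L where "L = g * real t * (real t - 2) * (real t + 1) / ((real t)\<^sup>2 - real t - 1)"
  have q: "0 < (real t)\<^sup>2 - real t - 1"
  proof -
    have "2 * real t \<le> real t * real t" using t5 by (intro mult_right_mono) auto
    then show ?thesis using t5 unfolding power2_eq_square by linarith
  qed
  have L: "0 < L" using q t5 g unfolding L_def by (intro divide_pos_pos mult_pos_pos) auto
  have obs_full: "set (obs d) = {..<t} \<times> {..<subjects d}" using d by (auto simp: set_obs)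
  have carr: "info_matrix e \<in> carrier_mat t t" "(info_matrix e)\<^sup>T = info_matrix e"
    "info_matrix e *\<^sub>v one_vec t = 0\<^sub>v t" if "valid_assign e" "treatments e = t" for e
    using info_matrix_carrier[of e] info_matrix_symmetric[OF that(1)] info_matrix_one[OF that(1)] that(2)
    by (simp_all add: one_vec_def)
  \<comment> \<open>Every wave of nonzero frequency is centred, so the trace formula applies to the
    planned design with constant eigenvalue \<open>L\<close>.\<close>
  have eig_full: "info_matrix d *\<^sub>v vec t (wave t pos r \<delta>) = L \<cdot>\<^sub>v vec t (wave t pos r \<delta>)"
    if "0 < r" "r < t" for r \<delta>
    unfolding L_def by (rule info_full_eigenvector[OF d(1) refl refl valid obs_full wave_sum_zero[OF pos that]])
  have plan: "centered_pd t (info_matrix d)"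
    "mat_trace (moore_penrose (info_matrix d)) = (\<Sum>r = 1..t-1. 1 / L)"
    by (rule trace_pinv_waves[where l = "\<lambda>_. L", OF carr[OF valid d(1)] t0 pos eig_full L], assumption+)+
  have Tp: "mat_trace (moore_penrose (info_matrix d)) = (real t - 1) / L"
    using plan(2) t5 by (simp add: of_nat_diff)
  have min_valid: "valid_assign (d_min d)" "treatments (d_min d) = t"
    using valid' d by (simp_all add: d_min_def)
  have g\<theta>: "0 < g * \<theta> r" if "0 < r" "r < t" for r using g \<theta>[OF that] by simp
  have min: "centered_pd t (info_matrix (d_min d))"
    "mat_trace (moore_penrose (info_matrix (d_min d))) = (\<Sum>r = 1..t-1. 1 / (g * \<theta> r))"
    by (rule trace_pinv_waves[where l = "\<lambda>r. g * \<theta> r", OF carr[OF min_valid] t0 pos eig g\<theta>], assumption+)+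
  have Tm: "mat_trace (moore_penrose (info_matrix (d_min d))) = (\<Sum>r = 1..t-1. 1 / \<theta> r) / g"
    using min(2) by (simp add: sum_divide_distrib mult.commute)
  let ?i = "implemented d A"
  have obs_i: "set (obs ?i) = {..<t - 1} \<times> {..<subjects d} \<union> {t - 1} \<times> A"
    using set_obs_implemented[OF A] d t5 by simp
  have obs_m: "set (obs (d_min d)) = {..<t - 1} \<times> {..<subjects d}"
    using set_obs_implemented[of "{}" d] d t5 by (simp add: d_min_def)
  have sub: "set (obs (d_min d)) \<subseteq> set (obs ?i)" "set (obs ?i) \<subseteq> set (obs d)"
    unfolding obs_i obs_m obs_full using A t5 by auto
  have "centered_pd (treatments (d_min d)) (info_matrix (d_min d))" using min(1) min_valid(2) by simp
  note imp = centered_pd_info_mono[OF this min_valid(1) valid'[of A] _ _ sub(1), simplified min_valid d(1)]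
  have imp_pd: "centered_pd t (info_matrix ?i)" and
    imp_le: "mat_trace (moore_penrose (info_matrix ?i)) \<le> mat_trace (moore_penrose (info_matrix (d_min d)))"
    using imp d t0 by (simp_all add: d_min_def)
  \<comment> \<open>With \<open>Tp_pos\<close> this makes the trace of the implemented design
    positive, so that the quotients can be compared.\<close>
  have imp_ge: "mat_trace (moore_penrose (info_matrix d)) \<le> mat_trace (moore_penrose (info_matrix ?i))"
    using centered_pd_info_mono(2)[of ?i d] imp_pd valid' valid sub(2) d t0 by simp
  have Tp_pos: "0 < mat_trace (moore_penrose (info_matrix d))" using Tp L t5 by simp
  have H: "H_eff e = (real t - 1) / mat_trace (moore_penrose (info_matrix e))"
    if "centered_pd t (info_matrix e)" "treatments e = t" for e
    using H_eff_centered_pd[of e] that t5 by (simp add: of_nat_diff)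
  have ratio: "(c / P - c / M) / (c / P) = 1 - P / M" if "0 < c" "0 < P" for c P M :: real
    unfolding diff_divide_distrib[of "c / P" "c / M" "c / P"] using that by simp
  have loss: "loss e d = 1 - mat_trace (moore_penrose (info_matrix d)) / mat_trace (moore_penrose (info_matrix e))"
    if "centered_pd t (info_matrix e)" "treatments e = t" for e
    unfolding loss_def H[OF that] H[OF plan(1) d(1)] by (rule ratio) (use Tp_pos t5 in auto)
  show "loss ?i d \<le> loss (d_min d) d"
    unfolding loss[OF imp_pd, simplified, OF d(1)] loss[OF min(1) min_valid(2)]
    using Tp_pos imp_ge imp_le by (simp add: divide_left_mono mult_pos_pos)
  have "0 < (\<Sum>r = 1..t-1. 1 / \<theta> r)"
    by (rule sum_pos) (use t5 \<theta> in auto)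
  then show "loss (d_min d) d = 1 - (real t - 1) * ((real t)\<^sup>2 - real t - 1) /
      (real t * (real t - 2) * (real t + 1)) * inverse (\<Sum>r = 1..t-1. 1 / \<theta> r)"
    unfolding loss[OF min(1) min_valid(2)] Tp Tm L_def using g q t5 by (simp add: divide_simps)
qed

section \<open>Fitting the two classes into the common layout\<close>

lemma perm_sum_delta:
  fixes t :: nat
  assumes "\<sigma> permutes {..<t}" "k < t"
  shows "(\<Sum>h<t. (if \<sigma> k = \<sigma> h then 1 else 0) * f h) = (f k :: real)"
proof -
  have "(\<Sum>h<t. (if \<sigma> k = \<sigma> h then 1 else 0) * f h) = (\<Sum>h<t. if k = h then f h else 0)"
    using permutes_inj[OF assms(1)] by (intro sum.cong) (auto dest: injD)
  then show ?thesis using assms(2) by simp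
qed

lemma loss_class_A:
  assumes t5: "5 \<le> t" and A: "class_A t g d"
    and \<theta>: "\<forall>r\<in>{1..t-1}. \<theta> r = real t / (real t - 1) *
      (real t - 2 - 2 * real t * (1 + cos (2 * pi * real r / real t)) /
         (real t * (real t - 3) - 2 * cos (2 * pi * real r / real t)))"
    and sub: "S \<subseteq> {..<subjects d}"
  shows "loss (implemented d S) d \<le> loss (d_min d) d"
    and "loss (d_min d) d = 1 - (real t - 1) * ((real t)\<^sup>2 - real t - 1) /
      (real t * (real t - 2) * (real t + 1)) * inverse (\<Sum>r = 1..t-1. 1 / \<theta> r)"
proof -
  obtain W where g: "0 < g" and W: "UBRMD t t W" and simple: "eigenvalue_one_simple (Pi_mat t W)"
    and plan: "plan t t g W d"
    using A unfolding class_A_def by blast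
  have t2: "2 \<le> t" and t0: "0 < t" using t5 by simp_all
  have W1: "UBRMD t (1 * t) W" using W by simp
  \<comment> \<open>In a square, uniformity makes each treatment occur once per period; Class B has
    to demand this of the last two rows of each half.\<close>
  have rp: "row_permutation t W k" if "k < t" for k
    using UBRMD_period_count[OF W1 t2 that] by (intro row_permutationI) simp
  have range: "W k i < t" if "k < t" "i < t" for k i using W that by (auto simp: UBRMD_def)
  obtain \<sigma> where \<sigma>: "\<sigma> permutes {..<t}" and Pi: "Pi_mat t W = perm_mat t \<sigma>"
    and sum: "\<And>F :: nat \<Rightarrow> nat \<Rightarrow> real. (\<Sum>i<t. F (W (t - 2) i) (W (t - 1) i)) = (\<Sum>h<t. F h (\<sigma> h))"
    using last_rows_permutation[OF rp rp range t2] t5 by auto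
  have \<sigma>_lt: "\<sigma> h < t" if "h < t" for h using permutes_in_image[OF \<sigma>, of h] that by simp
  obtain pos where pos: "bij_betw pos {..<t} {..<t}" and nxt: "\<And>h. h < t \<Longrightarrow> pos (\<sigma> h) = Suc (pos h) mod t"
    using cycle_positions[OF \<sigma> eigenvalue_one_simple_transitive[OF \<sigma> simple[unfolded Pi] t0] t0] by blast
  define N where "N h h' = (if h' = \<sigma> h then 1 else 0 :: real)" for h h'
  have "(\<Sum>h'<t. N h h' * F h h') = F h (\<sigma> h)" if "h < t" for h and F :: "nat \<Rightarrow> nat \<Rightarrow> real"
  proof -
    have "(\<Sum>h'<t. N h h' * F h h') = (\<Sum>h'<t. if h' = \<sigma> h then F h h' else 0)"
      by (rule sum.cong) (auto simp: N_def)
    then show ?thesis using \<sigma>_lt[OF that] by simp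
  qed
  note N_sum = this
  have layout: "crossover_layout t (subjects d) (real (1 * g)) (assign d) N"
    by (rule layout_of_plan[OF W1 t2 g]) (use plan sum N_sum in simp_all)
  interpret crossover_layout t "subjects d" "real g" "assign d" N using layout by simp
  have d: "treatments d = t" "periods d = t" "observed d = {..<t} \<times> {..<subjects d}"
    using plan by (auto simp: plan_def)
  have dm: "treatments (d_min d) = t" "subjects (d_min d) = subjects d" "assign (d_min d) = assign d"
    "valid_assign (d_min d)" "set (obs (d_min d)) = {..<t - 1} \<times> {..<subjects d}"
    using d range set_obs_implemented[of "{}" d] t5 by (auto simp: d_min_def valid_assign_def)
  have fw: "forward (wave t pos r \<delta>) h = wave t pos r (\<delta> - 2 * pi * real r / real t) h"
    if "h < t" for r \<delta> h
    using N_sum[OF that, of "\<lambda>_. wave t pos r \<delta>"] wave_next[where pos = pos, OF nxt[OF that] t0, of r \<delta>]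
    by (simp add: forward_def)
  \<comment> \<open>The transpose of a permutation matrix is its inverse, so \<open>backward\<close>
    steps back along the cycle and raises the phase.\<close>
  have bw: "backward (wave t pos r \<delta>) h = wave t pos r (\<delta> + 2 * pi * real r / real t) h"
    if h: "h < t" for r \<delta> h
  proof -
    obtain k where k: "k < t" "h = \<sigma> k" using h permutes_image[OF \<sigma>] by (metis imageE lessThan_iff)
    have "backward (wave t pos r \<delta>) h = wave t pos r \<delta> k"
      using perm_sum_delta[OF \<sigma> k(1), of "wave t pos r \<delta>"] by (simp add: backward_def N_def k(2))
    then show ?thesis
      using wave_next[where pos = pos, OF nxt[OF k(1)] t0, of r "\<delta> + 2 * pi * real r / real t"] k(2) by simp
  qed
  have eig: "info_matrix (d_min d) *\<^sub>v vec t (wave t pos r \<delta>) = (real g * \<theta> r) \<cdot>\<^sub>v vec t (wave t pos r \<delta>)"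
    if r: "0 < r" "r < t" for r \<delta>
    using info_short_wave_A[OF dm wave_sum_zero[OF pos r] fw bw wave_shift_sum denominator_pos(1)[OF t5]]
      \<theta> r by auto
  have \<theta>_pos: "0 < \<theta> r" if "0 < r" "r < t" for r
  proof -
    have "2 * (1 + cos (2 * pi * real r / real t)) \<le> 4" by simp
    from theta_pos[OF t5 this, of "2 * pi * real r / real t"] show ?thesis
      using \<theta> that by (auto simp: mult_ac)
  qed
  show "loss (implemented d S) d \<le> loss (d_min d) d"
    "loss (d_min d) d = 1 - (real t - 1) * ((real t)\<^sup>2 - real t - 1) /
      (real t * (real t - 2) * (real t + 1)) * inverse (\<Sum>r = 1..t-1. 1 / \<theta> r)"
    using loss_of_layout[OF t5 crossover_layout_axioms d pos eig \<theta>_pos sub] by blast+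
qed

lemma loss_class_B:
  assumes t5: "5 \<le> t" and B: "class_B t g d"
    and \<theta>: "\<forall>r\<in>{1..t-1}. \<theta> r = real t / (real t - 1) *
      (real t - 2 - real t * (1 + cos (2 * pi * real r / real t))\<^sup>2 /
         (real t * (real t - 3) - 2 * cos (2 * pi * real r / real t)))"
    and sub: "S \<subseteq> {..<subjects d}"
  shows "loss (implemented d S) d \<le> loss (d_min d) d"
    and "loss (d_min d) d = 1 - (real t - 1) * ((real t)\<^sup>2 - real t - 1) /
      (real t * (real t - 2) * (real t + 1)) * inverse (\<Sum>r = 1..t-1. 1 / \<theta> r)"
proof -
  obtain W1 W2 where g: "0 < g" "even g" and W: "UBRMD t (2 * t) (juxtapose t W1 W2)"
    and rp: "row_permutation t W1 (t - 2)" "row_permutation t W1 (t - 1)"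
      "row_permutation t W2 (t - 2)" "row_permutation t W2 (t - 1)"
    and simple: "eigenvalue_one_simple (Pi_mat t W1)"
    and transp: "Pi_mat t W2 = (Pi_mat t W1)\<^sup>T"
    and plan: "plan t (2 * t) (g div 2) (juxtapose t W1 W2) d"
    using B unfolding class_B_def by blast
  let ?W = "juxtapose t W1 W2"
  have t2: "2 \<le> t" and t0: "0 < t" using t5 by simp_all
  have range: "?W k i < t" if "k < t" "i < 2 * t" for k i using W that by (auto simp: UBRMD_def)
  have range1: "W1 k i < t" if "k < t" "i < t" for k i
    using range[of k i] that by (simp add: juxtapose_def)
  have range2: "W2 k i < t" if "k < t" "i < t" for k i
    using range[of k "t + i"] that by (simp add: juxtapose_def)
  obtain \<sigma> where \<sigma>: "\<sigma> permutes {..<t}" and Pi: "Pi_mat t W1 = perm_mat t \<sigma>"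
    and sum1: "\<And>F :: nat \<Rightarrow> nat \<Rightarrow> real. (\<Sum>i<t. F (W1 (t - 2) i) (W1 (t - 1) i)) = (\<Sum>h<t. F h (\<sigma> h))"
    using last_rows_permutation[OF rp(1,2) range1 t2] by blast
  obtain \<tau> where \<tau>: "\<tau> permutes {..<t}" and Pi2: "Pi_mat t W2 = perm_mat t \<tau>"
    and sum2: "\<And>F :: nat \<Rightarrow> nat \<Rightarrow> real. (\<Sum>i<t. F (W2 (t - 2) i) (W2 (t - 1) i)) = (\<Sum>h<t. F h (\<tau> h))"
    using last_rows_permutation[OF rp(3,4) range2 t2] by blast
  have \<sigma>_lt: "\<sigma> h < t" if "h < t" for h using permutes_in_image[OF \<sigma>, of h] that by simp
  have \<tau>_lt: "\<tau> h < t" if "h < t" for h using permutes_in_image[OF \<tau>, of h] that by simp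
  \<comment> \<open>\<open>\<Pi>\<^sub>2 = \<Pi>\<^sub>1'\<close> says that \<open>\<tau>\<close>
    inverts \<open>\<sigma>\<close> on the labels; both squares thus share one cycle, run in
    opposite directions.\<close>
  have inverse: "h = \<tau> h' \<longleftrightarrow> h' = \<sigma> h" if "h < t" "h' < t" for h h'
  proof -
    have "perm_mat t \<tau> $$ (h, h') = perm_mat t \<sigma> $$ (h', h)"
      using transp that unfolding Pi Pi2 by (simp add: perm_mat_def)
    then show ?thesis using that by (simp add: perm_mat_def split: if_splits)
  qed
  obtain pos where pos: "bij_betw pos {..<t} {..<t}" and nxt: "\<And>h. h < t \<Longrightarrow> pos (\<sigma> h) = Suc (pos h) mod t"
    using cycle_positions[OF \<sigma> eigenvalue_one_simple_transitive[OF \<sigma> simple[unfolded Pi] t0] t0] by blast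
  \<comment> \<open>Each square receives half of the subjects, hence the mean of the two permutation
    matrices.\<close>
  define N where "N h h' = ((if h' = \<sigma> h then 1 else 0) + (if h' = \<tau> h then 1 else 0)) / (2 :: real)" for h h'
  have N_sum: "(\<Sum>h'<t. N h h' * F h h') = (F h (\<sigma> h) + F h (\<tau> h)) / 2" if "h < t"
    for h and F :: "nat \<Rightarrow> nat \<Rightarrow> real"
  proof -
    have "(\<Sum>h'<t. N h h' * F h h') =
        (\<Sum>h'<t. (if h' = \<sigma> h then F h h' / 2 else 0) + (if h' = \<tau> h then F h h' / 2 else 0))"
      by (rule sum.cong) (auto simp: N_def)
    then show ?thesis using \<sigma>_lt[OF that] \<tau>_lt[OF that] by (simp add: sum.distrib add_divide_distrib)
  qed
  have N_sym: "N h h' = N h' h" if "h < t" "h' < t" for h h'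
    using inverse[OF that] inverse[OF that(2,1)] by (auto simp: N_def)
  have last: "(\<Sum>i<2 * t. F (?W (t - 2) i) (?W (t - 1) i)) = real 2 * (\<Sum>h<t. \<Sum>h'<t. N h h' * F h h')"
    for F :: "nat \<Rightarrow> nat \<Rightarrow> real"
  proof -
    have "(\<Sum>i<2 * t. F (?W (t - 2) i) (?W (t - 1) i)) =
        (\<Sum>i<t. F (W1 (t - 2) i) (W1 (t - 1) i)) + (\<Sum>i<t. F (W2 (t - 2) i) (W2 (t - 1) i))"
      unfolding mult_2 sum_lessThan_add by (simp add: juxtapose_def)
    also have "\<dots> = (\<Sum>h<t. F h (\<sigma> h)) + (\<Sum>h<t. F h (\<tau> h))" unfolding sum1 sum2 ..
    also have "\<dots> = real 2 * (\<Sum>h<t. \<Sum>h'<t. N h h' * F h h')"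
      by (simp add: N_sum sum.distrib flip: sum_divide_distrib)
    finally show ?thesis .
  qed
  have g2: "0 < g div 2" and gg: "real (2 * (g div 2)) = real g" using g by (auto elim: evenE)
  have layout: "crossover_layout t (subjects d) (real (2 * (g div 2))) (assign d) N"
    by (rule layout_of_plan[OF W t2 g2 plan last])
  interpret crossover_layout t "subjects d" "real g" "assign d" N using layout unfolding gg .
  have d: "treatments d = t" "periods d = t" "observed d = {..<t} \<times> {..<subjects d}"
    using plan by (auto simp: plan_def)
  have dm: "treatments (d_min d) = t" "subjects (d_min d) = subjects d" "assign (d_min d) = assign d"
    "valid_assign (d_min d)" "set (obs (d_min d)) = {..<t - 1} \<times> {..<subjects d}"
    using d crossover_layout.range[OF crossover_layout_axioms] set_obs_implemented[of "{}" d] t5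
    by (auto simp: d_min_def valid_assign_def)
  \<comment> \<open>Averaging a step along the cycle and a step back makes the phase shifts cancel
    and leaves the factor \<open>cos\<close>.\<close>
  have fw: "forward (wave t pos r \<delta>) h = cos (2 * pi * real r / real t) * wave t pos r \<delta> h"
    if h: "h < t" for r \<delta> h
  proof -
    let ?\<phi> = "2 * pi * real r / real t"
    have "\<sigma> (\<tau> h) = h" using inverse[OF \<tau>_lt[OF h] h] by simp
    then have "wave t pos r (\<delta> + ?\<phi>) h = wave t pos r \<delta> (\<tau> h)"
      using wave_next[where pos = pos, OF nxt[OF \<tau>_lt[OF h]] t0, of r "\<delta> + ?\<phi>"] by simp
    moreover have "wave t pos r (\<delta> - ?\<phi>) h = wave t pos r \<delta> (\<sigma> h)"
      using wave_next[where pos = pos, OF nxt[OF h] t0, of r \<delta>] by simp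
    ultimately show ?thesis
      using N_sum[OF h, of "\<lambda>_. wave t pos r \<delta>"] wave_shift_sum[of t pos r \<delta> ?\<phi> h]
      by (simp add: forward_def)
  qed
  have bw: "backward f h = forward f h" if "h < t" for f h
    unfolding backward_def forward_def using that by (intro sum.cong) (auto simp: N_sym)
  have eig: "info_matrix (d_min d) *\<^sub>v vec t (wave t pos r \<delta>) = (real g * \<theta> r) \<cdot>\<^sub>v vec t (wave t pos r \<delta>)"
    if r: "0 < r" "r < t" for r \<delta>
    using info_short_wave_B[OF dm wave_sum_zero[OF pos r] fw _ denominator_pos(1)[OF t5]]
      \<theta> r bw fw by auto
  have \<theta>_pos: "0 < \<theta> r" if "0 < r" "r < t" for r
  proof -
    let ?c = "cos (2 * pi * real r / real t)"
    have "(1 + ?c)\<^sup>2 \<le> 2\<^sup>2" 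
      using cos_ge_minus_one[of "2 * pi * real r / real t"] cos_le_one[of "2 * pi * real r / real t"]
      by (intro power_mono) linarith+
    then have "(1 + ?c)\<^sup>2 \<le> 4" by simp
    from theta_pos[OF t5 this, of "2 * pi * real r / real t"] show ?thesis
      using \<theta> that by auto
  qed
  show "loss (implemented d S) d \<le> loss (d_min d) d"
    "loss (d_min d) d = 1 - (real t - 1) * ((real t)\<^sup>2 - real t - 1) /
      (real t * (real t - 2) * (real t + 1)) * inverse (\<Sum>r = 1..t-1. 1 / \<theta> r)"
    using loss_of_layout[OF t5 crossover_layout_axioms d pos eig \<theta>_pos sub] by blast+
qed

theorem corollary11:
  fixes t g :: nat and d_plan d_imp :: design and A :: "nat set" and \<theta> :: "nat \<Rightarrow> real"
  assumes "t \<ge> 5"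
    and "class_A t g d_plan \<and>
           (\<forall>r\<in>{1..t-1}. \<theta> r = real t / (real t - 1) *
              (real t - 2 - 2 * real t * (1 + cos (2 * pi * real r / real t)) /
                 (real t * (real t - 3) - 2 * cos (2 * pi * real r / real t))))
       \<or> class_B t g d_plan \<and>
           (\<forall>r\<in>{1..t-1}. \<theta> r = real t / (real t - 1) *
              (real t - 2 - real t * (1 + cos (2 * pi * real r / real t))\<^sup>2 /
                 (real t * (real t - 3) - 2 * cos (2 * pi * real r / real t))))"
    and "A \<subseteq> {..<subjects d_plan}"
    and "d_imp = implemented d_plan A"
  shows "loss d_imp d_plan \<le> loss (d_min d_plan) d_plan \<and>
         loss (d_min d_plan) d_plan = max_loss d_plan \<and>
         max_loss d_plan =
           1 - (real t - 1) * ((real t)\<^sup>2 - real t - 1) / (real t * (real t - 2) * (real t + 1)) *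
               inverse (\<Sum>r = 1..t-1. 1 / \<theta> r)"
  using assms(2)
proof
  assume "class_A t g d_plan \<and>
           (\<forall>r\<in>{1..t-1}. \<theta> r = real t / (real t - 1) *
              (real t - 2 - 2 * real t * (1 + cos (2 * pi * real r / real t)) /
                 (real t * (real t - 3) - 2 * cos (2 * pi * real r / real t))))"
  then show ?thesis
    using loss_class_A[OF assms(1) _ _ assms(3)] unfolding assms(4) max_loss_def by blast
next
  assume "class_B t g d_plan \<and>
           (\<forall>r\<in>{1..t-1}. \<theta> r = real t / (real t - 1) *
              (real t - 2 - real t * (1 + cos (2 * pi * real r / real t))\<^sup>2 /
                 (real t * (real t - 3) - 2 * cos (2 * pi * real r / real t))))"
  then show ?thesis
    using loss_class_B[OF assms(1) _ _ assms(3)] unfolding assms(4) max_loss_def by blast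
qed

end
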